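(* Let $\Omega_1\subset\mathbb{R}^{N_1}$ and $\Omega_2\subset\mathbb{R}^{N_2}$ be regions satisfying (B1) and (B2), and let $\Omega_p:=\Omega_1\times\Omega_2$. Let $\{\lambda_{1j}\}_{j\in\mathbb{N}}$, $\{f_{1j}\}_{j\in\mathbb{N}}$ and $\{\lambda_{2k}\}_{k\in\mathbb{N}}$, $\{f_{2k}\}_{k\in\mathbb{N}}$ be the sequences of Neumann Laplacian eigenvalues and eigenfunctions on $\Omega_1$ and $\Omega_2$ respectively, and put $u_{jk}:=f_{1j}\otimes f_{2k}$, $$v_{jk}:=\left(\frac{(1+\lambda_{1j})(1+\lambda_{2k})}{1+\lambda_{1j}+\lambda_{2k}}\right)^{1/2}u_{jk},\qquad \tilde v_{jk}:=(1+\lambda_{1j})^{1/2}(1+\lambda_{2k})^{1/2}\,u_{jk},$$ $\mathcal{V}:=\{v_{jk}:j,k\in\mathbb{N}\}$ and $\widetilde{\mathcal{V}}:=\{\tilde v_{jk}:j,k\in\mathbb{N}\}$. Then $\mathcal{V}$ is an orthonormal basis of $H^1(\Omega_p)$ (with its standard inner product), $\widetilde{\mathcal{V}}$ is an orthonormal basis of $L^2(\Omega_p)$, and $H^1(\Omega_p)=H^1(\Omega_1)\otimes H^1(\Omega_2)$, where $\otimes$ between spaces denotes the Hilbert tensor product.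
   Context: A region is a nonempty, connected, open subset of $\mathbb{R}^N$. All function spaces are real. Condition (B1) on a region $\Omega\subset\mathbb{R}^N$: $\Omega$ is bounded and its boundary $\partial\Omega:=\overline{\Omega}\setminus\Omega$ is the union of a finite number of disjoint closed Lipschitz surfaces, each having finite surface area. Condition (B2): $\Omega$ satisfies (B1); the imbedding of $H^1(\Omega)$ into $L^p(\Omega)$ is compact for $1\le p<p_s$, where $p_s=2N/(N-2)$ if $N\ge3$ and $p_s=\infty$ if $N=2$ (Rellich theorem); and the trace map $\gamma:H^1(\Omega)\to L^2(\partial\Omega,d\sigma)$ is compact, $\sigma$ being $(N-1)$-dimensional Hausdorff measure ($L^2$-compact trace theorem). The standard inner product on $H^1(\Omega)$ is $[u,v]_{1,2}:=\int_\Omega(uv+\nabla u\cdot\nabla v)\,dx$. The Neumann Laplacian eigenproblem on $\Omega$ is to find $(\lambda,u)\in\mathbb{R}\times H^1(\Omega)$ with $u\ne0$ such that $\int_\Omega\nabla u\cdot\nabla h\,dx=\lambda\int_\Omega u\,h\,dx$ for all $h\in H^1(\Omega)$. When $\Omega$ satisfies (B1) and (B2), the Neumann eigendata on $\Omega$ are the increasing sequence $\{\lambda_k:k\in\mathbb{N}\}$ of all Neumann eigenvalues repeated according to multiplicity, $\lambda_k\to\infty$, and associated eigenfunctions $\{f_k:k\in\mathbb{N}\}$ forming a maximal orthonormal set in $H^1(\Omega)$ for $[\cdot,\cdot]_{1,2}$; then $\int_\Omega f_jf_k\,dx=\delta_{jk}/(1+\lambda_k)$ and $\{(1+\lambda_k)^{1/2}f_k\}$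 is a maximal orthonormal set in $L^2(\Omega)$. For functions $f$ on $\Omega_1$ and $g$ on $\Omega_2$, $(f\otimes g)(x,y):=f(x)g(y)$. Hilbert tensor product: for real separable Hilbert spaces $H_1\subset L^2(\Omega_1)$, $H_2\subset L^2(\Omega_2)$ with orthonormal bases $\{p_j\}$, $\{q_k\}$, $H_1\otimes H_2$ is the completion of the space of finite linear combinations $g=\sum\hat g_{jk}\,p_j\otimes q_k$ with respect to the inner product $\langle g,h\rangle_\otimes:=\sum_{j,k}\hat g_{jk}\hat h_{jk}$. Here $H^1(\Omega_1)$ and $H^1(\Omega_2)$ carry their standard inner products.
   Formalization: The identity H^1(Ω_p)=H^1(Ω_1)⊗H^1(Ω_2) is false as an equality of spaces, since ‖u_jk‖ in H^1(Ω_p) tends to 0; it is proved instead as an isometric identification sending u_jk to v_jk. *)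

theory Defs
  imports "HOL-Analysis.Analysis"
begin

(* Elements of L^2, H^1 etc. are represented by real functions on the whole type; only their
   restriction to the underlying set, up to null sets, matters. Accordingly the inner products
   below are positive semidefinite, and "zero" means "ip u u = 0", i.e. zero a.e. *)

section \<open>Inner product spaces of functions\<close>

definition ip_norm :: "(('x \<Rightarrow> real) \<Rightarrow> ('x \<Rightarrow> real) \<Rightarrow> real) \<Rightarrow> ('x \<Rightarrow> real) \<Rightarrow> real" where
  "ip_norm ip u = sqrt (ip u u)"

definition orthonormal ::
  "('x \<Rightarrow> real) set \<Rightarrow> (('x \<Rightarrow> real) \<Rightarrow> ('x \<Rightarrow> real) \<Rightarrow> real) \<Rightarrow> ('i \<Rightarrow> 'x \<Rightarrow> real) \<Rightarrow> bool" where
  "orthonormal S ip e \<longleftrightarrow> (\<forall>i. e i \<in> S) \<and> (\<forall>i j. ip (e i) (e j) = (if i = j then 1 else 0))"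

definition maximal_orthonormal ::
  "('x \<Rightarrow> real) set \<Rightarrow> (('x \<Rightarrow> real) \<Rightarrow> ('x \<Rightarrow> real) \<Rightarrow> real) \<Rightarrow> ('i \<Rightarrow> 'x \<Rightarrow> real) \<Rightarrow> bool" where
  "maximal_orthonormal S ip e \<longleftrightarrow>
     orthonormal S ip e \<and> (\<forall>u\<in>S. (\<forall>i. ip u (e i) = 0) \<longrightarrow> ip u u = 0)"

definition ip_dense ::
  "('x \<Rightarrow> real) set \<Rightarrow> (('x \<Rightarrow> real) \<Rightarrow> ('x \<Rightarrow> real) \<Rightarrow> real) \<Rightarrow> ('x \<Rightarrow> real) set \<Rightarrow> bool" where
  "ip_dense S ip A \<longleftrightarrow>
     A \<subseteq> S \<and> (\<forall>u\<in>S. \<forall>\<epsilon>>0. \<exists>a\<in>A. ip_norm ip (\<lambda>x. u x - a x) < \<epsilon>)"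

definition ip_complete ::
  "('x \<Rightarrow> real) set \<Rightarrow> (('x \<Rightarrow> real) \<Rightarrow> ('x \<Rightarrow> real) \<Rightarrow> real) \<Rightarrow> bool" where
  "ip_complete S ip \<longleftrightarrow>
     (\<forall>s :: nat \<Rightarrow> 'x \<Rightarrow> real. (\<forall>n. s n \<in> S) \<longrightarrow>
        (\<forall>\<epsilon>>0. \<exists>N. \<forall>m\<ge>N. \<forall>n\<ge>N. ip_norm ip (\<lambda>x. s m x - s n x) < \<epsilon>) \<longrightarrow>
        (\<exists>u\<in>S. (\<lambda>n. ip_norm ip (\<lambda>x. s n x - u x)) \<longlonglongrightarrow> 0))"

definition finite_combinations :: "('i \<Rightarrow> 'x \<Rightarrow> real) \<Rightarrow> ('x \<Rightarrow> real) set" where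
  "finite_combinations e = {\<lambda>x. \<Sum>i\<in>F. c i * e i x | F c. finite F}"

definition orthonormal_basis ::
  "('x \<Rightarrow> real) set \<Rightarrow> (('x \<Rightarrow> real) \<Rightarrow> ('x \<Rightarrow> real) \<Rightarrow> real) \<Rightarrow> ('i \<Rightarrow> 'x \<Rightarrow> real) \<Rightarrow> bool" where
  "orthonormal_basis S ip e \<longleftrightarrow> orthonormal S ip e \<and> ip_dense S ip (finite_combinations e)"

definition compact_map ::
  "('x \<Rightarrow> real) set \<Rightarrow> (('x \<Rightarrow> real) \<Rightarrow> real) \<Rightarrow> ('y \<Rightarrow> real) set \<Rightarrow> (('y \<Rightarrow> real) \<Rightarrow> real) \<Rightarrow>
     (('x \<Rightarrow> real) \<Rightarrow> ('y \<Rightarrow> real)) \<Rightarrow> bool" where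
  "compact_map S nrm T nrm' A \<longleftrightarrow>
     (\<forall>u\<in>S. A u \<in> T) \<and>
     (\<forall>s :: nat \<Rightarrow> 'x \<Rightarrow> real. (\<forall>n. s n \<in> S) \<and> (\<exists>C. \<forall>n. nrm (s n) \<le> C) \<longrightarrow>
        (\<exists>r w. strict_mono r \<and> w \<in> T \<and> (\<lambda>n. nrm' (\<lambda>y. A (s (r n)) y - w y)) \<longlonglongrightarrow> 0))"

section \<open>Lebesgue spaces\<close>

definition Lp :: "'x measure \<Rightarrow> real \<Rightarrow> ('x \<Rightarrow> real) set" where
  "Lp M p = {u \<in> borel_measurable M. integrable M (\<lambda>x. \<bar>u x\<bar> powr p)}"

definition Lp_norm :: "'x measure \<Rightarrow> real \<Rightarrow> ('x \<Rightarrow> real) \<Rightarrow> real" where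
  "Lp_norm M p u = (\<integral>x. \<bar>u x\<bar> powr p \<partial>M) powr (1 / p)"

definition L2 :: "'x measure \<Rightarrow> ('x \<Rightarrow> real) set" where
  "L2 M = {u \<in> borel_measurable M. integrable M (\<lambda>x. (u x)\<^sup>2)}"

definition L2_ip :: "'x measure \<Rightarrow> ('x \<Rightarrow> real) \<Rightarrow> ('x \<Rightarrow> real) \<Rightarrow> real" where
  "L2_ip M u v = (\<integral>x. u x * v x \<partial>M)"

(* Borel representatives suffice: every Lebesgue measurable function is a.e. equal to one. *)
definition leb :: "'a::euclidean_space set \<Rightarrow> 'a measure" where
  "leb \<Omega> = restrict_space lborel \<Omega>"

section \<open>The Sobolev space $H^1$\<close>

definition region :: "'a::euclidean_space set \<Rightarrow> bool" where
  "region \<Omega> \<longleftrightarrow> \<Omega> \<noteq> {} \<and> connected \<Omega> \<and> open \<Omega>"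

(* C^infinity: f and all its iterated partial derivatives are differentiable everywhere. *)
coinductive smooth :: "('a::euclidean_space \<Rightarrow> real) \<Rightarrow> bool" where
  "(\<forall>x. f differentiable (at x)) \<Longrightarrow>
   (\<forall>b\<in>Basis. smooth (\<lambda>x. frechet_derivative f (at x) b)) \<Longrightarrow> smooth f"

definition test_functions :: "'a::euclidean_space set \<Rightarrow> ('a \<Rightarrow> real) set" where
  "test_functions \<Omega> =
     {\<phi>. smooth \<phi> \<and> compact (closure {x. \<phi> x \<noteq> 0}) \<and> closure {x. \<phi> x \<noteq> 0} \<subseteq> \<Omega>}"

definition L2_weak_gradient ::
  "'a::euclidean_space set \<Rightarrow> ('a \<Rightarrow> real) \<Rightarrow> ('a \<Rightarrow> 'a) \<Rightarrow> bool" where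
  "L2_weak_gradient \<Omega> u G \<longleftrightarrow>
     (\<forall>b\<in>Basis. (\<lambda>x. G x \<bullet> b) \<in> L2 (leb \<Omega>) \<and>
        (\<forall>\<phi>\<in>test_functions \<Omega>.
           (\<integral>x. u x * frechet_derivative \<phi> (at x) b \<partial>leb \<Omega>) = - (\<integral>x. (G x \<bullet> b) * \<phi> x \<partial>leb \<Omega>)))"

definition H1 :: "'a::euclidean_space set \<Rightarrow> ('a \<Rightarrow> real) set" where
  "H1 \<Omega> = {u \<in> L2 (leb \<Omega>). \<exists>G. L2_weak_gradient \<Omega> u G}"

(* The weak gradient is unique up to null sets. *)
definition grad :: "'a::euclidean_space set \<Rightarrow> ('a \<Rightarrow> real) \<Rightarrow> 'a \<Rightarrow> 'a" where
  "grad \<Omega> u = (SOME G. L2_weak_gradient \<Omega> u G)"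

definition H1_ip :: "'a::euclidean_space set \<Rightarrow> ('a \<Rightarrow> real) \<Rightarrow> ('a \<Rightarrow> real) \<Rightarrow> real" where
  "H1_ip \<Omega> u v = (\<integral>x. u x * v x + grad \<Omega> u x \<bullet> grad \<Omega> v x \<partial>leb \<Omega>)"

section \<open>Hausdorff measure and the boundary conditions\<close>

(* One term of the covering sum; the normalisation makes the N-dimensional measure on R^N
   Lebesgue measure. In dimension 0, points have size 1 since 0^0 = 1. *)
definition hausdorff_size :: "nat \<Rightarrow> 'a::euclidean_space set \<Rightarrow> ennreal" where
  "hausdorff_size d U =
     (if U = {} then 0 else ennreal (unit_ball_vol (real d) * (diameter U / 2) ^ d))"

definition hausdorff_outer :: "nat \<Rightarrow> 'a::euclidean_space set \<Rightarrow> ennreal" where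
  "hausdorff_outer d A =
     (SUP \<delta>\<in>{0<..}. INF U\<in>{U :: nat \<Rightarrow> 'a set. A \<subseteq> (\<Union>i. U i) \<and>
                                    (\<forall>i. bounded (U i) \<and> diameter (U i) \<le> \<delta>)}.
        \<Sum>i. hausdorff_size d (U i))"

(* measure_of yields the zero measure if its argument is not countably additive;
   Hausdorff outer measure is a metric outer measure, hence countably additive on Borel sets. *)
definition hausdorff :: "nat \<Rightarrow> 'a::euclidean_space measure" where
  "hausdorff d = measure_of UNIV (sets borel) (hausdorff_outer d)"

definition bdry :: "'a::euclidean_space set \<Rightarrow> 'a set" where
  "bdry \<Omega> = closure \<Omega> - \<Omega>"

definition surface_measure :: "'a::euclidean_space set \<Rightarrow> 'a measure" where
  "surface_measure \<Omega> = restrict_space (hausdorff (DIM('a) - 1)) (bdry \<Omega>)"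

(* Locally, S is the graph of a Lipschitz function \<phi> over the hyperplane orthogonal to e.
   "Closed surface": compact, connected and without boundary. *)
definition closed_lipschitz_surface :: "'a::euclidean_space set \<Rightarrow> bool" where
  "closed_lipschitz_surface S \<longleftrightarrow>
     S \<noteq> {} \<and> compact S \<and> connected S \<and>
     (\<forall>x\<in>S. \<exists>U e \<phi> L. open U \<and> x \<in> U \<and> norm e = 1 \<and> L-lipschitz_on {y. y \<bullet> e = 0} \<phi> \<and>
        S \<inter> U = {y \<in> U. y \<bullet> e = \<phi> (y - (y \<bullet> e) *\<^sub>R e)})"

definition condition_B1 :: "'a::euclidean_space set \<Rightarrow> bool" where
  "condition_B1 \<Omega> \<longleftrightarrow>
     bounded \<Omega> \<and>
     (\<exists>\<S>. finite \<S> \<and> disjoint \<S> \<and> \<Union>\<S> = bdry \<Omega> \<and>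
        (\<forall>S\<in>\<S>. closed_lipschitz_surface S \<and> emeasure (hausdorff (DIM('a) - 1)) S < \<infinity>))"

(* The bounded linear extension to H^1 of the restriction to the boundary. *)
definition trace_map ::
  "'a::euclidean_space set \<Rightarrow> (('a \<Rightarrow> real) \<Rightarrow> ('a \<Rightarrow> real)) \<Rightarrow> bool" where
  "trace_map \<Omega> \<gamma> \<longleftrightarrow>
     (\<forall>u\<in>H1 \<Omega>. \<gamma> u \<in> L2 (surface_measure \<Omega>)) \<and>
     (\<forall>u\<in>H1 \<Omega>. \<forall>v\<in>H1 \<Omega>. \<forall>a b.
        AE x in surface_measure \<Omega>. \<gamma> (\<lambda>x. a * u x + b * v x) x = a * \<gamma> u x + b * \<gamma> v x) \<and>
     (\<exists>C. \<forall>u\<in>H1 \<Omega>. ip_norm (L2_ip (surface_measure \<Omega>)) (\<gamma> u) \<le> C * ip_norm (H1_ip \<Omega>) u) \<and>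
     (\<forall>u\<in>H1 \<Omega>. continuous_on (closure \<Omega>) u \<longrightarrow> (AE x in surface_measure \<Omega>. \<gamma> u x = u x))"

(* Covers p_s = infinity for N = 2 (and, by the usual convention, for N = 1). *)
definition below_sobolev_exponent :: "nat \<Rightarrow> real \<Rightarrow> bool" where
  "below_sobolev_exponent N p \<longleftrightarrow> (N \<ge> 3 \<longrightarrow> p < 2 * real N / (real N - 2))"

definition condition_B2 :: "'a::euclidean_space set \<Rightarrow> bool" where
  "condition_B2 \<Omega> \<longleftrightarrow>
     condition_B1 \<Omega> \<and>
     (\<forall>p\<ge>1. below_sobolev_exponent DIM('a) p \<longrightarrow>
        compact_map (H1 \<Omega>) (ip_norm (H1_ip \<Omega>)) (Lp (leb \<Omega>) p) (Lp_norm (leb \<Omega>) p) (\<lambda>u. u)) \<and>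
     (\<exists>\<gamma>. trace_map \<Omega> \<gamma> \<and>
        compact_map (H1 \<Omega>) (ip_norm (H1_ip \<Omega>))
          (L2 (surface_measure \<Omega>)) (ip_norm (L2_ip (surface_measure \<Omega>))) \<gamma>)"

section \<open>Neumann eigendata\<close>

definition neumann_eigenpair :: "'a::euclidean_space set \<Rightarrow> real \<Rightarrow> ('a \<Rightarrow> real) \<Rightarrow> bool" where
  "neumann_eigenpair \<Omega> \<mu> u \<longleftrightarrow>
     u \<in> H1 \<Omega> \<and> \<not> (AE x in leb \<Omega>. u x = 0) \<and>
     (\<forall>h\<in>H1 \<Omega>. (\<integral>x. grad \<Omega> u x \<bullet> grad \<Omega> h x \<partial>leb \<Omega>) = \<mu> * (\<integral>x. u x * h x \<partial>leb \<Omega>))"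

(* The last clause says that the sequence contains all eigenvalues with their multiplicities:
   the eigenspace of \<mu> is spanned by the (independent) f k with lam k = \<mu>, which are finitely
   many because lam tends to infinity. *)
definition neumann_eigendata ::
  "'a::euclidean_space set \<Rightarrow> (nat \<Rightarrow> real) \<Rightarrow> (nat \<Rightarrow> 'a \<Rightarrow> real) \<Rightarrow> bool" where
  "neumann_eigendata \<Omega> lam f \<longleftrightarrow>
     mono lam \<and> filterlim lam at_top sequentially \<and>
     (\<forall>k. neumann_eigenpair \<Omega> (lam k) (f k)) \<and>
     maximal_orthonormal (H1 \<Omega>) (H1_ip \<Omega>) f \<and>
     (\<forall>\<mu> u. neumann_eigenpair \<Omega> \<mu> u \<longrightarrow>
        (\<exists>c. AE x in leb \<Omega>. u x = (\<Sum>k | lam k = \<mu>. c k * f k x)))"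

section \<open>Tensor products\<close>

definition tensor :: "('x \<Rightarrow> real) \<Rightarrow> ('y \<Rightarrow> real) \<Rightarrow> 'x \<times> 'y \<Rightarrow> real" (infixr "\<otimes>\<^sub>f" 75) where
  "f \<otimes>\<^sub>f g = (\<lambda>(x, y). f x * g y)"

definition tensor_combination ::
  "(nat \<Rightarrow> 'x \<Rightarrow> real) \<Rightarrow> (nat \<Rightarrow> 'y \<Rightarrow> real) \<Rightarrow> (nat \<times> nat \<Rightarrow> real) \<Rightarrow> 'x \<times> 'y \<Rightarrow> real" where
  "tensor_combination p q c = (\<lambda>z. \<Sum>i | c i \<noteq> 0. c i * (p (fst i) \<otimes>\<^sub>f q (snd i)) z)"

definition tensor_combinations ::
  "(nat \<Rightarrow> 'x \<Rightarrow> real) \<Rightarrow> (nat \<Rightarrow> 'y \<Rightarrow> real) \<Rightarrow> ('x \<times> 'y \<Rightarrow> real) set" where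
  "tensor_combinations p q = tensor_combination p q ` {c. finite {i. c i \<noteq> 0}}"

definition coeff_ip :: "(nat \<times> nat \<Rightarrow> real) \<Rightarrow> (nat \<times> nat \<Rightarrow> real) \<Rightarrow> real" where
  "coeff_ip c d = (\<Sum>i | c i \<noteq> 0 \<and> d i \<noteq> 0. c i * d i)"

(* (K, ip), together with \<iota>, is a completion of the finite linear combinations
   g = tensor_combination p q c with respect to the inner product <g, h> = sum of products of
   coefficients. With p, q orthonormal bases of H_1, H_2 this says that K is the Hilbert tensor
   product of H_1 and H_2, which as a completion is determined up to isometric isomorphism.
   \<iota> need not be the inclusion map: for K = H1 of a product of regions with its standard inner
   product the inclusion is not isometric, because the norm of f j \<otimes>\<^sub>f g k there tends to 0 when
   f, g are Neumann eigenfunctions of norm 1 and j, k tend to infinity. *)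
definition hilbert_tensor_product ::
  "(nat \<Rightarrow> 'x \<Rightarrow> real) \<Rightarrow> (nat \<Rightarrow> 'y \<Rightarrow> real) \<Rightarrow>
   ('z \<Rightarrow> real) set \<Rightarrow> (('z \<Rightarrow> real) \<Rightarrow> ('z \<Rightarrow> real) \<Rightarrow> real) \<Rightarrow>
   (('x \<times> 'y \<Rightarrow> real) \<Rightarrow> ('z \<Rightarrow> real)) \<Rightarrow> bool" where
  "hilbert_tensor_product p q K ip \<iota> \<longleftrightarrow>
     ip_complete K ip \<and>
     (\<forall>g\<in>tensor_combinations p q. \<forall>h\<in>tensor_combinations p q. \<forall>a b.
        \<iota> (\<lambda>z. a * g z + b * h z) = (\<lambda>z. a * \<iota> g z + b * \<iota> h z)) \<and>
     (\<forall>c d. finite {i. c i \<noteq> 0} \<longrightarrow> finite {i. d i \<noteq> 0} \<longrightarrow>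
        ip (\<iota> (tensor_combination p q c)) (\<iota> (tensor_combination p q d)) = coeff_ip c d) \<and>
     ip_dense K ip (\<iota> ` tensor_combinations p q)"

end

theory Submission
  imports Defs
begin

text \<open>
  Write \<open>u\<close> for the product \<open>f \<otimes>\<^sub>f g\<close> of a Neumann eigenfunction \<open>f\<close> on \<open>\<Omega>1\<close> with eigenvalue \<open>\<kappa>\<close> and
  one, \<open>g\<close>, on \<open>\<Omega>2\<close> with eigenvalue \<open>\<mu>\<close>. Separation of variables suggests that \<open>u\<close> is a Neumann
  eigenfunction on the product domain with eigenvalue \<open>\<kappa> + \<mu>\<close>. In weak form this says that for every
  \<open>w\<close> in \<open>H1\<close> of the product the \<open>H1\<close> inner product of \<open>w\<close> and \<open>u\<close> is \<open>1 + \<kappa> + \<mu>\<close> times their \<open>L2\<close>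
  inner product (\<open>H1_ip_tensor_eigenfunctions\<close>). To see it, average \<open>w\<close> over the second variable
  against \<open>g\<close>. The result lies in \<open>H1 \<Omega>1\<close>, and its weak gradient is the average of the partial
  derivatives of \<open>w\<close> in the first variable (\<open>avg_snd_weak_gradient\<close>), so it may be inserted into the
  eigenvalue equation of \<open>f\<close>. This gives the part of the gradient term that belongs to the first
  variable; exchanging the roles of the variables gives the other part.

  Everything else follows from this identity. In \<open>L2\<close> the products are orthogonal with squared norms
  \<open>1 / ((1 + \<kappa>) (1 + \<mu>))\<close> by Fubini's theorem, so in \<open>H1\<close> they are orthogonal with squared norms
  \<open>(1 + \<kappa> + \<mu>) / ((1 + \<kappa>) (1 + \<mu>))\<close>; these are the normalisations in the statement. A function in
  \<open>H1\<close> that is orthogonal to all products in \<open>H1\<close> is orthogonal to them in \<open>L2\<close>, and a function with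
  the latter property vanishes almost everywhere (\<open>tensor_total\<close>), because the eigenfunctions of each
  factor are total in its \<open>L2\<close> space (\<open>neumann_eigendata_total\<close>). Since \<open>L2\<close> and \<open>H1\<close> are complete
  (\<open>L2_complete\<close>, \<open>H1_complete\<close>), both maximal orthonormal systems are bases
  (\<open>orthonormal_basis_of_complete\<close>).

  For the Hilbert tensor product, let \<open>\<iota>\<close> send each product of eigenfunctions to the corresponding
  normalised basis element of \<open>H1\<close>, and extend linearly. This is well defined since the coefficients of
  a finite combination can be read off by \<open>L2\<close> inner products; it is isometric and has dense range
  because it carries one orthonormal system to an orthonormal basis.

  The analytic input about weak derivatives is the fundamental lemma of the calculus of variations
  (\<open>AE_zero_of_test_functions\<close>), proved with explicit smooth approximations of indicators of boxes. It
  makes weak gradients unique, and it allows identities for products \<open>\<phi> \<otimes>\<^sub>f \<eta>\<close> of test functions to be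
  extended to products in which one factor is merely square-integrable.
\<close>

section \<open>Semi-inner-product spaces of functions\<close>

text \<open>Functions are not identified when they agree almost everywhere, so the inner products are only
  semidefinite. Both \<open>L2\<close> and \<open>H1\<close> are instances; the Hilbert space arguments are carried out here
  once for the two of them.\<close>
locale semi_inner_space =
  fixes S :: "('x \<Rightarrow> real) set" and ip :: "('x \<Rightarrow> real) \<Rightarrow> ('x \<Rightarrow> real) \<Rightarrow> real"
  assumes zero_mem: "(\<lambda>x. 0) \<in> S"
    and lin_mem: "\<And>u v a b. u \<in> S \<Longrightarrow> v \<in> S \<Longrightarrow> (\<lambda>x. a * u x + b * v x) \<in> S"
    and ip_sym: "\<And>u v. u \<in> S \<Longrightarrow> v \<in> S \<Longrightarrow> ip u v = ip v u"
    and ip_lin: "\<And>u v w a b. u \<in> S \<Longrightarrow> v \<in> S \<Longrightarrow> w \<in> S \<Longrightarrow>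
                   ip (\<lambda>x. a * u x + b * v x) w = a * ip u w + b * ip v w"
    and ip_nonneg: "\<And>u. u \<in> S \<Longrightarrow> 0 \<le> ip u u"
begin

lemma scale_mem: "u \<in> S \<Longrightarrow> (\<lambda>x. a * u x) \<in> S"
  using lin_mem[of u u a 0] by simp

lemma diff_mem: "u \<in> S \<Longrightarrow> v \<in> S \<Longrightarrow> (\<lambda>x. u x - v x) \<in> S"
  using lin_mem[of u v 1 "-1"] by simp

lemma ip_scale: "u \<in> S \<Longrightarrow> w \<in> S \<Longrightarrow> ip (\<lambda>x. a * u x) w = a * ip u w"
  using ip_lin[of u u w a 0] by simp

lemma ip_zero: "w \<in> S \<Longrightarrow> ip (\<lambda>x. 0) w = 0"
  using ip_scale[of w w 0] by simp

lemma ip_diff: "u \<in> S \<Longrightarrow> v \<in> S \<Longrightarrow> w \<in> S \<Longrightarrow> ip (\<lambda>x. u x - v x) w = ip u w - ip v w"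
  using ip_lin[of u v w 1 "-1"] by simp

lemma ip_diff_right: "u \<in> S \<Longrightarrow> v \<in> S \<Longrightarrow> w \<in> S \<Longrightarrow> ip w (\<lambda>x. u x - v x) = ip w u - ip w v"
  using ip_sym[of w "\<lambda>x. u x - v x"] ip_sym[of u w] ip_sym[of v w] ip_diff[of u v w] diff_mem[of u v]
  by simp

lemma sum_mem:
  assumes "finite F" "\<And>i. i \<in> F \<Longrightarrow> e i \<in> S"
  shows "(\<lambda>x. \<Sum>i\<in>F. c i * e i x) \<in> S"
  using assms
proof (induction F)
  case empty
  then show ?case by (simp add: zero_mem)
next
  case (insert i F)
  then show ?case using lin_mem[of "e i" "\<lambda>x. \<Sum>i\<in>F. c i * e i x" "c i" 1] by simp
qed

lemma ip_sum:
  assumes "finite F" "\<And>i. i \<in> F \<Longrightarrow> e i \<in> S" "w \<in> S"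
  shows "ip (\<lambda>x. \<Sum>i\<in>F. c i * e i x) w = (\<Sum>i\<in>F. c i * ip (e i) w)"
  using assms
proof (induction F)
  case empty
  then show ?case by (simp add: ip_zero)
next
  case (insert i F)
  then show ?case
    using ip_lin[of "e i" "\<lambda>x. \<Sum>i\<in>F. c i * e i x" w "c i" 1] sum_mem[of F e c] by simp
qed

lemma Cauchy_Schwarz:
  assumes u: "u \<in> S" and v: "v \<in> S"
  shows "\<bar>ip u v\<bar> \<le> ip_norm ip u * ip_norm ip v"
proof -
  have exp: "0 \<le> ip u u - 2 * t * ip u v + t\<^sup>2 * ip v v" for t
  proof -
    let ?w = "\<lambda>x. u x - t * v x"
    have tv: "(\<lambda>x. t * v x) \<in> S" and w: "?w \<in> S"
      using u v by (auto intro: diff_mem scale_mem)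
    have "ip u (\<lambda>x. t * v x) = t * ip u v"
      using ip_scale[OF v u] ip_sym[OF u tv] ip_sym[OF u v] by simp
    moreover have "ip (\<lambda>x. t * v x) ?w = t * (ip u v - t * ip v v)"
      using ip_scale[OF v w, of t] ip_diff_right[OF u tv v] ip_sym[OF u v]
        ip_scale[OF v v, of t] ip_sym[OF tv v] by simp
    ultimately have "ip ?w ?w = ip u u - t * ip u v - t * (ip u v - t * ip v v)"
      using ip_diff[OF u tv w] ip_diff_right[OF u tv u] by simp
    then show ?thesis
      using ip_nonneg[OF w] by (simp add: algebra_simps power2_eq_square)
  qed
  have "(ip u v)\<^sup>2 \<le> ip u u * ip v v"
  proof (cases "ip v v = 0")
    case True
    (* The quadratic in t degenerates to an affine function, which is nonnegative everywhere only
       if its slope vanishes. *)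
    have "ip u v = 0"
    proof (rule ccontr)
      assume "ip u v \<noteq> 0"
      then show False
        using exp[of "(ip u u + 1) / (2 * ip u v)"] True by simp
    qed
    then show ?thesis using True by simp
  next
    case False
    then have pos: "ip v v > 0" using ip_nonneg[OF v] by simp
    (* t = ip u v / ip v v minimises the quadratic. *)
    have "0 \<le> ip u u - (ip u v)\<^sup>2 / ip v v"
      using exp[of "ip u v / ip v v"] False by (simp add: power2_eq_square)
    then show ?thesis using pos by (simp add: field_simps)
  qed
  then have "sqrt ((ip u v)\<^sup>2) \<le> sqrt (ip u u * ip v v)"
    by (rule real_sqrt_le_mono)
  then show ?thesis by (simp add: ip_norm_def real_sqrt_mult)
qed

lemma ip_norm_nonneg: "u \<in> S \<Longrightarrow> 0 \<le> ip_norm ip u"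
  by (simp add: ip_norm_def ip_nonneg)

lemma ip_norm_sq: "u \<in> S \<Longrightarrow> (ip_norm ip u)\<^sup>2 = ip u u"
  by (simp add: ip_norm_def ip_nonneg)

lemma ip_tendsto:
  assumes "\<And>n. s n \<in> S" "u \<in> S" "w \<in> S"
    and lim: "(\<lambda>n. ip_norm ip (\<lambda>x. s n x - u x)) \<longlonglongrightarrow> 0"
  shows "(\<lambda>n. ip (s n) w) \<longlonglongrightarrow> ip u w"
proof -
  have "(\<lambda>n. ip_norm ip (\<lambda>x. s n x - u x) * ip_norm ip w) \<longlonglongrightarrow> 0"
    using tendsto_mult_left_zero[OF lim] .
  then have "(\<lambda>n. ip (s n) w - ip u w) \<longlonglongrightarrow> 0"
  proof (rule Lim_null_comparison[rotated], intro always_eventually allI)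
    fix n
    show "norm (ip (s n) w - ip u w) \<le> ip_norm ip (\<lambda>x. s n x - u x) * ip_norm ip w"
      using Cauchy_Schwarz[of "\<lambda>x. s n x - u x" w] assms by (simp add: ip_diff diff_mem)
  qed
  then show ?thesis using LIM_zero_iff by blast
qed

context
  fixes e :: "'i \<Rightarrow> 'x \<Rightarrow> real"
  assumes on: "orthonormal S ip e"
begin

lemma orthonormal_mem: "e i \<in> S" and ip_orthonormal: "ip (e i) (e j) = (if i = j then 1 else 0)"
  using on unfolding orthonormal_def by auto

lemma ip_orthonormal_sum_e:
  assumes "finite F"
  shows "ip (\<lambda>x. \<Sum>i\<in>F. c i * e i x) (e j) = (if j \<in> F then c j else 0)"
proof -
  have "ip (\<lambda>x. \<Sum>i\<in>F. c i * e i x) (e j) = (\<Sum>i\<in>F. c i * ip (e i) (e j))"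
    using assms orthonormal_mem by (intro ip_sum) auto
  also have "\<dots> = (\<Sum>i\<in>F. if j = i then c i else 0)"
    by (intro sum.cong) (auto simp: ip_orthonormal)
  finally show ?thesis using assms by simp
qed

lemma ip_orthonormal_sums:
  assumes "finite F" "finite G"
  shows "ip (\<lambda>x. \<Sum>i\<in>F. c i * e i x) (\<lambda>x. \<Sum>i\<in>G. d i * e i x) = (\<Sum>i\<in>F \<inter> G. c i * d i)"
proof -
  let ?g = "\<lambda>x. \<Sum>i\<in>G. d i * e i x"
  have g: "?g \<in> S" using assms orthonormal_mem by (intro sum_mem) auto
  have "ip (e i) ?g = (if i \<in> G then d i else 0)" for i
    using ip_sym[OF orthonormal_mem g] ip_orthonormal_sum_e[OF \<open>finite G\<close>] by simp
  then have "ip (\<lambda>x. \<Sum>i\<in>F. c i * e i x) ?g = (\<Sum>i\<in>F. c i * (if i \<in> G then d i else 0))"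
    using assms orthonormal_mem g by (subst ip_sum) auto
  also have "\<dots> = (\<Sum>i\<in>F. if i \<in> G then c i * d i else 0)"
    by (intro sum.cong) auto
  also have "\<dots> = (\<Sum>i\<in>F \<inter> G. c i * d i)"
    using \<open>finite F\<close> by (simp add: sum.inter_restrict)
  finally show ?thesis .
qed

lemma Bessel:
  assumes "u \<in> S" "finite F"
  shows "(\<Sum>i\<in>F. (ip u (e i))\<^sup>2) \<le> ip u u"
proof -
  let ?c = "\<lambda>i. ip u (e i)"
  let ?s = "\<lambda>x. \<Sum>i\<in>F. ?c i * e i x"
  have s: "?s \<in> S" using assms orthonormal_mem by (intro sum_mem) auto
  have us: "ip u ?s = (\<Sum>i\<in>F. (?c i)\<^sup>2)"
    using assms s orthonormal_mem by (simp add: ip_sym[of u ?s] ip_sum ip_sym[of "e _" u] power2_eq_square)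
  have ss: "ip ?s ?s = (\<Sum>i\<in>F. (?c i)\<^sup>2)"
    using ip_orthonormal_sums[OF \<open>finite F\<close> \<open>finite F\<close>, of ?c ?c] by (simp add: power2_eq_square)
  have "0 \<le> ip (\<lambda>x. u x - ?s x) (\<lambda>x. u x - ?s x)"
    using assms s by (intro ip_nonneg diff_mem)
  also have "\<dots> = ip u u - (\<Sum>i\<in>F. (?c i)\<^sup>2)"
    using assms s us ss by (simp add: ip_diff ip_diff_right diff_mem ip_sym[of ?s u])
  finally show ?thesis by simp
qed

text \<open>By Bessel's inequality the Fourier partial sums of \<open>u\<close>, taken along the enumeration \<open>h\<close> of the index set, form a Cauchy sequence, and the
  difference of \<open>u\<close> and their limit is orthogonal to the whole system, hence has norm zero.\<close>
lemma orthonormal_basis_of_complete: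
  assumes compl: "ip_complete S ip" and inj: "inj (h :: 'i \<Rightarrow> nat)"
    and max: "\<And>u. u \<in> S \<Longrightarrow> (\<And>i. ip u (e i) = 0) \<Longrightarrow> ip u u = 0"
  shows "orthonormal_basis S ip e"
  unfolding orthonormal_basis_def ip_dense_def
proof (intro conjI ballI allI impI on)
  show "finite_combinations e \<subseteq> S"
    using orthonormal_mem by (auto simp: finite_combinations_def intro: sum_mem)
next
  fix u and \<epsilon> :: real
  assume u: "u \<in> S" and "\<epsilon> > 0"
  define F where "F n = {i. h i < n}" for n
  have fin: "finite (F n)" for n
    using finite_vimageI[OF finite_lessThan[of n] inj] by (simp add: F_def vimage_def)
  define c where "c i = ip u (e i)" for i
  (* The squared norm of the partial sum s n is T n, and T is increasing and bounded. *)
  define s where "s n = (\<lambda>x. \<Sum>i\<in>F n. c i * e i x)" for n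
  define T where "T n = (\<Sum>i\<in>F n. (c i)\<^sup>2)" for n
  have s_mem: "s n \<in> S" for n
    unfolding s_def using fin orthonormal_mem by (intro sum_mem) auto
  have mono: "F m \<subseteq> F n" if "m \<le> n" for m n using that by (auto simp: F_def)
  have "incseq T" unfolding incseq_def T_def
    using mono fin by (auto intro!: sum_mono2)
  moreover have "T n \<le> ip u u" for n
    unfolding T_def c_def by (rule Bessel[OF u fin])
  ultimately obtain l where "T \<longlonglongrightarrow> l"
    using incseq_convergent by blast
  then have CT: "Cauchy T" by (rule LIMSEQ_imp_Cauchy)
  have diff: "ip (\<lambda>x. s n x - s m x) (\<lambda>x. s n x - s m x) = \<bar>T n - T m\<bar>" for m n
  proof -
    have inner: "ip (s k) (s l) = T (min k l)" for k l
    proof -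
      have "F k \<inter> F l = F (min k l)" by (auto simp: F_def)
      then show ?thesis
        unfolding s_def T_def by (subst ip_orthonormal_sums[OF fin fin]) (simp add: power2_eq_square)
    qed
    have "ip (\<lambda>x. s n x - s m x) (\<lambda>x. s n x - s m x) = T n - T (min n m) - (T (min n m) - T m)"
      by (simp add: ip_diff ip_diff_right diff_mem s_mem inner min.commute)
    then show ?thesis
      using \<open>incseq T\<close> by (cases "m \<le> n") (auto simp: incseq_def min_def)
  qed
  have "\<exists>N. \<forall>m\<ge>N. \<forall>n\<ge>N. ip_norm ip (\<lambda>x. s m x - s n x) < \<delta>" if "\<delta> > 0" for \<delta>
  proof -
    obtain N where N: "\<And>m n. m \<ge> N \<Longrightarrow> n \<ge> N \<Longrightarrow> dist (T m) (T n) < \<delta>\<^sup>2"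
      using CT \<open>\<delta> > 0\<close> unfolding Cauchy_def by (metis zero_less_power)
    have "ip_norm ip (\<lambda>x. s m x - s n x) < \<delta>" if "m \<ge> N" "n \<ge> N" for m n
    proof -
      have "sqrt \<bar>T m - T n\<bar> < sqrt (\<delta>\<^sup>2)"
        using N[OF that] by (subst real_sqrt_less_iff) (simp add: dist_real_def)
      then show ?thesis using \<open>\<delta> > 0\<close> by (simp add: ip_norm_def diff)
    qed
    then show ?thesis by blast
  qed
  then obtain w where w: "w \<in> S" and lim: "(\<lambda>n. ip_norm ip (\<lambda>x. s n x - w x)) \<longlonglongrightarrow> 0"
    using compl[unfolded ip_complete_def, THEN spec, of s] s_mem by blast
  have "ip (\<lambda>x. u x - w x) (e i) = 0" for i
  proof -
    have "(\<lambda>n. ip (s n) (e i)) \<longlonglongrightarrow> ip w (e i)"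
      using ip_tendsto[OF s_mem w orthonormal_mem lim] .
    moreover have "eventually (\<lambda>n. ip (s n) (e i) = c i) sequentially"
      using eventually_gt_at_top[of "h i"]
      by eventually_elim (simp add: s_def ip_orthonormal_sum_e[OF fin], simp add: F_def)
    ultimately have "ip w (e i) = c i"
      by (metis LIMSEQ_unique tendsto_eventually)
    then show ?thesis using u w orthonormal_mem by (simp add: ip_diff c_def)
  qed
  then have "ip (\<lambda>x. u x - w x) (\<lambda>x. u x - w x) = 0"
    using max diff_mem[OF u w] by blast
  then have uw0: "ip_norm ip (\<lambda>x. u x - w x) = 0" by (simp add: ip_norm_def)
  obtain n where n: "ip_norm ip (\<lambda>x. s n x - w x) < \<epsilon>"
    using LIMSEQ_D[OF lim \<open>\<epsilon> > 0\<close>] ip_norm_nonneg[OF diff_mem[OF s_mem w]] by auto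
  have "ip_norm ip (\<lambda>x. u x - s n x) = ip_norm ip (\<lambda>x. s n x - w x)"
  proof -
    let ?a = "\<lambda>x. u x - w x" and ?b = "\<lambda>x. s n x - w x"
    have a: "?a \<in> S" and b: "?b \<in> S" using u w s_mem by (auto intro: diff_mem)
    have ab: "(\<lambda>x. u x - s n x) = (\<lambda>x. ?a x - ?b x)" by auto
    have "ip ?a f = 0" if "f \<in> S" for f
      using Cauchy_Schwarz[OF a that] uw0 by simp
    then have "ip ?a ?a = 0" "ip ?a ?b = 0" "ip ?b ?a = 0"
      using a b ip_sym[OF b a] by auto
    then show ?thesis
      unfolding ip_norm_def ab
      using ip_diff[OF a b diff_mem[OF a b]] ip_diff_right[OF a b a] ip_diff_right[OF a b b] by simp
  qed
  then show "\<exists>a\<in>finite_combinations e. ip_norm ip (\<lambda>x. u x - a x) < \<epsilon>"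
    using n fin unfolding finite_combinations_def s_def by (intro bexI[of _ "s n"]) (auto simp: s_def)
qed

end

end

section \<open>The space L2\<close>

lemma L2_measurable: "u \<in> L2 M \<Longrightarrow> u \<in> borel_measurable M"
  by (simp add: L2_def)

lemma L2_integrable_sq: "u \<in> L2 M \<Longrightarrow> integrable M (\<lambda>x. (u x)\<^sup>2)"
  by (simp add: L2_def)

lemma L2_integrable_mult:
  assumes u: "u \<in> L2 M" and v: "v \<in> L2 M"
  shows "integrable M (\<lambda>x. u x * v x)"
proof (rule Bochner_Integration.integrable_bound)
  show "integrable M (\<lambda>x. (u x)\<^sup>2 + (v x)\<^sup>2)"
    using u v by (simp add: L2_integrable_sq)
  show "(\<lambda>x. u x * v x) \<in> borel_measurable M"
    using u v by (intro borel_measurable_times L2_measurable)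
  show "AE x in M. norm (u x * v x) \<le> norm ((u x)\<^sup>2 + (v x)\<^sup>2)"
  proof (intro always_eventually allI)
    fix x
    have "2 * (\<bar>u x\<bar> * \<bar>v x\<bar>) \<le> (u x)\<^sup>2 + (v x)\<^sup>2"
      using sum_squares_bound[of "\<bar>u x\<bar>" "\<bar>v x\<bar>"] by simp
    moreover have "0 \<le> \<bar>u x\<bar> * \<bar>v x\<bar>" by simp
    ultimately have "\<bar>u x\<bar> * \<bar>v x\<bar> \<le> (u x)\<^sup>2 + (v x)\<^sup>2" by linarith
    then show "norm (u x * v x) \<le> norm ((u x)\<^sup>2 + (v x)\<^sup>2)"
      by (simp add: abs_mult)
  qed
qed

lemma L2_lin:
  assumes u: "u \<in> L2 M" and v: "v \<in> L2 M"
  shows "(\<lambda>x. a * u x + b * v x) \<in> L2 M"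
proof -
  have "(\<lambda>x. (a * u x + b * v x)\<^sup>2)
      = (\<lambda>x. a\<^sup>2 * (u x)\<^sup>2 + 2 * a * b * (u x * v x) + b\<^sup>2 * (v x)\<^sup>2)"
    by (auto simp: power2_eq_square algebra_simps)
  then have "integrable M (\<lambda>x. (a * u x + b * v x)\<^sup>2)"
    using L2_integrable_sq[OF u] L2_integrable_sq[OF v] L2_integrable_mult[OF u v] by simp
  moreover have "(\<lambda>x. a * u x + b * v x) \<in> borel_measurable M"
    using u v by (intro borel_measurable_add borel_measurable_times borel_measurable_const L2_measurable)
  ultimately show ?thesis by (simp add: L2_def)
qed

lemma L2_zero: "(\<lambda>x. 0) \<in> L2 M"
  by (simp add: L2_def)

interpretation L2: semi_inner_space "L2 M" "L2_ip M"
proof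
  fix u v w :: "'a \<Rightarrow> real" and a b :: real
  assume u: "u \<in> L2 M" and v: "v \<in> L2 M" and w: "w \<in> L2 M"
  show "L2_ip M (\<lambda>x. a * u x + b * v x) w = a * L2_ip M u w + b * L2_ip M v w"
    using L2_integrable_mult[OF u w] L2_integrable_mult[OF v w]
    by (simp add: L2_ip_def ring_distribs mult.assoc)
qed (auto intro: L2_zero L2_lin simp: L2_ip_def mult.commute)

lemma L2_ip_zero_iff:
  assumes "u \<in> L2 M"
  shows "L2_ip M u u = 0 \<longleftrightarrow> (AE x in M. u x = 0)"
  using integral_nonneg_eq_0_iff_AE[of M "\<lambda>x. (u x)\<^sup>2"] L2_integrable_sq[OF assms]
  by (simp add: L2_ip_def power2_eq_square)

lemma L2_ip_cong_AE:
  assumes "AE x in M. u x = u' x" "AE x in M. v x = v' x"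
    and "u \<in> L2 M" "u' \<in> L2 M" "v \<in> L2 M" "v' \<in> L2 M"
  shows "L2_ip M u v = L2_ip M u' v'"
  unfolding L2_ip_def using assms by (intro integral_cong_AE borel_measurable_times L2_measurable) auto

lemma L2_norm_sq_eq: "u \<in> L2 M \<Longrightarrow> (ip_norm (L2_ip M) u)\<^sup>2 = (\<integral>x. (u x)\<^sup>2 \<partial>M)"
  by (simp add: L2.ip_norm_sq) (simp add: L2_ip_def power2_eq_square)

lemma L2_nn_integral_sq:
  assumes "u \<in> L2 M"
  shows "(\<integral>\<^sup>+x. ennreal ((u x)\<^sup>2) \<partial>M) = ennreal ((ip_norm (L2_ip M) u)\<^sup>2)"
  using nn_integral_eq_integral[OF L2_integrable_sq[OF assms]]
  by (simp add: L2_norm_sq_eq[OF assms])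

text \<open>A sequence whose consecutive \<open>L2\<close>-distances decay like \<open>1/4^n\<close> converges almost
  everywhere: the series of \<open>4^n\<close> times the squared differences has finite integral, so its terms
  are bounded at almost every point, where the differences are therefore \<open>O(2^-n)\<close>.\<close>
lemma L2_fast_Cauchy_AE_convergent:
  fixes s :: "nat \<Rightarrow> 'x \<Rightarrow> real"
  assumes s: "\<And>n. s n \<in> L2 M"
    and fast: "\<And>n. ip_norm (L2_ip M) (\<lambda>x. s (Suc n) x - s n x) \<le> (1/4) ^ n"
  shows "AE x in M. convergent (\<lambda>n. s n x)"
proof -
  define d where "d n = (\<lambda>x. s (Suc n) x - s n x)" for n
  have d: "d n \<in> L2 M" for n unfolding d_def by (intro L2.diff_mem s)
  note [measurable] = L2_measurable[OF d]
  have *: "(\<integral>\<^sup>+x. ennreal (4 ^ n * (d n x)\<^sup>2) \<partial>M) \<le> ennreal ((1/4) ^ n)" for n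
  proof -
    have "(\<integral>\<^sup>+x. ennreal (4 ^ n * (d n x)\<^sup>2) \<partial>M) = ennreal (4 ^ n) * (\<integral>\<^sup>+x. ennreal ((d n x)\<^sup>2) \<partial>M)"
      by (subst nn_integral_cmult[symmetric]) (auto simp: ennreal_mult)
    also have "\<dots> = ennreal (4 ^ n * (ip_norm (L2_ip M) (d n))\<^sup>2)"
      by (simp add: L2_nn_integral_sq[OF d] ennreal_mult)
    also have "\<dots> \<le> ennreal ((1/4) ^ n)"
    proof (rule ennreal_leI)
      have "(ip_norm (L2_ip M) (d n))\<^sup>2 \<le> ((1/4) ^ n)\<^sup>2"
        using fast[of n] L2.ip_norm_nonneg[OF d] by (intro power_mono) (auto simp: d_def)
      then have "4 ^ n * (ip_norm (L2_ip M) (d n))\<^sup>2 \<le> 4 ^ n * ((1/4) ^ n)\<^sup>2"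
        by (intro mult_left_mono) auto
      also have "\<dots> = (1/4) ^ n"
        by (simp add: power2_eq_square power_divide)
      finally show "4 ^ n * (ip_norm (L2_ip M) (d n))\<^sup>2 \<le> (1/4) ^ n" .
    qed
    finally show ?thesis .
  qed
  have "(\<integral>\<^sup>+x. (\<Sum>n. ennreal (4 ^ n * (d n x)\<^sup>2)) \<partial>M)
      = (\<Sum>n. \<integral>\<^sup>+x. ennreal (4 ^ n * (d n x)\<^sup>2) \<partial>M)"
    by (intro nn_integral_suminf) auto
  also have "\<dots> \<le> (\<Sum>n. ennreal ((1/4) ^ n))"
    by (intro suminf_le * ) auto
  also have "\<dots> = ennreal (\<Sum>n. (1/4) ^ n)"
    by (intro suminf_ennreal2 summable_geometric) auto
  finally have "(\<integral>\<^sup>+x. (\<Sum>n. ennreal (4 ^ n * (d n x)\<^sup>2)) \<partial>M) \<noteq> \<infinity>"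
    by (auto simp: top_unique)
  then have "AE x in M. (\<Sum>n. ennreal (4 ^ n * (d n x)\<^sup>2)) \<noteq> \<infinity>"
    by (intro nn_integral_PInf_AE) auto
  then show ?thesis
  proof eventually_elim
    case (elim x)
    define t where "t n = ennreal (4 ^ n * (d n x)\<^sup>2)" for n
    have "suminf t \<noteq> \<infinity>" using elim by (simp only: t_def[abs_def] not_False_eq_True)
    then obtain C where C: "0 \<le> C" "suminf t = ennreal C"
      by (cases "suminf t") auto
    have bd: "\<bar>d n x\<bar> \<le> sqrt C * (1/2) ^ n" for n
    proof -
      have "t n \<le> suminf t"
        using sum_le_suminf[of t "{n}"] by auto
      then have "4 ^ n * (d n x)\<^sup>2 \<le> C" using C by (simp add: t_def ennreal_le_iff)
      then have "sqrt (4 ^ n * (d n x)\<^sup>2) \<le> sqrt C" by (rule real_sqrt_le_mono)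
      moreover have "sqrt (4 ^ n * (d n x)\<^sup>2) = 2 ^ n * \<bar>d n x\<bar>"
        using real_sqrt_power[of 4 n] by (simp add: real_sqrt_mult)
      ultimately show ?thesis by (simp add: field_simps)
    qed
    have "summable (\<lambda>n. d n x)"
      by (rule summable_comparison_test'[where g="\<lambda>n. sqrt C * (1/2) ^ n" and N=0])
        (use bd in \<open>auto intro: summable_mult\<close>)
    then have "convergent (\<lambda>n. \<Sum>k<n. d k x)" by (simp add: summable_iff_convergent)
    then have "convergent (\<lambda>n. s 0 x + (\<Sum>k<n. d k x))"
      by (simp add: convergent_add_const_iff)
    moreover have "s 0 x + (\<Sum>k<n. d k x) = s n x" for n
      unfolding d_def by (subst sum_lessThan_telescope) simp
    ultimately show ?case by simp
  qed
qed

text \<open>Riesz and Fischer: a subsequence with fast decaying distances converges almost everywhere,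
  and Fatou's lemma turns the pointwise limit into a limit in the norm.\<close>
theorem L2_complete:
  fixes M :: "'x measure"
  shows "ip_complete (L2 M) (L2_ip M)"
  unfolding ip_complete_def
proof (intro allI impI)
  fix s :: "nat \<Rightarrow> 'x \<Rightarrow> real"
  assume "\<forall>n. s n \<in> L2 M"
  then have s: "s n \<in> L2 M" for n by blast
  note [measurable] = L2_measurable[OF s]
  assume Cauchy: "\<forall>\<epsilon>>0. \<exists>N. \<forall>m\<ge>N. \<forall>n\<ge>N. ip_norm (L2_ip M) (\<lambda>x. s m x - s n x) < \<epsilon>"
  have "\<forall>k. \<exists>N. \<forall>m\<ge>N. \<forall>n\<ge>N. ip_norm (L2_ip M) (\<lambda>x. s m x - s n x) < (1/4) ^ k"
  proof
    fix k :: nat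
    show "\<exists>N. \<forall>m\<ge>N. \<forall>n\<ge>N. ip_norm (L2_ip M) (\<lambda>x. s m x - s n x) < (1/4) ^ k"
      by (rule Cauchy[THEN spec, THEN mp]) simp
  qed
  from choice[OF this] obtain N where
    N': "\<forall>k. \<forall>m\<ge>N k. \<forall>n\<ge>N k. ip_norm (L2_ip M) (\<lambda>x. s m x - s n x) < (1/4) ^ k" ..
  have N: "ip_norm (L2_ip M) (\<lambda>x. s m x - s n x) < (1/4) ^ k" if "m \<ge> N k" "n \<ge> N k" for k m n
    using N'[THEN spec, of k] that by blast
  (* Summing the thresholds N j makes r monotone while keeping r k above both k and N k. *)
  define r where "r k = k + (\<Sum>j\<le>k. N j)" for k
  have rN: "r k \<ge> N k" for k
    unfolding r_def using member_le_sum[of k "{..k}" N] by (simp add: trans_le_add2)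
  have rk: "r k \<ge> k" for k by (simp add: r_def)
  have r_mono: "r k \<le> r (Suc k)" for k by (simp add: r_def)
  have "AE x in M. convergent (\<lambda>k. s (r k) x)"
  proof (rule L2_fast_Cauchy_AE_convergent)
    fix k
    show "ip_norm (L2_ip M) (\<lambda>x. s (r (Suc k)) x - s (r k) x) \<le> (1/4) ^ k"
      using N[of k "r (Suc k)" "r k"] rN[of k] r_mono[of k] by simp
  qed (rule s)
  define u where "u x = lim (\<lambda>k. s (r k) x)" for x
  have u_meas [measurable]: "u \<in> borel_measurable M"
    unfolding u_def by measurable
  have lim: "AE x in M. (\<lambda>k. s (r k) x) \<longlonglongrightarrow> u x"
    using \<open>AE x in M. convergent (\<lambda>k. s (r k) x)\<close>
    by eventually_elim (simp add: u_def convergent_LIMSEQ_iff)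
  (* Fatou's lemma along the subsequence bounds the distance of the limit to each s n. *)
  have close: "(\<lambda>x. s n x - u x) \<in> L2 M \<and> ip_norm (L2_ip M) (\<lambda>x. s n x - u x) \<le> \<epsilon>"
    if "\<epsilon> > 0" and n: "\<And>m. m \<ge> n0 \<Longrightarrow> ip_norm (L2_ip M) (\<lambda>x. s n x - s m x) < \<epsilon>" for \<epsilon> n n0
  proof -
    have nn: "(\<integral>\<^sup>+x. ennreal ((s n x - u x)\<^sup>2) \<partial>M) \<le> ennreal (\<epsilon>\<^sup>2)"
    proof -
      have "(\<integral>\<^sup>+x. ennreal ((s n x - u x)\<^sup>2) \<partial>M)
          = (\<integral>\<^sup>+x. liminf (\<lambda>k. ennreal ((s n x - s (r k) x)\<^sup>2)) \<partial>M)"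
        using lim
      proof (intro nn_integral_cong_AE, eventually_elim)
        case (elim x)
        have "(\<lambda>k. ennreal ((s n x - s (r k) x)\<^sup>2)) \<longlonglongrightarrow> ennreal ((s n x - u x)\<^sup>2)"
          using elim by (intro tendsto_intros) auto
        then show ?case by (rule lim_imp_Liminf[OF sequentially_bot, symmetric])
      qed
      also have "\<dots> \<le> liminf (\<lambda>k. \<integral>\<^sup>+x. ennreal ((s n x - s (r k) x)\<^sup>2) \<partial>M)"
        by (intro nn_integral_liminf) auto
      also have "\<dots> \<le> liminf (\<lambda>k. ennreal (\<epsilon>\<^sup>2))"
      proof (intro Liminf_mono)
        show "\<forall>\<^sub>F k in sequentially. (\<integral>\<^sup>+x. ennreal ((s n x - s (r k) x)\<^sup>2) \<partial>M) \<le> ennreal (\<epsilon>\<^sup>2)"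
          using eventually_ge_at_top[of n0]
        proof eventually_elim
          case (elim k)
          have "ip_norm (L2_ip M) (\<lambda>x. s n x - s (r k) x) \<le> \<epsilon>"
            using n[of "r k"] elim rk[of k] by simp
          then show ?case
            unfolding L2_nn_integral_sq[OF L2.diff_mem[OF s s]]
            using L2.ip_norm_nonneg[OF L2.diff_mem[OF s s]]
            by (intro ennreal_leI power_mono) auto
        qed
      qed
      finally show ?thesis by (simp add: Liminf_const)
    qed
    then have "integrable M (\<lambda>x. (s n x - u x)\<^sup>2)"
      by (intro integrableI_nonneg) (auto simp: le_less_trans[OF _ ennreal_less_top])
    then have mem: "(\<lambda>x. s n x - u x) \<in> L2 M" by (simp add: L2_def)
    have "(ip_norm (L2_ip M) (\<lambda>x. s n x - u x))\<^sup>2 \<le> \<epsilon>\<^sup>2"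
      using nn unfolding L2_nn_integral_sq[OF mem] by (simp add: ennreal_le_iff)
    then show ?thesis using mem \<open>\<epsilon> > 0\<close> by (auto intro: power2_le_imp_le)
  qed
  have "u \<in> L2 M"
  proof -
    obtain n0 where "\<And>m n. m \<ge> n0 \<Longrightarrow> n \<ge> n0 \<Longrightarrow> ip_norm (L2_ip M) (\<lambda>x. s m x - s n x) < 1"
      using Cauchy[THEN spec, of 1] by auto
    then have "(\<lambda>x. s n0 x - u x) \<in> L2 M" using close[of 1 n0 n0] by auto
    then show ?thesis using L2.diff_mem[OF s[of n0], of "\<lambda>x. s n0 x - u x"] by simp
  qed
  moreover have "(\<lambda>n. ip_norm (L2_ip M) (\<lambda>x. s n x - u x)) \<longlonglongrightarrow> 0"
  proof (rule LIMSEQ_I)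
    fix \<epsilon> :: real assume "\<epsilon> > 0"
    then obtain n0 where n0: "\<And>m n. m \<ge> n0 \<Longrightarrow> n \<ge> n0 \<Longrightarrow>
        ip_norm (L2_ip M) (\<lambda>x. s m x - s n x) < \<epsilon> / 2"
      using Cauchy[THEN spec, of "\<epsilon> / 2"] by auto
    have "norm (ip_norm (L2_ip M) (\<lambda>x. s n x - u x) - 0) < \<epsilon>" if "n \<ge> n0" for n
    proof -
      have "(\<lambda>x. s n x - u x) \<in> L2 M" "ip_norm (L2_ip M) (\<lambda>x. s n x - u x) \<le> \<epsilon> / 2"
        using close[of "\<epsilon>/2" n0 n] n0 that \<open>\<epsilon> > 0\<close> by auto
      then show ?thesis using L2.ip_norm_nonneg \<open>\<epsilon> > 0\<close> by fastforce
    qed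
    then show "\<exists>n0. \<forall>n\<ge>n0. norm (ip_norm (L2_ip M) (\<lambda>x. s n x - u x) - 0) < \<epsilon>" by blast
  qed
  ultimately show "\<exists>u\<in>L2 M. (\<lambda>n. ip_norm (L2_ip M) (\<lambda>x. s n x - u x)) \<longlonglongrightarrow> 0" by blast
qed

section \<open>Smooth functions\<close>

text \<open>Smoothness is proved by exhibiting a class of differentiable functions that contains the partial
  derivatives of its members.\<close>
lemma smooth_coinduct_derivative:
  assumes "P f"
    and step: "\<And>f. P f \<Longrightarrow>
      \<exists>D. (\<forall>x. (f has_derivative D x) (at x)) \<and> (\<forall>b\<in>Basis. P (\<lambda>x. D x b))"
  shows "smooth f"
  using \<open>P f\<close>
proof (coinduction arbitrary: f rule: smooth.coinduct)
  case (smooth f)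
  then obtain D where D: "\<And>x. (f has_derivative D x) (at x)" "\<And>b. b \<in> Basis \<Longrightarrow> P (\<lambda>x. D x b)"
    using step by blast
  have "frechet_derivative f (at x) = D x" for x
    using frechet_derivative_at[OF D(1)] by simp
  then show ?case
    using D by (auto simp: differentiable_def)
qed

lemma smooth_differentiable: "smooth f \<Longrightarrow> f differentiable (at x)"
  by (erule smooth.cases) auto

lemma smooth_has_derivative:
  "smooth f \<Longrightarrow> (f has_derivative frechet_derivative f (at x)) (at x)"
  using smooth_differentiable frechet_derivative_works by blast

lemma smooth_partial: "smooth f \<Longrightarrow> b \<in> Basis \<Longrightarrow> smooth (\<lambda>x. frechet_derivative f (at x) b)"
  by (erule smooth.cases) auto

lemma smooth_continuous_on: "smooth f \<Longrightarrow> continuous_on A f"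
  by (intro continuous_at_imp_continuous_on ballI has_derivative_continuous[OF smooth_has_derivative])

lemma smooth_const: "smooth (\<lambda>x::'a::euclidean_space. c)"
proof (rule smooth_coinduct_derivative[where P="\<lambda>f. \<exists>c. f = (\<lambda>x. c)"])
  fix f :: "'a \<Rightarrow> real"
  assume "\<exists>c. f = (\<lambda>x. c)"
  then show "\<exists>D. (\<forall>x. (f has_derivative D x) (at x)) \<and> (\<forall>b\<in>Basis. \<exists>c. (\<lambda>x. D x b) = (\<lambda>x. c))"
    by (intro exI[of _ "\<lambda>x v. 0"]) auto
qed auto

inductive sum_of_smooth_products :: "('a::euclidean_space \<Rightarrow> real) \<Rightarrow> bool" where
  prod: "smooth f \<Longrightarrow> smooth g \<Longrightarrow> sum_of_smooth_products (\<lambda>x. f x * g x)"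
| sum: "sum_of_smooth_products f \<Longrightarrow> sum_of_smooth_products g \<Longrightarrow>
    sum_of_smooth_products (\<lambda>x. f x + g x)"

text \<open>The partial derivatives of a product are sums of products, so the coinductive invariant
  has to allow for sums.\<close>
lemma smooth_mult:
  assumes "smooth f" "smooth g"
  shows "smooth (\<lambda>x. f x * g x)"
proof (rule smooth_coinduct_derivative[where P=sum_of_smooth_products])
  show "sum_of_smooth_products (\<lambda>x. f x * g x)" using assms by (rule prod)
next
  fix h :: "'a \<Rightarrow> real"
  assume "sum_of_smooth_products h"
  then show "\<exists>D. (\<forall>x. (h has_derivative D x) (at x)) \<and> (\<forall>b\<in>Basis. sum_of_smooth_products (\<lambda>x. D x b))"
  proof induction
    case (prod f g)
    show ?case
    proof (intro exI conjI allI ballI)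
      show "((\<lambda>x. f x * g x) has_derivative
          (\<lambda>v. f x * frechet_derivative g (at x) v + frechet_derivative f (at x) v * g x)) (at x)" for x
        using has_derivative_mult[OF smooth_has_derivative[OF prod(1)] smooth_has_derivative[OF prod(2)]] .
      show "sum_of_smooth_products
          (\<lambda>x. f x * frechet_derivative g (at x) b + frechet_derivative f (at x) b * g x)"
        if "b \<in> Basis" for b
        using prod that by (intro sum_of_smooth_products.intros smooth_partial)
    qed
  next
    case (sum f g)
    then obtain D E where "\<And>x. (f has_derivative D x) (at x)" "\<And>x. (g has_derivative E x) (at x)"
      "\<And>b. b \<in> Basis \<Longrightarrow> sum_of_smooth_products (\<lambda>x. D x b)"
      "\<And>b. b \<in> Basis \<Longrightarrow> sum_of_smooth_products (\<lambda>x. E x b)"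
      by blast
    then show ?case
      by (intro exI[of _ "\<lambda>x v. D x v + E x v"])
        (auto intro!: has_derivative_add sum_of_smooth_products.sum)
  qed
qed

lemma smooth_prod:
  assumes "\<And>i. i \<in> I \<Longrightarrow> smooth (f i)"
  shows "smooth (\<lambda>x. \<Prod>i\<in>I. f i x)"
  using assms by (induction I rule: infinite_finite_induct) (auto intro: smooth_const smooth_mult)

lemma smooth_comp_affine:
  fixes h :: "real \<Rightarrow> real" and a :: "'a::euclidean_space"
  assumes "smooth h"
  shows "smooth (\<lambda>x. h (x \<bullet> a + \<beta>))"
proof (rule smooth_coinduct_derivative[where P="\<lambda>f. \<exists>k h. smooth h \<and> f = (\<lambda>x. k * h (x \<bullet> a + \<beta>))"])
  show "\<exists>k h'. smooth h' \<and> (\<lambda>x. h (x \<bullet> a + \<beta>)) = (\<lambda>x. k * h' (x \<bullet> a + \<beta>))"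
    using assms by (intro exI[of _ 1] exI[of _ h]) auto
next
  fix f :: "'a \<Rightarrow> real"
  assume "\<exists>k h. smooth h \<and> f = (\<lambda>x. k * h (x \<bullet> a + \<beta>))"
  then obtain k h where h: "smooth h" and f: "f = (\<lambda>x. k * h (x \<bullet> a + \<beta>))" by blast
  let ?h' = "\<lambda>t. frechet_derivative h (at t) 1"
  have deriv: "(h has_real_derivative ?h' t) (at t)" for t
  proof -
    interpret bounded_linear "frechet_derivative h (at t)"
      by (rule has_derivative_bounded_linear[OF smooth_has_derivative[OF h]])
    have "frechet_derivative h (at t) v = ?h' t * v" for v
      using scaleR[of v 1] by (simp add: mult.commute)
    then have "frechet_derivative h (at t) = (*) (?h' t)" by blast
    then show ?thesis
      using smooth_has_derivative[OF h, of t] by (simp add: has_field_derivative_def)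
  qed
  show "\<exists>D. (\<forall>x. (f has_derivative D x) (at x)) \<and>
      (\<forall>b\<in>Basis. \<exists>k h. smooth h \<and> (\<lambda>x. D x b) = (\<lambda>x. k * h (x \<bullet> a + \<beta>)))"
  proof (intro exI[of _ "\<lambda>x v. k * ((v \<bullet> a) * ?h' (x \<bullet> a + \<beta>))"] conjI allI ballI)
    fix x
    show "(f has_derivative (\<lambda>v. k * ((v \<bullet> a) * ?h' (x \<bullet> a + \<beta>)))) (at x)"
      unfolding f
      by (rule has_derivative_mult_right, rule DERIV_compose_FDERIV[OF deriv])
        (auto intro!: derivative_eq_intros)
  next
    fix b :: 'a
    show "\<exists>k' h'. smooth h' \<and> (\<lambda>x. k * ((b \<bullet> a) * ?h' (x \<bullet> a + \<beta>))) = (\<lambda>x. k' * h' (x \<bullet> a + \<beta>))"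
      using smooth_partial[OF h, of 1]
      by (intro exI[of _ "k * (b \<bullet> a)"] exI[of _ ?h']) auto
  qed
qed

text \<open>A partial derivative of a product of functions of separate variables acts on one factor only, so
  such products form a class that is closed under partial derivatives.\<close>
lemma smooth_tensor:
  fixes f :: "'a::euclidean_space \<Rightarrow> real" and g :: "'b::euclidean_space \<Rightarrow> real"
  assumes "smooth f" "smooth g"
  shows "smooth (f \<otimes>\<^sub>f g)"
proof (rule smooth_coinduct_derivative[where P="\<lambda>h. \<exists>f g. smooth f \<and> smooth g \<and> h = f \<otimes>\<^sub>f g"])
  fix h :: "'a \<times> 'b \<Rightarrow> real"
  assume "\<exists>f g. smooth f \<and> smooth g \<and> h = f \<otimes>\<^sub>f g"
  then obtain f g where f: "smooth f" and g: "smooth g" and h: "h = f \<otimes>\<^sub>f g" by blast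
  let ?f' = "\<lambda>x. frechet_derivative f (at x)" and ?g' = "\<lambda>y. frechet_derivative g (at y)"
  let ?D = "\<lambda>z v. f (fst z) * ?g' (snd z) (snd v) + ?f' (fst z) (fst v) * g (snd z)"
  have lin: "?f' x 0 = 0" "?g' y 0 = 0" for x y
    using linear_frechet_derivative[OF smooth_differentiable] f g linear_0 by blast+
  show "\<exists>D. (\<forall>z. (h has_derivative D z) (at z)) \<and>
      (\<forall>b\<in>Basis. \<exists>f g. smooth f \<and> smooth g \<and> (\<lambda>z. D z b) = f \<otimes>\<^sub>f g)"
  proof (intro exI[of _ ?D] conjI allI ballI)
    fix z :: "'a \<times> 'b"
    have "((\<lambda>z. f (fst z)) has_derivative (\<lambda>v. ?f' (fst z) (fst v))) (at z)"
      by (rule has_derivative_compose[OF has_derivative_fst[OF has_derivative_ident]])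
        (rule smooth_has_derivative[OF f])
    moreover have "((\<lambda>z. g (snd z)) has_derivative (\<lambda>v. ?g' (snd z) (snd v))) (at z)"
      by (rule has_derivative_compose[OF has_derivative_snd[OF has_derivative_ident]])
        (rule smooth_has_derivative[OF g])
    ultimately have "((\<lambda>z. f (fst z) * g (snd z)) has_derivative ?D z) (at z)"
      by (rule has_derivative_mult)
    then show "(h has_derivative ?D z) (at z)"
      by (simp add: h tensor_def case_prod_beta')
  next
    fix b :: "'a \<times> 'b"
    assume "b \<in> Basis"
    then consider b1 where "b1 \<in> Basis" "b = (b1, 0)" | b2 where "b2 \<in> Basis" "b = (0, b2)"
      by (auto simp: Basis_prod_def)
    then show "\<exists>f g. smooth f \<and> smooth g \<and> (\<lambda>z. ?D z b) = f \<otimes>\<^sub>f g"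
    proof cases
      case 1
      then have "smooth (\<lambda>x. ?f' x b1)" "(\<lambda>z. ?D z b) = (\<lambda>x. ?f' x b1) \<otimes>\<^sub>f g"
        using f by (auto intro: smooth_partial simp: tensor_def lin)
      then show ?thesis using g by blast
    next
      case 2
      then have "smooth (\<lambda>y. ?g' y b2)" "(\<lambda>z. ?D z b) = f \<otimes>\<^sub>f (\<lambda>y. ?g' y b2)"
        using g by (auto intro: smooth_partial simp: tensor_def lin)
      then show ?thesis using f by blast
    qed
  qed
qed (use assms in blast)

lemma smooth_slice_has_derivative:
  assumes "smooth f"
  shows "((\<lambda>x. f (x, y)) has_derivative (\<lambda>v. frechet_derivative f (at (x, y)) (v, 0))) (at x)"
    and "((\<lambda>y. f (x, y)) has_derivative (\<lambda>v. frechet_derivative f (at (x, y)) (0, v))) (at y)"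
proof -
  have "((\<lambda>x. (x, y)) has_derivative (\<lambda>v. (v, 0))) (at x)"
    by (intro has_derivative_Pair has_derivative_ident has_derivative_const)
  from has_derivative_compose[OF this smooth_has_derivative[OF assms]]
  show "((\<lambda>x. f (x, y)) has_derivative (\<lambda>v. frechet_derivative f (at (x, y)) (v, 0))) (at x)" .
  have "((\<lambda>y. (x, y)) has_derivative (\<lambda>v. (0, v))) (at y)"
    by (intro has_derivative_Pair has_derivative_ident has_derivative_const)
  from has_derivative_compose[OF this smooth_has_derivative[OF assms]]
  show "((\<lambda>y. f (x, y)) has_derivative (\<lambda>v. frechet_derivative f (at (x, y)) (0, v))) (at y)" .
qed

lemma smooth_slice_fst:
  fixes f :: "'a::euclidean_space \<times> 'b::euclidean_space \<Rightarrow> real"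
  assumes "smooth f"
  shows "smooth (\<lambda>x. f (x, y))"
proof (rule smooth_coinduct_derivative[where P="\<lambda>h. \<exists>f. smooth f \<and> h = (\<lambda>x. f (x, y))"])
  fix h :: "'a \<Rightarrow> real"
  assume "\<exists>f. smooth f \<and> h = (\<lambda>x. f (x, y))"
  then obtain f where f: "smooth f" and h: "h = (\<lambda>x. f (x, y))" by blast
  have "smooth (\<lambda>z. frechet_derivative f (at z) (b, 0))" if "b \<in> Basis" for b
    using f that by (intro smooth_partial) (auto simp: Basis_prod_def)
  then show "\<exists>D. (\<forall>x. (h has_derivative D x) (at x)) \<and>
      (\<forall>b\<in>Basis. \<exists>f. smooth f \<and> (\<lambda>x. D x b) = (\<lambda>x. f (x, y)))"
    unfolding h
    by (intro exI[of _ "\<lambda>x v. frechet_derivative f (at (x, y)) (v, 0)"] conjI allI ballI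
        smooth_slice_has_derivative f) blast
qed (use assms in blast)

lemma smooth_slice_snd:
  fixes f :: "'a::euclidean_space \<times> 'b::euclidean_space \<Rightarrow> real"
  assumes "smooth f"
  shows "smooth (\<lambda>y. f (x, y))"
proof (rule smooth_coinduct_derivative[where P="\<lambda>h. \<exists>f. smooth f \<and> h = (\<lambda>y. f (x, y))"])
  fix h :: "'b \<Rightarrow> real"
  assume "\<exists>f. smooth f \<and> h = (\<lambda>y. f (x, y))"
  then obtain f where f: "smooth f" and h: "h = (\<lambda>y. f (x, y))" by blast
  have "smooth (\<lambda>z. frechet_derivative f (at z) (0, b))" if "b \<in> Basis" for b
    using f that by (intro smooth_partial) (auto simp: Basis_prod_def)
  then show "\<exists>D. (\<forall>y. (h has_derivative D y) (at y)) \<and>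
      (\<forall>b\<in>Basis. \<exists>f. smooth f \<and> (\<lambda>y. D y b) = (\<lambda>y. f (x, y)))"
    unfolding h
    by (intro exI[of _ "\<lambda>y v. frechet_derivative f (at (x, y)) (0, v)"] conjI allI ballI
        smooth_slice_has_derivative f) blast
qed (use assms in blast)

text \<open>The functions \<open>p(1/t) exp(-1/t)\<close> with a polynomial \<open>p\<close>, extended by zero to \<open>t \<le> 0\<close>: the
  chain and product rules stay within this class, which makes all its members smooth.\<close>
definition flat_exp :: "real poly \<Rightarrow> real \<Rightarrow> real" where
  "flat_exp p t = (if t > 0 then poly p (1 / t) * exp (- (1 / t)) else 0)"

lemma poly_exp_decay:
  fixes p :: "real poly"
  shows "((\<lambda>s. poly p s * s ^ k * exp (- s)) \<longlongrightarrow> 0) at_top"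
proof (induction p arbitrary: k)
  case 0
  then show ?case by simp
next
  case (pCons a p)
  have "((\<lambda>s::real. a * (s ^ k / exp s) + poly p s * s ^ Suc k * exp (- s)) \<longlongrightarrow> a * 0 + 0) at_top"
    by (intro tendsto_add tendsto_mult tendsto_const tendsto_power_div_exp_0 pCons.IH)
  then show ?case
    by (simp add: algebra_simps exp_minus divide_inverse)
qed

text \<open>For \<open>t > 0\<close> the derivative of \<open>p(1/t) exp(-1/t)\<close> is \<open>q(1/t) exp(-1/t)\<close> with
  \<open>q(s) = s\<^sup>2 (p(s) - p'(s))\<close>; at 0 the difference quotient tends to zero because the exponential
  beats every power.\<close>
lemma flat_exp_has_derivative:
  "(flat_exp p has_real_derivative flat_exp ([:0, 0, 1:] * (p - pderiv p)) t) (at t)"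
proof -
  consider "t > 0" | "t < 0" | "t = 0" by linarith
  then show ?thesis
  proof cases
    case 1
    have "((\<lambda>t. poly p (1 / t) * exp (- (1 / t))) has_real_derivative
        flat_exp ([:0, 0, 1:] * (p - pderiv p)) t) (at t)"
      using 1 by (auto intro!: derivative_eq_intros simp: flat_exp_def field_simps power2_eq_square)
    then show ?thesis
      by (rule has_field_derivative_transform_within_open[of _ _ _ "{0<..}"])
        (use 1 in \<open>auto simp: flat_exp_def\<close>)
  next
    case 2
    then have "((\<lambda>t. 0) has_real_derivative flat_exp ([:0, 0, 1:] * (p - pderiv p)) t) (at t)"
      by (simp add: flat_exp_def)
    then show ?thesis
      by (rule has_field_derivative_transform_within_open[of _ _ _ "{..<0}"])
        (use 2 in \<open>auto simp: flat_exp_def\<close>)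
  next
    case 3
    have left: "((\<lambda>y. flat_exp p y / y) \<longlongrightarrow> 0) (at_left 0)"
      by (rule tendsto_eventually) (auto simp: eventually_at_left_field flat_exp_def intro: exI[of _ "-1"])
    have "((\<lambda>y. poly p (inverse y) * inverse y ^ 1 * exp (- inverse y)) \<longlongrightarrow> 0) (at_right (0::real))"
      by (rule filterlim_compose[OF poly_exp_decay filterlim_inverse_at_top_right])
    moreover have "\<forall>\<^sub>F y in at_right 0. poly p (inverse y) * inverse y ^ 1 * exp (- inverse y) = flat_exp p y / y"
      by (auto simp: eventually_at_right_field flat_exp_def divide_inverse intro: exI[of _ 1])
    ultimately have right: "((\<lambda>y. flat_exp p y / y) \<longlongrightarrow> 0) (at_right 0)"
      by (rule Lim_transform_eventually)
    have "((\<lambda>y. flat_exp p y / y) \<longlongrightarrow> 0) (at 0)"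
      using left right by (simp add: filterlim_at_split)
    then show ?thesis using 3 by (simp add: has_field_derivative_iff flat_exp_def)
  qed
qed

lemma smooth_flat_exp: "smooth (flat_exp p)"
proof (rule smooth_coinduct_derivative[where P="\<lambda>f. \<exists>p. f = flat_exp p"])
  fix f assume "\<exists>p. f = flat_exp p"
  then obtain p where f: "f = flat_exp p" by blast
  let ?q = "[:0, 0, 1:] * (p - pderiv p)"
  show "\<exists>D. (\<forall>x. (f has_derivative D x) (at x)) \<and> (\<forall>b\<in>Basis. \<exists>p. (\<lambda>x. D x b) = flat_exp p)"
  proof (intro exI[of _ "\<lambda>x v. flat_exp ?q x * v"] conjI allI ballI)
    show "(f has_derivative (\<lambda>v. flat_exp ?q x * v)) (at x)" for x
      using flat_exp_has_derivative[of p x] by (simp add: f has_field_derivative_def)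
    show "\<exists>p. (\<lambda>x. flat_exp ?q x * b) = flat_exp p" if "b \<in> Basis" for b
      using that by (intro exI[of _ ?q]) auto
  qed
qed auto

section \<open>Test functions\<close>

lemma test_functionsI:
  assumes "smooth \<phi>" "compact K" "K \<subseteq> \<Omega>" "\<And>x. x \<notin> K \<Longrightarrow> \<phi> x = 0"
  shows "\<phi> \<in> test_functions \<Omega>"
proof -
  have "closure {x. \<phi> x \<noteq> 0} \<subseteq> K"
    using assms by (intro closure_minimal) (auto intro: compact_imp_closed)
  moreover from this have "compact (closure {x. \<phi> x \<noteq> 0})"
    using compact_Int_closed[OF \<open>compact K\<close> closed_closure, of "{x. \<phi> x \<noteq> 0}"]
    by (simp add: Int_absorb1)
  ultimately show ?thesis
    using assms by (auto simp: test_functions_def)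
qed

lemma test_functionsE:
  assumes "\<phi> \<in> test_functions \<Omega>"
  obtains K where "smooth \<phi>" "compact K" "K \<subseteq> \<Omega>" "\<And>x. x \<notin> K \<Longrightarrow> \<phi> x = 0"
proof (rule that[of "closure {x. \<phi> x \<noteq> 0}"])
  show "\<phi> x = 0" if "x \<notin> closure {x. \<phi> x \<noteq> 0}" for x
    using that closure_subset[of "{x. \<phi> x \<noteq> 0}"] by blast
qed (use assms in \<open>auto simp: test_functions_def\<close>)

lemma test_function_smooth: "\<phi> \<in> test_functions \<Omega> \<Longrightarrow> smooth \<phi>"
  by (simp add: test_functions_def)

lemma test_function_partial:
  assumes "\<phi> \<in> test_functions \<Omega>" "b \<in> Basis"
  shows "(\<lambda>x. frechet_derivative \<phi> (at x) b) \<in> test_functions \<Omega>"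
  using assms(1)
proof (rule test_functionsE)
  fix K assume \<phi>: "smooth \<phi>" and K: "compact K" "K \<subseteq> \<Omega>" and out: "\<And>x. x \<notin> K \<Longrightarrow> \<phi> x = 0"
  show ?thesis
  proof (rule test_functionsI[OF smooth_partial[OF \<phi> \<open>b \<in> Basis\<close>] K])
    fix x assume "x \<notin> K"
    have "((\<lambda>x. 0) has_derivative (\<lambda>v. 0)) (at x)" by simp
    then have "(\<phi> has_derivative (\<lambda>v. 0)) (at x)"
      by (rule has_derivative_transform_within_open[of _ _ _ _ "- K"])
        (use \<open>x \<notin> K\<close> out K in \<open>auto intro: compact_imp_closed simp: open_Compl\<close>)
    then show "frechet_derivative \<phi> (at x) b = 0"
      using frechet_derivative_at by metis
  qed
qed

lemma test_function_bounded:
  assumes "\<phi> \<in> test_functions \<Omega>"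
  shows "\<exists>C. \<forall>x. \<bar>\<phi> x\<bar> \<le> C"
  using assms
proof (rule test_functionsE)
  fix K assume \<phi>: "smooth \<phi>" and K: "compact K" and out: "\<And>x. x \<notin> K \<Longrightarrow> \<phi> x = 0"
  have "bounded (\<phi> ` K)"
    by (intro compact_imp_bounded compact_continuous_image smooth_continuous_on \<phi> K)
  then obtain C where C: "\<And>x. x \<in> K \<Longrightarrow> \<bar>\<phi> x\<bar> \<le> C" by (auto simp: bounded_iff)
  have "\<bar>\<phi> x\<bar> \<le> max C 0" for x
    using C[of x] out[of x] by (cases "x \<in> K") auto
  then show ?thesis by blast
qed

lemma test_function_borel: "\<phi> \<in> test_functions \<Omega> \<Longrightarrow> \<phi> \<in> borel_measurable borel"
  by (intro borel_measurable_continuous_onI smooth_continuous_on test_function_smooth)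

lemma test_function_tensor:
  assumes "\<phi> \<in> test_functions \<Omega>1" "\<eta> \<in> test_functions \<Omega>2"
  shows "\<phi> \<otimes>\<^sub>f \<eta> \<in> test_functions (\<Omega>1 \<times> \<Omega>2)"
proof -
  obtain K where K: "compact K" "K \<subseteq> \<Omega>1" "\<And>x. x \<notin> K \<Longrightarrow> \<phi> x = 0"
    using test_functionsE[OF assms(1)] by metis
  obtain L where L: "compact L" "L \<subseteq> \<Omega>2" "\<And>x. x \<notin> L \<Longrightarrow> \<eta> x = 0"
    using test_functionsE[OF assms(2)] by metis
  show ?thesis
  proof (rule test_functionsI)
    show "compact (K \<times> L)" using K L by (intro compact_Times)
    show "smooth (\<phi> \<otimes>\<^sub>f \<eta>)" using assms by (intro smooth_tensor test_function_smooth)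
    show "K \<times> L \<subseteq> \<Omega>1 \<times> \<Omega>2" using K L by blast
    show "(\<phi> \<otimes>\<^sub>f \<eta>) z = 0" if "z \<notin> K \<times> L" for z
      using that K(3)[of "fst z"] L(3)[of "snd z"] by (cases z) (auto simp: tensor_def)
  qed
qed

lemma test_function_slice_fst:
  assumes "\<phi> \<in> test_functions (\<Omega>1 \<times> \<Omega>2)"
  shows "(\<lambda>x. \<phi> (x, y)) \<in> test_functions \<Omega>1"
  using assms
proof (rule test_functionsE)
  fix K assume \<phi>: "smooth \<phi>" and K: "compact K" "K \<subseteq> \<Omega>1 \<times> \<Omega>2" and out: "\<And>x. x \<notin> K \<Longrightarrow> \<phi> x = 0"
  show ?thesis
  proof (rule test_functionsI[OF smooth_slice_fst[OF \<phi>]])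
    show "compact (fst ` K)" by (intro compact_continuous_image K continuous_intros)
    show "\<phi> (x, y) = 0" if "x \<notin> fst ` K" for x
      using that by (intro out) force
  qed (use K in auto)
qed

lemma test_function_slice_snd:
  assumes "\<phi> \<in> test_functions (\<Omega>1 \<times> \<Omega>2)"
  shows "(\<lambda>y. \<phi> (x, y)) \<in> test_functions \<Omega>2"
  using assms
proof (rule test_functionsE)
  fix K assume \<phi>: "smooth \<phi>" and K: "compact K" "K \<subseteq> \<Omega>1 \<times> \<Omega>2" and out: "\<And>x. x \<notin> K \<Longrightarrow> \<phi> x = 0"
  show ?thesis
  proof (rule test_functionsI[OF smooth_slice_snd[OF \<phi>]])
    show "compact (snd ` K)" by (intro compact_continuous_image K continuous_intros)
    show "\<phi> (x, y) = 0" if "y \<notin> snd ` K" for y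
      using that by (intro out) force
  qed (use K in auto)
qed

text \<open>Since \<open>exp(-1/(n t))\<close> increases to 1 as \<open>n\<close> grows, for each \<open>t > 0\<close>, these bumps approximate
  the indicator of an open box from within. The scaling by \<open>Suc n\<close> avoids the degenerate factor 0.\<close>
definition box_bump :: "'a::euclidean_space \<Rightarrow> 'a \<Rightarrow> nat \<Rightarrow> 'a \<Rightarrow> real" where
  "box_bump c d n x =
     (\<Prod>b\<in>Basis. flat_exp 1 (real (Suc n) * (x \<bullet> b - c \<bullet> b)) * flat_exp 1 (real (Suc n) * (d \<bullet> b - x \<bullet> b)))"

lemma smooth_box_bump: "smooth (box_bump c d n)"
proof -
  have "smooth (\<lambda>x. flat_exp 1 (real (Suc n) * (x \<bullet> b - c \<bullet> b)))" for b
    using smooth_comp_affine[OF smooth_flat_exp, of 1 "real (Suc n) *\<^sub>R b" "- real (Suc n) * (c \<bullet> b)"]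
    by (simp add: algebra_simps)
  moreover have "smooth (\<lambda>x. flat_exp 1 (real (Suc n) * (d \<bullet> b - x \<bullet> b)))" for b
    using smooth_comp_affine[OF smooth_flat_exp, of 1 "- real (Suc n) *\<^sub>R b" "real (Suc n) * (d \<bullet> b)"]
    by (simp add: algebra_simps)
  ultimately show ?thesis
    unfolding box_bump_def[abs_def] by (intro smooth_prod smooth_mult)
qed

lemma box_bump_outside:
  assumes "x \<notin> box c d"
  shows "box_bump c d n x = 0"
proof -
  obtain b where "b \<in> Basis" "x \<bullet> b \<le> c \<bullet> b \<or> d \<bullet> b \<le> x \<bullet> b"
    using assms by (auto simp: mem_box not_less)
  then have "\<exists>b\<in>Basis. flat_exp 1 (real (Suc n) * (x \<bullet> b - c \<bullet> b)) * flat_exp 1 (real (Suc n) * (d \<bullet> b - x \<bullet> b)) = 0"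
    by (intro bexI[of _ b]) (auto simp: flat_exp_def zero_less_mult_iff)
  then show ?thesis unfolding box_bump_def by (simp add: prod_zero)
qed

lemma box_bump_test: "cbox c d \<subseteq> \<Omega> \<Longrightarrow> box_bump c d n \<in> test_functions \<Omega>"
  using box_subset_cbox[of c d]
  by (intro test_functionsI[OF smooth_box_bump compact_cbox] box_bump_outside) auto

lemma box_bump_bounded: "\<bar>box_bump c d n x\<bar> \<le> 1"
proof -
  have "0 \<le> flat_exp 1 t" "flat_exp 1 t \<le> 1" for t by (auto simp: flat_exp_def)
  then have "0 \<le> box_bump c d n x" "box_bump c d n x \<le> 1"
    unfolding box_bump_def by (auto intro!: prod_nonneg prod_le_1 mult_le_one)
  then show ?thesis by simp
qed

lemma flat_exp_dilate_tendsto: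
  assumes "t > 0"
  shows "(\<lambda>n. flat_exp 1 (real (Suc n) * t)) \<longlonglongrightarrow> 1"
proof -
  have "(\<lambda>n. exp (- (inverse (real (Suc n)) * (1 / t)))) \<longlonglongrightarrow> exp (- (0 * (1 / t)))"
    by (intro tendsto_intros LIMSEQ_inverse_real_of_nat)
  moreover have "flat_exp 1 (real (Suc n) * t) = exp (- (inverse (real (Suc n)) * (1 / t)))" for n
  proof -
    have "real (Suc n) * t > 0" using assms by (intro mult_pos_pos) auto
    then show ?thesis unfolding flat_exp_def by (simp add: field_simps)
  qed
  ultimately show ?thesis by simp
qed

lemma box_bump_tendsto: "(\<lambda>n. box_bump c d n x) \<longlonglongrightarrow> indicator (box c d) x"
proof (cases "x \<in> box c d")
  case True
  then have "(\<lambda>n. box_bump c d n x) \<longlonglongrightarrow> (\<Prod>b\<in>(Basis::'a set). 1 * 1)"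
    unfolding box_bump_def
    by (intro tendsto_prod tendsto_mult flat_exp_dilate_tendsto) (auto simp: mem_box)
  then show ?thesis using True by simp
next
  case False
  then show ?thesis by (simp add: box_bump_outside)
qed

section \<open>Integrals against test functions\<close>

lemma integral_leb:
  fixes f :: "'a::euclidean_space \<Rightarrow> real"
  assumes "\<Omega> \<in> sets borel"
  shows "(\<integral>x. f x \<partial>leb \<Omega>) = (\<integral>x. indicator \<Omega> x * f x \<partial>lborel)"
  using assms by (simp add: leb_def integral_restrict_space)

lemma integrable_leb:
  fixes f :: "'a::euclidean_space \<Rightarrow> real"
  assumes "\<Omega> \<in> sets borel"
  shows "integrable (leb \<Omega>) f \<longleftrightarrow> integrable lborel (\<lambda>x. indicator \<Omega> x * f x)"
  using assms by (simp add: leb_def integrable_restrict_space set_integrable_def)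

lemma borel_measurable_leb: "f \<in> borel_measurable borel \<Longrightarrow> f \<in> borel_measurable (leb \<Omega>)"
  unfolding leb_def by (rule measurable_restrict_space1) simp

lemma bounded_support_integrable:
  fixes f :: "'a::euclidean_space \<Rightarrow> real"
  assumes f: "f \<in> borel_measurable borel" and bd: "\<And>x. \<bar>f x\<bar> \<le> C"
    and K: "compact K" and out: "\<And>x. x \<notin> K \<Longrightarrow> f x = 0"
  shows "integrable lborel f"
proof (rule Bochner_Integration.integrable_bound)
  show "integrable lborel (\<lambda>x. C * indicator K x)"
    using emeasure_compact_finite[OF K] borel_compact[OF K]
    by (intro integrable_mult_right integrable_real_indicator) auto
  show "AE x in lborel. norm (f x) \<le> norm (C * indicator K x)"
  proof (intro always_eventually allI)
    fix x show "norm (f x) \<le> norm (C * indicator K x)"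
      using bd[of x] out[of x] by (cases "x \<in> K") auto
  qed
qed (use f in simp)

lemma test_function_integrable:
  assumes "\<phi> \<in> test_functions \<Omega>"
  shows "integrable lborel \<phi>"
proof -
  obtain C where C: "\<And>x. \<bar>\<phi> x\<bar> \<le> C" using test_function_bounded[OF assms] by blast
  show ?thesis
    using assms
    by (rule test_functionsE) (rule bounded_support_integrable[OF test_function_borel[OF assms] C])
qed

lemma test_function_mult:
  assumes "\<phi> \<in> test_functions \<Omega>" "\<psi> \<in> test_functions \<Omega>"
  shows "(\<lambda>x. \<phi> x * \<psi> x) \<in> test_functions \<Omega>"
  using assms(1)
proof (rule test_functionsE)
  fix K assume "smooth \<phi>" "compact K" "K \<subseteq> \<Omega>" "\<And>x. x \<notin> K \<Longrightarrow> \<phi> x = 0"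
  then show ?thesis
    using test_function_smooth[OF assms(2)] by (intro test_functionsI[of _ K] smooth_mult) auto
qed

lemma test_function_L2:
  assumes "\<phi> \<in> test_functions \<Omega>" and \<Omega>: "\<Omega> \<in> sets borel"
  shows "\<phi> \<in> L2 (leb \<Omega>)"
proof -
  have "integrable lborel (\<lambda>x. (\<phi> x)\<^sup>2)"
    using test_function_integrable[OF test_function_mult[OF assms(1) assms(1)]]
    by (simp add: power2_eq_square)
  then have "integrable (leb \<Omega>) (\<lambda>x. (\<phi> x)\<^sup>2)"
    using integrable_mult_indicator[of \<Omega> lborel "\<lambda>x. (\<phi> x)\<^sup>2"] \<Omega> by (simp add: integrable_leb)
  then show ?thesis
    using test_function_borel[OF assms(1)] by (simp add: L2_def borel_measurable_leb)
qed

text \<open>Open boxes are closed under intersection and generate the Borel sets, so by Dynkin's lemma the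
  integral of \<open>f\<close> vanishes over every Borel set.\<close>
lemma AE_zero_of_integral_boxes:
  fixes f :: "'a::euclidean_space \<Rightarrow> real"
  assumes f: "integrable lborel f" and total: "(\<integral>x. f x \<partial>lborel) = 0"
    and box: "\<And>a b. set_lebesgue_integral lborel (box a b) f = 0"
  shows "AE x in lborel. f x = 0"
proof (rule sigma_finite_measure.density_zero[OF sigma_finite_lborel f])
  fix A :: "'a set"
  assume "A \<in> sets lborel"
  have int: "set_integrable lborel B f" if "B \<in> sets borel" for B
    unfolding set_integrable_def using f that by (intro integrable_mult_indicator) auto
  let ?G = "range (\<lambda>(a, b). box a b :: 'a set)"
  have sets: "sets borel = sigma_sets UNIV ?G"
    unfolding borel_eq_box by simp
  have "Int_stable ?G"
    by (auto simp: Int_stable_def box_Int_box)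
  moreover have "?G \<subseteq> Pow UNIV" by simp
  moreover have "A \<in> sigma_sets UNIV ?G"
    using \<open>A \<in> sets lborel\<close> sets by simp
  ultimately show "set_lebesgue_integral lborel A f = 0"
  proof (induction rule: sigma_sets_induct_disjoint)
    case (basic A)
    then show ?case using box by auto
  next
    case empty
    then show ?case by (simp add: set_lebesgue_integral_def)
  next
    case (compl A)
    then have A: "A \<in> sets borel" using sets by simp
    have "set_lebesgue_integral lborel (A \<union> (UNIV - A)) f
        = set_lebesgue_integral lborel A f + set_lebesgue_integral lborel (UNIV - A) f"
      using A by (intro set_integral_Un int) auto
    then show ?case using compl total by (simp add: set_lebesgue_integral_def)
  next
    case (union A)
    then have A: "A i \<in> sets borel" for i using sets by auto
    have "set_lebesgue_integral lborel (\<Union>i. A i) f = (\<Sum>i. set_lebesgue_integral lborel (A i) f)"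
      using A union by (intro lebesgue_integral_countable_add int) (auto simp: disjoint_family_on_def)
    then show ?case using union by simp
  qed
qed

text \<open>The fundamental lemma of the calculus of variations. Testing with box bumps and passing to the
  limit shows that the integral of \<open>g\<close> vanishes over every box whose closure lies in \<open>\<Omega>\<close>; hence
  \<open>g\<close> vanishes almost everywhere on such a box, and countably many of them cover \<open>\<Omega>\<close>.\<close>
lemma AE_zero_of_test_functions:
  fixes \<Omega> :: "'a::euclidean_space set"
  assumes \<Omega>: "open \<Omega>" and g: "g \<in> L2 (leb \<Omega>)"
    and orth: "\<And>\<phi>. \<phi> \<in> test_functions \<Omega> \<Longrightarrow> (\<integral>x. g x * \<phi> x \<partial>leb \<Omega>) = 0"
  shows "AE x in leb \<Omega>. g x = 0"
proof -
  have [measurable]: "\<Omega> \<in> sets borel" using \<Omega> by simp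
  define h where "h x = indicator \<Omega> x * g x" for x
  have [measurable]: "h \<in> borel_measurable borel"
    using L2_measurable[OF g] borel_measurable_restrict_space_iff[of \<Omega> lborel g]
    by (simp add: h_def[abs_def] leb_def)
  have zero: "AE x in lborel. x \<in> cbox c d \<longrightarrow> h x = 0" if cd: "cbox c d \<subseteq> \<Omega>" for c d
  proof -
    have int: "integrable lborel (\<lambda>x. indicator (cbox c d) x * h x)"
    proof -
      have "integrable (leb \<Omega>) (\<lambda>x. (indicator (cbox c d) x :: real)\<^sup>2)"
        using bounded_support_integrable[of "\<lambda>x. indicator \<Omega> x * (indicator (cbox c d) x)\<^sup>2" 1 "cbox c d"]
        by (simp add: integrable_leb indicator_def)
      then have "indicator (cbox c d) \<in> L2 (leb \<Omega>)"
        by (simp add: L2_def borel_measurable_leb)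
      from L2_integrable_mult[OF this g] show ?thesis
        by (simp add: integrable_leb h_def algebra_simps)
    qed
    have boxes: "(\<integral>x. indicator (box a b) x * h x \<partial>lborel) = 0" if "box a b \<subseteq> box c d" for a b
    proof (cases "box a b = {}")
      case False
      then have ab: "cbox a b \<subseteq> cbox c d"
        using that closure_mono[OF that] by (metis box_subset_cbox closure_box closure_empty subset_empty)
      have "(\<lambda>n. \<integral>x. box_bump a b n x * h x \<partial>lborel) \<longlonglongrightarrow> (\<integral>x. indicator (box a b) x * h x \<partial>lborel)"
      proof (rule integral_dominated_convergence[where w="\<lambda>x. \<bar>indicator (cbox c d) x * h x\<bar>"])
        show "(\<lambda>x. box_bump a b n x * h x) \<in> borel_measurable lborel" for n
          using borel_measurable_continuous_onI[OF smooth_continuous_on[OF smooth_box_bump]] by measurable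
        show "AE x in lborel. (\<lambda>n. box_bump a b n x * h x) \<longlonglongrightarrow> indicator (box a b) x * h x"
          by (intro always_eventually allI tendsto_mult box_bump_tendsto tendsto_const)
        show "AE x in lborel. norm (box_bump a b n x * h x) \<le> \<bar>indicator (cbox c d) x * h x\<bar>" for n
        proof (intro always_eventually allI)
          fix x
          show "norm (box_bump a b n x * h x) \<le> \<bar>indicator (cbox c d) x * h x\<bar>"
          proof (cases "x \<in> box a b")
            case True
            then have "x \<in> cbox c d" using that box_subset_cbox by blast
            then show ?thesis using box_bump_bounded[of a b n x] by (simp add: abs_mult mult_left_le_one_le)
          qed (simp add: box_bump_outside)
        qed
      qed (use int in auto)
      moreover have "(\<integral>x. box_bump a b n x * h x \<partial>lborel) = 0" for n
        using orth[OF box_bump_test[of a b \<Omega> n]] ab cd by (simp add: integral_leb h_def algebra_simps)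
      ultimately show ?thesis by (simp add: LIMSEQ_const_iff)
    qed simp
    have "AE x in lborel. indicator (box c d) x * h x = 0"
    proof (rule AE_zero_of_integral_boxes)
      have "integrable lborel (\<lambda>x. indicator (box c d) x *\<^sub>R (indicator (cbox c d) x * h x))"
        by (rule integrable_mult_indicator[OF _ int]) simp
      moreover have "indicator (box c d) x *\<^sub>R (indicator (cbox c d) x * h x) = indicator (box c d) x * h x" for x
        using box_subset_cbox[of c d] by (auto simp: indicator_def)
      ultimately show "integrable lborel (\<lambda>x. indicator (box c d) x * h x)"
        by (simp only:)
      show "(\<integral>x. indicator (box c d) x * h x \<partial>lborel) = 0" by (rule boxes) simp
      fix a b :: 'a
      obtain a' b' where ab: "box a b \<inter> box c d = box a' b'" using box_Int_box by blast
      then have "indicator (box a b) x * (indicator (box c d) x * h x) = indicator (box a' b') x * h x" for x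
        by (simp add: indicator_inter_arith flip: ab)
      moreover have "box a' b' \<subseteq> box c d" using ab by blast
      ultimately show "set_lebesgue_integral lborel (box a b) (\<lambda>x. indicator (box c d) x * h x) = 0"
        using boxes[of a' b'] by (simp only: set_lebesgue_integral_def real_scaleR_def)
    qed
    moreover have "AE x in lborel. x \<notin> cbox c d - box c d"
    proof (rule AE_not_in)
      show "cbox c d - box c d \<in> null_sets lborel"
      proof (intro null_setsI)
        have "emeasure lborel (cbox c d - box c d) = emeasure lborel (cbox c d) - emeasure lborel (box c d)"
          by (intro emeasure_Diff) (auto simp: emeasure_lborel_box_eq box_subset_cbox)
        then show "emeasure lborel (cbox c d - box c d) = 0"
          by (simp add: emeasure_lborel_box_eq emeasure_lborel_cbox_eq)
      qed simp
    qed
    ultimately show ?thesis by eventually_elim (auto simp: indicator_def split: if_splits)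
  qed
  obtain \<D> where \<D>: "countable \<D>" "\<D> \<subseteq> Pow \<Omega>"
    "\<And>X. X \<in> \<D> \<Longrightarrow> \<exists>a b. X = cbox a b" "\<Union>\<D> = \<Omega>"
    using open_countable_Union_open_cbox[OF \<Omega>] by metis
  have "AE x in lborel. \<forall>X\<in>\<D>. x \<in> X \<longrightarrow> h x = 0"
  proof (subst AE_ball_countable[OF \<D>(1)], intro ballI)
    fix X assume X: "X \<in> \<D>"
    obtain a b where "X = cbox a b" using \<D>(3)[OF X] by blast
    then show "AE x in lborel. x \<in> X \<longrightarrow> h x = 0" using zero X \<D>(2) by blast
  qed
  then have "AE x in lborel. x \<in> \<Omega> \<longrightarrow> g x = 0"
  proof eventually_elim
    case (elim x)
    show ?case
    proof
      assume "x \<in> \<Omega>"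
      then have "h x = 0" using elim \<D>(4) by blast
      then show "g x = 0" using \<open>x \<in> \<Omega>\<close> by (simp add: h_def)
    qed
  qed
  then show ?thesis
    unfolding leb_def by (subst AE_restrict_space_iff) auto
qed

lemma integral_lborel_translate:
  fixes f :: "'a::euclidean_space \<Rightarrow> real"
  assumes "f \<in> borel_measurable borel"
  shows "(\<integral>x. f (c + x) \<partial>lborel) = (\<integral>x. f x \<partial>lborel)"
    and "integrable lborel f \<Longrightarrow> integrable lborel (\<lambda>x. f (c + x))"
proof -
  have "(\<integral>x. f x \<partial>lborel) = (\<integral>x. f x \<partial>distr lborel borel ((+) c))"
    by (simp add: lborel_distr_plus)
  also have "\<dots> = (\<integral>x. f (c + x) \<partial>lborel)"
    using assms by (subst integral_distr) auto
  finally show "(\<integral>x. f (c + x) \<partial>lborel) = (\<integral>x. f x \<partial>lborel)" by simp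
  show "integrable lborel (\<lambda>x. f (c + x))" if "integrable lborel f"
    using that integrable_distr_eq[of "(+) c" lborel borel f] assms by (simp add: lborel_distr_plus)
qed

text \<open>By translation invariance the difference quotients of a test function have integral zero,
  and they converge boundedly, with supports in a common compact set, to the partial derivative.\<close>
lemma integral_partial_test_function:
  fixes \<omega> :: "'a::euclidean_space \<Rightarrow> real"
  assumes "\<omega> \<in> test_functions \<Omega>" "b \<in> Basis"
  shows "(\<integral>x. frechet_derivative \<omega> (at x) b \<partial>lborel) = 0"
  using assms(1)
proof (rule test_functionsE)
  fix K assume \<omega>: "smooth \<omega>" and K: "compact K" and out: "\<And>x. x \<notin> K \<Longrightarrow> \<omega> x = 0"
  let ?D = "\<lambda>x. frechet_derivative \<omega> (at x) b"
  obtain C where C: "\<And>x. \<bar>?D x\<bar> \<le> C"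
    using test_function_bounded[OF test_function_partial[OF assms]] by blast
  have line: "((\<lambda>t. \<omega> (x + t *\<^sub>R b)) has_real_derivative ?D (x + t *\<^sub>R b)) (at t)" for x t
  proof -
    have "((\<lambda>t. x + t *\<^sub>R b) has_derivative (\<lambda>s. s *\<^sub>R b)) (at t)"
      by (auto intro!: derivative_eq_intros)
    from has_derivative_compose[OF this smooth_has_derivative[OF \<omega>]]
    have "((\<lambda>t. \<omega> (x + t *\<^sub>R b)) has_derivative (\<lambda>s. frechet_derivative \<omega> (at (x + t *\<^sub>R b)) (s *\<^sub>R b))) (at t)" .
    moreover have "frechet_derivative \<omega> (at (x + t *\<^sub>R b)) (s *\<^sub>R b) = ?D (x + t *\<^sub>R b) * s" for s
      using linear_cmul[OF linear_frechet_derivative[OF smooth_differentiable[OF \<omega>]]] by simp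
    ultimately show ?thesis by (simp add: has_field_derivative_def)
  qed
  define \<epsilon> where "\<epsilon> n = inverse (real (Suc n))" for n
  have \<epsilon>: "0 < \<epsilon> n" "\<epsilon> n \<le> 1" for n by (auto simp: \<epsilon>_def inverse_le_1_iff)
  define q where "q n x = (\<omega> (\<epsilon> n *\<^sub>R b + x) - \<omega> x) / \<epsilon> n" for n x
  have [measurable]: "\<omega> \<in> borel_measurable borel" using test_function_borel[OF assms(1)] .
  obtain R where R: "\<And>x. x \<in> K \<Longrightarrow> norm x \<le> R" using compact_imp_bounded[OF K] by (auto simp: bounded_iff)
  have "(\<lambda>n. \<integral>x. q n x \<partial>lborel) \<longlonglongrightarrow> (\<integral>x. ?D x \<partial>lborel)"
  proof (rule integral_dominated_convergence[where w="\<lambda>x. C * indicator (cball 0 (R + 1)) x"])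
    show "?D \<in> borel_measurable lborel"
      using test_function_borel[OF test_function_partial[OF assms]] by simp
    show "q n \<in> borel_measurable lborel" for n unfolding q_def by measurable
    show "integrable lborel (\<lambda>x. C * indicator (cball (0::'a) (R + 1)) x)"
      using emeasure_compact_finite[OF compact_cball[of "0::'a" "R + 1"]]
      by (intro integrable_mult_right integrable_real_indicator) auto
    show "AE x in lborel. (\<lambda>n. q n x) \<longlonglongrightarrow> ?D x"
    proof (intro always_eventually allI)
      fix x
      have "((\<lambda>h. (\<omega> (x + h *\<^sub>R b) - \<omega> x) / h) \<longlongrightarrow> ?D x) (at 0)"
        using DERIV_D[OF line[of x 0]] by simp
      moreover have "filterlim \<epsilon> (at 0) sequentially"
        unfolding filterlim_at using \<epsilon>(1) LIMSEQ_inverse_real_of_nat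
        by (auto simp: \<epsilon>_def[abs_def])
      ultimately have "(\<lambda>n. (\<omega> (x + \<epsilon> n *\<^sub>R b) - \<omega> x) / \<epsilon> n) \<longlonglongrightarrow> ?D x"
        by (rule filterlim_compose)
      then show "(\<lambda>n. q n x) \<longlonglongrightarrow> ?D x" by (simp add: q_def add.commute)
    qed
    show "AE x in lborel. norm (q n x) \<le> C * indicator (cball 0 (R + 1)) x" for n
    proof (intro always_eventually allI)
      fix x
      show "norm (q n x) \<le> C * indicator (cball 0 (R + 1)) x"
      proof (cases "x \<in> cball 0 (R + 1)")
        case True
        obtain z where "\<omega> (x + \<epsilon> n *\<^sub>R b) - \<omega> (x + 0 *\<^sub>R b) = (\<epsilon> n - 0) * ?D (x + z *\<^sub>R b)"
          using MVT2[OF \<epsilon>(1)[of n], of "\<lambda>t. \<omega> (x + t *\<^sub>R b)" "\<lambda>t. ?D (x + t *\<^sub>R b)"] line by blast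
        then have "q n x = ?D (x + z *\<^sub>R b)"
          using \<epsilon>(1)[of n] by (simp add: q_def add.commute)
        then show ?thesis using True C by simp
      next
        case False
        then have "norm x > R + 1" by simp
        moreover have "norm (\<epsilon> n *\<^sub>R b) \<le> 1" using \<epsilon>[of n] \<open>b \<in> Basis\<close> by simp
        ultimately have "norm (\<epsilon> n *\<^sub>R b + x) > R" "norm x > R"
          using norm_triangle_ineq2[of x "- (\<epsilon> n *\<^sub>R b)"] norm_ge_zero[of "\<epsilon> n *\<^sub>R b"]
          by (auto simp: add.commute)
        then have "\<epsilon> n *\<^sub>R b + x \<notin> K" "x \<notin> K" using R by force+
        then show ?thesis using False by (simp add: q_def out)
      qed
    qed
  qed
  moreover have "(\<integral>x. q n x \<partial>lborel) = 0" for n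
    using integral_lborel_translate[of \<omega> "\<epsilon> n *\<^sub>R b"] test_function_integrable[OF assms(1)]
    by (simp add: q_def)
  ultimately show ?thesis by (simp add: LIMSEQ_const_iff)
qed

section \<open>The Sobolev space\<close>

text \<open>The \<open>L2\<close> inner product of vector fields. It is defined by components because weak gradients are
  square-integrable componentwise.\<close>
definition vec_ip :: "'x measure \<Rightarrow> ('x \<Rightarrow> 'a::euclidean_space) \<Rightarrow> ('x \<Rightarrow> 'a) \<Rightarrow> real" where
  "vec_ip M G H = (\<Sum>b\<in>Basis. L2_ip M (\<lambda>x. G x \<bullet> b) (\<lambda>x. H x \<bullet> b))"

lemma integral_inner_eq_vec_ip:
  assumes "\<And>b. b \<in> Basis \<Longrightarrow> (\<lambda>x. G x \<bullet> b) \<in> L2 M" "\<And>b. b \<in> Basis \<Longrightarrow> (\<lambda>x. H x \<bullet> b) \<in> L2 M"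
  shows "integrable M (\<lambda>x. G x \<bullet> H x)" "(\<integral>x. G x \<bullet> H x \<partial>M) = vec_ip M G H"
  unfolding vec_ip_def L2_ip_def euclidean_inner[of "G _" "H _"]
  using L2_integrable_mult[OF assms] by (auto intro!: Bochner_Integration.integral_sum)

lemma H1_L2: "u \<in> H1 \<Omega> \<Longrightarrow> u \<in> L2 (leb \<Omega>)"
  by (simp add: H1_def)

lemma H1_weak_gradient: "u \<in> H1 \<Omega> \<Longrightarrow> L2_weak_gradient \<Omega> u (grad \<Omega> u)"
  unfolding H1_def grad_def by (auto intro: someI_ex[of "L2_weak_gradient \<Omega> u"])

lemma H1I: "u \<in> L2 (leb \<Omega>) \<Longrightarrow> L2_weak_gradient \<Omega> u G \<Longrightarrow> u \<in> H1 \<Omega>"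
  by (auto simp: H1_def)

lemma weak_gradient_L2: "L2_weak_gradient \<Omega> u G \<Longrightarrow> b \<in> Basis \<Longrightarrow> (\<lambda>x. G x \<bullet> b) \<in> L2 (leb \<Omega>)"
  by (simp add: L2_weak_gradient_def)

lemma weak_gradient_test:
  "L2_weak_gradient \<Omega> u G \<Longrightarrow> b \<in> Basis \<Longrightarrow> \<phi> \<in> test_functions \<Omega> \<Longrightarrow>
     L2_ip (leb \<Omega>) u (\<lambda>x. frechet_derivative \<phi> (at x) b) = - L2_ip (leb \<Omega>) (\<lambda>x. G x \<bullet> b) \<phi>"
  by (simp add: L2_weak_gradient_def L2_ip_def)

lemma weak_gradientI:
  assumes "\<And>b. b \<in> Basis \<Longrightarrow> (\<lambda>x. G x \<bullet> b) \<in> L2 (leb \<Omega>)"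
    and "\<And>b \<phi>. b \<in> Basis \<Longrightarrow> \<phi> \<in> test_functions \<Omega> \<Longrightarrow>
      L2_ip (leb \<Omega>) u (\<lambda>x. frechet_derivative \<phi> (at x) b) = - L2_ip (leb \<Omega>) (\<lambda>x. G x \<bullet> b) \<phi>"
  shows "L2_weak_gradient \<Omega> u G"
  using assms by (simp add: L2_weak_gradient_def L2_ip_def)

text \<open>The difference of two weak gradients is, componentwise, orthogonal to all test functions.\<close>
lemma weak_gradient_unique:
  assumes \<Omega>: "open \<Omega>"
    and G: "L2_weak_gradient \<Omega> u G" and H: "L2_weak_gradient \<Omega> v H"
    and u: "u \<in> L2 (leb \<Omega>)" and v: "v \<in> L2 (leb \<Omega>)" and uv: "AE x in leb \<Omega>. u x = v x"
  shows "AE x in leb \<Omega>. G x = H x"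
proof -
  have "AE x in leb \<Omega>. G x \<bullet> b = H x \<bullet> b" if b: "b \<in> Basis" for b
  proof -
    note Gb = weak_gradient_L2[OF G b] and Hb = weak_gradient_L2[OF H b]
    have "AE x in leb \<Omega>. G x \<bullet> b - H x \<bullet> b = 0"
    proof (rule AE_zero_of_test_functions[OF \<Omega> L2.diff_mem[OF Gb Hb]])
      fix \<phi> assume \<phi>: "\<phi> \<in> test_functions \<Omega>"
      have \<phi>2: "\<phi> \<in> L2 (leb \<Omega>)" "(\<lambda>x. frechet_derivative \<phi> (at x) b) \<in> L2 (leb \<Omega>)"
        using \<phi> b \<Omega> by (auto intro!: test_function_L2 test_function_partial)
      have "L2_ip (leb \<Omega>) u (\<lambda>x. frechet_derivative \<phi> (at x) b)
          = L2_ip (leb \<Omega>) v (\<lambda>x. frechet_derivative \<phi> (at x) b)"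
        using u v uv \<phi>2 by (intro L2_ip_cong_AE) auto
      then have "L2_ip (leb \<Omega>) (\<lambda>x. G x \<bullet> b - H x \<bullet> b) \<phi> = 0"
        using weak_gradient_test[OF G b \<phi>] weak_gradient_test[OF H b \<phi>] L2.ip_diff[OF Gb Hb \<phi>2(1)]
        by simp
      then show "(\<integral>x. (G x \<bullet> b - H x \<bullet> b) * \<phi> x \<partial>leb \<Omega>) = 0" by (simp add: L2_ip_def)
    qed
    then show ?thesis by simp
  qed
  then have "AE x in leb \<Omega>. \<forall>b\<in>Basis. G x \<bullet> b = H x \<bullet> b"
    by (subst AE_ball_countable) (auto intro: countable_finite)
  then show ?thesis by eventually_elim (auto intro: euclidean_eqI)
qed

lemma weak_gradient_lin:
  assumes \<Omega>: "open \<Omega>"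
    and G: "L2_weak_gradient \<Omega> u G" and H: "L2_weak_gradient \<Omega> v H"
    and u: "u \<in> L2 (leb \<Omega>)" and v: "v \<in> L2 (leb \<Omega>)"
  shows "L2_weak_gradient \<Omega> (\<lambda>x. \<alpha> * u x + \<beta> * v x) (\<lambda>x. \<alpha> *\<^sub>R G x + \<beta> *\<^sub>R H x)"
proof (rule weak_gradientI)
  fix b :: 'a assume b: "b \<in> Basis"
  note Gb = weak_gradient_L2[OF G b] and Hb = weak_gradient_L2[OF H b]
  show "(\<lambda>x. (\<alpha> *\<^sub>R G x + \<beta> *\<^sub>R H x) \<bullet> b) \<in> L2 (leb \<Omega>)"
    using L2.lin_mem[OF Gb Hb] by (simp add: inner_add_left)
  fix \<phi> assume \<phi>: "\<phi> \<in> test_functions \<Omega>"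
  have \<phi>2: "\<phi> \<in> L2 (leb \<Omega>)" "(\<lambda>x. frechet_derivative \<phi> (at x) b) \<in> L2 (leb \<Omega>)"
    using \<phi> b \<Omega> by (auto intro!: test_function_L2 test_function_partial)
  show "L2_ip (leb \<Omega>) (\<lambda>x. \<alpha> * u x + \<beta> * v x) (\<lambda>x. frechet_derivative \<phi> (at x) b)
      = - L2_ip (leb \<Omega>) (\<lambda>x. (\<alpha> *\<^sub>R G x + \<beta> *\<^sub>R H x) \<bullet> b) \<phi>"
    using weak_gradient_test[OF G b \<phi>] weak_gradient_test[OF H b \<phi>]
      L2.ip_lin[OF u v \<phi>2(2)] L2.ip_lin[OF Gb Hb \<phi>2(1)]
    by (simp add: inner_add_left algebra_simps)
qed

text \<open>The gradient in the inner product is an arbitrarily chosen weak gradient; by uniqueness any other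
  weak gradient gives the same value. This is how \<open>H1\<close> inner products are computed below.\<close>
lemma H1_ip_eq:
  assumes \<Omega>: "open \<Omega>"
    and G: "L2_weak_gradient \<Omega> u G" and H: "L2_weak_gradient \<Omega> v H"
    and u: "u \<in> L2 (leb \<Omega>)" and v: "v \<in> L2 (leb \<Omega>)"
  shows "H1_ip \<Omega> u v = L2_ip (leb \<Omega>) u v + vec_ip (leb \<Omega>) G H"
proof -
  have gu: "L2_weak_gradient \<Omega> u (grad \<Omega> u)" and gv: "L2_weak_gradient \<Omega> v (grad \<Omega> v)"
    using G H u v by (auto intro: H1_weak_gradient H1I)
  have "H1_ip \<Omega> u v = L2_ip (leb \<Omega>) u v + vec_ip (leb \<Omega>) (grad \<Omega> u) (grad \<Omega> v)"
    using L2_integrable_mult[OF u v] integral_inner_eq_vec_ip[of "grad \<Omega> u" "leb \<Omega>" "grad \<Omega> v"]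
      weak_gradient_L2[OF gu] weak_gradient_L2[OF gv]
    by (simp add: H1_ip_def L2_ip_def)
  moreover have "vec_ip (leb \<Omega>) (grad \<Omega> u) (grad \<Omega> v) = vec_ip (leb \<Omega>) G H"
    unfolding vec_ip_def
  proof (intro sum.cong refl L2_ip_cong_AE)
    show "AE x in leb \<Omega>. grad \<Omega> u x \<bullet> b = G x \<bullet> b" for b
      using weak_gradient_unique[OF \<Omega> gu G u u] by auto
    show "AE x in leb \<Omega>. grad \<Omega> v x \<bullet> b = H x \<bullet> b" for b
      using weak_gradient_unique[OF \<Omega> gv H v v] by auto
  qed (use weak_gradient_L2 gu gv G H in auto)
  ultimately show ?thesis by simp
qed

lemma vec_ip_sym: "vec_ip M G H = vec_ip M H G"
  by (simp add: vec_ip_def L2_ip_def mult.commute)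

lemma vec_ip_nonneg: "0 \<le> vec_ip M G G"
  by (simp add: vec_ip_def L2_ip_def sum_nonneg)

lemma vec_ip_lin:
  assumes "\<And>b. b \<in> Basis \<Longrightarrow> (\<lambda>x. G x \<bullet> b) \<in> L2 M" "\<And>b. b \<in> Basis \<Longrightarrow> (\<lambda>x. H x \<bullet> b) \<in> L2 M"
    "\<And>b. b \<in> Basis \<Longrightarrow> (\<lambda>x. K x \<bullet> b) \<in> L2 M"
  shows "vec_ip M (\<lambda>x. \<alpha> *\<^sub>R G x + \<beta> *\<^sub>R H x) K = \<alpha> * vec_ip M G K + \<beta> * vec_ip M H K"
  unfolding vec_ip_def
  using L2.ip_lin[OF assms] by (simp add: inner_add_left sum.distrib sum_distrib_left)

lemma H1_semi_inner_space:
  assumes \<Omega>: "open \<Omega>"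
  shows "semi_inner_space (H1 \<Omega>) (H1_ip \<Omega>)"
proof
  show "(\<lambda>x. 0) \<in> H1 \<Omega>"
    by (rule H1I[OF L2_zero, of _ "\<lambda>x. 0"]) (auto intro!: weak_gradientI simp: L2_zero L2_ip_def)
next
  fix u v and \<alpha> \<beta> :: real
  assume "u \<in> H1 \<Omega>" "v \<in> H1 \<Omega>"
  then show "(\<lambda>x. \<alpha> * u x + \<beta> * v x) \<in> H1 \<Omega>"
    by (auto intro!: H1I[OF L2.lin_mem weak_gradient_lin[OF \<Omega> H1_weak_gradient H1_weak_gradient]] H1_L2)
next
  fix u v assume uv: "u \<in> H1 \<Omega>" "v \<in> H1 \<Omega>"
  show "H1_ip \<Omega> u v = H1_ip \<Omega> v u"
    by (simp add: H1_ip_def mult.commute inner_commute)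
next
  fix u v w and \<alpha> \<beta> :: real
  assume uvw: "u \<in> H1 \<Omega>" "v \<in> H1 \<Omega>" "w \<in> H1 \<Omega>"
  note L = uvw[THEN H1_L2] and W = uvw[THEN H1_weak_gradient]
  show "H1_ip \<Omega> (\<lambda>x. \<alpha> * u x + \<beta> * v x) w = \<alpha> * H1_ip \<Omega> u w + \<beta> * H1_ip \<Omega> v w"
    unfolding H1_ip_eq[OF \<Omega> weak_gradient_lin[OF \<Omega> W(1,2) L(1,2)] W(3) L2.lin_mem[OF L(1,2)] L(3)]
      H1_ip_eq[OF \<Omega> W(1) W(3) L(1) L(3)] H1_ip_eq[OF \<Omega> W(2) W(3) L(2) L(3)]
    using L W by (simp add: L2.ip_lin vec_ip_lin weak_gradient_L2 algebra_simps)
next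
  fix u assume "u \<in> H1 \<Omega>"
  then show "0 \<le> H1_ip \<Omega> u u"
    by (simp add: H1_ip_def)
qed

lemma weak_gradient_diff:
  assumes "open \<Omega>" "L2_weak_gradient \<Omega> u G" "L2_weak_gradient \<Omega> v H" "u \<in> L2 (leb \<Omega>)" "v \<in> L2 (leb \<Omega>)"
  shows "L2_weak_gradient \<Omega> (\<lambda>x. u x - v x) (\<lambda>x. G x - H x)"
  using weak_gradient_lin[OF assms, of 1 "-1"] by simp

lemma L2_norm_le_H1_norm:
  assumes \<Omega>: "open \<Omega>" and G: "L2_weak_gradient \<Omega> u G" and u: "u \<in> L2 (leb \<Omega>)"
  shows "ip_norm (L2_ip (leb \<Omega>)) u \<le> ip_norm (H1_ip \<Omega>) u"
    and "b \<in> Basis \<Longrightarrow> ip_norm (L2_ip (leb \<Omega>)) (\<lambda>x. G x \<bullet> b) \<le> ip_norm (H1_ip \<Omega>) u"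
proof -
  have eq: "H1_ip \<Omega> u u = L2_ip (leb \<Omega>) u u + vec_ip (leb \<Omega>) G G"
    using H1_ip_eq[OF \<Omega> G G u u] .
  have nn: "0 \<le> L2_ip (leb \<Omega>) v v" for v by (simp add: L2_ip_def)
  show "ip_norm (L2_ip (leb \<Omega>)) u \<le> ip_norm (H1_ip \<Omega>) u"
    using eq vec_ip_nonneg[of "leb \<Omega>" G] by (simp add: ip_norm_def)
  show "ip_norm (L2_ip (leb \<Omega>)) (\<lambda>x. G x \<bullet> b) \<le> ip_norm (H1_ip \<Omega>) u" if "b \<in> Basis"
    unfolding ip_norm_def
  proof (rule real_sqrt_le_mono)
    have "L2_ip (leb \<Omega>) (\<lambda>x. G x \<bullet> b) (\<lambda>x. G x \<bullet> b) \<le> vec_ip (leb \<Omega>) G G"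
      unfolding vec_ip_def by (rule member_le_sum[OF that]) (use nn in auto)
    then show "L2_ip (leb \<Omega>) (\<lambda>x. G x \<bullet> b) (\<lambda>x. G x \<bullet> b) \<le> H1_ip \<Omega> u u"
      using eq nn[of u] by simp
  qed
qed

text \<open>The functions and the components of their gradients converge in \<open>L2\<close>, and the defining identity of
  the weak gradient passes to the limit because each test function enters it as a fixed element of
  \<open>L2\<close>.\<close>
theorem H1_complete:
  fixes \<Omega> :: "'a::euclidean_space set"
  assumes \<Omega>: "open \<Omega>"
  shows "ip_complete (H1 \<Omega>) (H1_ip \<Omega>)"
  unfolding ip_complete_def
proof (intro allI impI)
  let ?N = "ip_norm (L2_ip (leb \<Omega>))"
  fix s :: "nat \<Rightarrow> 'a \<Rightarrow> real"
  assume "\<forall>n. s n \<in> H1 \<Omega>"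
  then have s: "s n \<in> H1 \<Omega>" for n by blast
  define G where "G n = grad \<Omega> (s n)" for n
  have sL: "s n \<in> L2 (leb \<Omega>)" and sG: "L2_weak_gradient \<Omega> (s n) (G n)" for n
    unfolding G_def using s by (auto intro: H1_L2 H1_weak_gradient)
  note dG = weak_gradient_diff[OF \<Omega> sG sG sL sL] and dL = L2.diff_mem[OF sL sL]
  assume Cauchy: "\<forall>\<epsilon>>0. \<exists>N. \<forall>m\<ge>N. \<forall>n\<ge>N. ip_norm (H1_ip \<Omega>) (\<lambda>x. s m x - s n x) < \<epsilon>"
  have "\<forall>\<epsilon>>0. \<exists>N. \<forall>m\<ge>N. \<forall>n\<ge>N. ?N (\<lambda>x. s m x - s n x) < \<epsilon>"
    using Cauchy le_less_trans[OF L2_norm_le_H1_norm(1)[OF \<Omega> dG dL]] by meson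
  then obtain u where u: "u \<in> L2 (leb \<Omega>)" and u_lim: "(\<lambda>n. ?N (\<lambda>x. s n x - u x)) \<longlonglongrightarrow> 0"
    using L2_complete[of "leb \<Omega>", unfolded ip_complete_def, THEN spec, of s] sL by blast
  have "\<exists>g. g \<in> L2 (leb \<Omega>) \<and> (\<lambda>n. ?N (\<lambda>x. G n x \<bullet> b - g x)) \<longlonglongrightarrow> 0" if b: "b \<in> Basis" for b
  proof -
    have Gb: "(\<lambda>x. G n x \<bullet> b) \<in> L2 (leb \<Omega>)" for n by (rule weak_gradient_L2[OF sG b])
    have "?N (\<lambda>x. G m x \<bullet> b - G n x \<bullet> b) \<le> ip_norm (H1_ip \<Omega>) (\<lambda>x. s m x - s n x)" for m n
      using L2_norm_le_H1_norm(2)[OF \<Omega> dG dL b] by (simp add: inner_diff_left)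
    then have "\<forall>\<epsilon>>0. \<exists>N. \<forall>m\<ge>N. \<forall>n\<ge>N. ?N (\<lambda>x. G m x \<bullet> b - G n x \<bullet> b) < \<epsilon>"
      using Cauchy le_less_trans by meson
    then show ?thesis
      using L2_complete[of "leb \<Omega>", unfolded ip_complete_def, THEN spec, of "\<lambda>n x. G n x \<bullet> b"] Gb by blast
  qed
  then have "\<forall>b\<in>Basis. \<exists>g. g \<in> L2 (leb \<Omega>) \<and> (\<lambda>n. ?N (\<lambda>x. G n x \<bullet> b - g x)) \<longlonglongrightarrow> 0" by blast
  from bchoice[OF this] obtain g where
    g': "\<forall>b\<in>Basis. g b \<in> L2 (leb \<Omega>) \<and> (\<lambda>n. ?N (\<lambda>x. G n x \<bullet> b - g b x)) \<longlonglongrightarrow> 0" ..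
  define H where "H x = (\<Sum>b\<in>Basis. g b x *\<^sub>R b)" for x
  have Hb: "H x \<bullet> b = g b x" if "b \<in> Basis" for b x
    using that by (simp add: H_def)
  have g: "(\<lambda>x. H x \<bullet> b) \<in> L2 (leb \<Omega>)" and g_lim: "(\<lambda>n. ?N (\<lambda>x. G n x \<bullet> b - H x \<bullet> b)) \<longlonglongrightarrow> 0"
    if "b \<in> Basis" for b
    using g' that by (auto simp: Hb)
  have uH: "L2_weak_gradient \<Omega> u H"
  proof (rule weak_gradientI[OF g])
    fix b :: 'a and \<phi> assume b: "b \<in> Basis" and \<phi>: "\<phi> \<in> test_functions \<Omega>"
    have \<phi>2: "\<phi> \<in> L2 (leb \<Omega>)" "(\<lambda>x. frechet_derivative \<phi> (at x) b) \<in> L2 (leb \<Omega>)"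
      using \<phi> b \<Omega> by (auto intro!: test_function_L2 test_function_partial)
    have "(\<lambda>n. L2_ip (leb \<Omega>) (s n) (\<lambda>x. frechet_derivative \<phi> (at x) b))
        \<longlonglongrightarrow> L2_ip (leb \<Omega>) u (\<lambda>x. frechet_derivative \<phi> (at x) b)"
      by (rule L2.ip_tendsto[OF sL u \<phi>2(2) u_lim])
    moreover have "(\<lambda>n. - L2_ip (leb \<Omega>) (\<lambda>x. G n x \<bullet> b) \<phi>) \<longlonglongrightarrow> - L2_ip (leb \<Omega>) (\<lambda>x. H x \<bullet> b) \<phi>"
      by (intro tendsto_minus L2.ip_tendsto[OF weak_gradient_L2[OF sG b] g[OF b] \<phi>2(1) g_lim[OF b]])
    ultimately show "L2_ip (leb \<Omega>) u (\<lambda>x. frechet_derivative \<phi> (at x) b) = - L2_ip (leb \<Omega>) (\<lambda>x. H x \<bullet> b) \<phi>"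
      unfolding weak_gradient_test[OF sG b \<phi>] by (rule LIMSEQ_unique)
  qed
  have "ip_norm (H1_ip \<Omega>) (\<lambda>x. s n x - u x)
      = sqrt ((?N (\<lambda>x. s n x - u x))\<^sup>2 + (\<Sum>b\<in>Basis. (?N (\<lambda>x. G n x \<bullet> b - H x \<bullet> b))\<^sup>2))" for n
  proof -
    note d = weak_gradient_diff[OF \<Omega> sG uH sL u, of n]
    show ?thesis
      using L2.ip_norm_sq[OF L2.diff_mem[OF sL u]]
        L2.ip_norm_sq[OF L2.diff_mem[OF weak_gradient_L2[OF sG] g]]
      by (simp add: ip_norm_def[of "H1_ip \<Omega>"] H1_ip_eq[OF \<Omega> d d L2.diff_mem[OF sL u] L2.diff_mem[OF sL u]]
          vec_ip_def inner_diff_left)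
  qed
  moreover have "(\<lambda>n. sqrt ((?N (\<lambda>x. s n x - u x))\<^sup>2 + (\<Sum>b\<in>Basis. (?N (\<lambda>x. G n x \<bullet> b - H x \<bullet> b))\<^sup>2)))
      \<longlonglongrightarrow> sqrt (0\<^sup>2 + (\<Sum>b\<in>(Basis :: 'a set). 0\<^sup>2))"
    by (intro tendsto_real_sqrt tendsto_add tendsto_sum tendsto_power u_lim g_lim)
  ultimately have "(\<lambda>n. ip_norm (H1_ip \<Omega>) (\<lambda>x. s n x - u x)) \<longlonglongrightarrow> 0" by simp
  then show "\<exists>u\<in>H1 \<Omega>. (\<lambda>n. ip_norm (H1_ip \<Omega>) (\<lambda>x. s n x - u x)) \<longlonglongrightarrow> 0"
    using H1I[OF u uH] by blast
qed

lemma H1_ip_AE_zero: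
  assumes \<Omega>: "open \<Omega>" and u: "u \<in> H1 \<Omega>" and zero: "AE x in leb \<Omega>. u x = 0"
  shows "H1_ip \<Omega> u u = 0"
proof -
  have "L2_weak_gradient \<Omega> (\<lambda>x. 0) (\<lambda>x. 0)"
    by (rule weak_gradientI) (auto simp: L2_zero L2_ip_def)
  from weak_gradient_unique[OF \<Omega> H1_weak_gradient[OF u] this H1_L2[OF u] L2_zero zero] zero
  have "AE x in leb \<Omega>. u x * u x + grad \<Omega> u x \<bullet> grad \<Omega> u x = 0"
    by eventually_elim simp
  then show ?thesis unfolding H1_ip_def by (rule integral_eq_zero_AE)
qed

lemma test_function_outside: "\<phi> \<in> test_functions \<Omega> \<Longrightarrow> x \<notin> \<Omega> \<Longrightarrow> \<phi> x = 0"
  using closure_subset[of "{x. \<phi> x \<noteq> 0}"] by (auto simp: test_functions_def)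

text \<open>The integral of a partial derivative of \<open>\<phi> \<psi>\<close> vanishes; this is integration by parts and makes
  the classical partial derivatives of \<open>\<phi>\<close> weak ones.\<close>
lemma test_function_H1:
  assumes \<Omega>: "open \<Omega>" and \<phi>: "\<phi> \<in> test_functions \<Omega>"
  shows "\<phi> \<in> H1 \<Omega>"
proof (rule H1I)
  show "\<phi> \<in> L2 (leb \<Omega>)" using \<Omega> \<phi> by (intro test_function_L2) auto
  define G where "G x = (\<Sum>b\<in>Basis. frechet_derivative \<phi> (at x) b *\<^sub>R b)" for x
  have Gb: "G x \<bullet> b = frechet_derivative \<phi> (at x) b" if "b \<in> Basis" for x b
    using that by (simp add: G_def)
  show "L2_weak_gradient \<Omega> \<phi> G"
  proof (rule weak_gradientI)
    fix b :: 'a assume b: "b \<in> Basis"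
    show "(\<lambda>x. G x \<bullet> b) \<in> L2 (leb \<Omega>)"
      using \<Omega> \<phi> b by (simp add: Gb test_function_L2 test_function_partial)
    fix \<psi> assume \<psi>: "\<psi> \<in> test_functions \<Omega>"
    let ?D = "\<lambda>f x. frechet_derivative f (at x) b"
    have prod: "?D (\<lambda>x. \<phi> x * \<psi> x) x = \<phi> x * ?D \<psi> x + ?D \<phi> x * \<psi> x" for x
      using frechet_derivative_at[OF has_derivative_mult[OF
            smooth_has_derivative[OF test_function_smooth[OF \<phi>]]
            smooth_has_derivative[OF test_function_smooth[OF \<psi>]]], of x, THEN fun_cong, of b]
      by simp
    have "\<phi> x * ?D \<psi> x + ?D \<phi> x * \<psi> x = indicator \<Omega> x * (\<phi> x * ?D \<psi> x) + indicator \<Omega> x * (?D \<phi> x * \<psi> x)" for x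
    proof (cases "x \<in> \<Omega>")
      case False
      then have "\<phi> x = 0" "\<psi> x = 0" using \<phi> \<psi> by (auto intro: test_function_outside)
      then show ?thesis by simp
    qed simp
    then have "(\<integral>x. indicator \<Omega> x * (\<phi> x * ?D \<psi> x) + indicator \<Omega> x * (?D \<phi> x * \<psi> x) \<partial>lborel) = 0"
      using integral_partial_test_function[OF test_function_mult[OF \<phi> \<psi>] b] by (simp add: prod)
    moreover have "integrable lborel (\<lambda>x. indicator \<Omega> x * (f x * h x))"
      if "f \<in> test_functions \<Omega>" "h \<in> test_functions \<Omega>" for f h
      using L2_integrable_mult[OF test_function_L2[OF that(1)] test_function_L2[OF that(2)]] \<Omega>
      by (simp add: integrable_leb)
    ultimately have "(\<integral>x. indicator \<Omega> x * (\<phi> x * ?D \<psi> x) \<partial>lborel) + (\<integral>x. indicator \<Omega> x * (?D \<phi> x * \<psi> x) \<partial>lborel) = 0"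
      using \<phi> \<psi> b by (subst (asm) Bochner_Integration.integral_add) (auto intro: test_function_partial)
    then show "L2_ip (leb \<Omega>) \<phi> (?D \<psi>) = - L2_ip (leb \<Omega>) (\<lambda>x. G x \<bullet> b) \<psi>"
      using \<Omega> b by (simp add: L2_ip_def Gb integral_leb)
  qed
qed

section \<open>Square-integrable functions on product measure spaces\<close>

context pair_sigma_finite
begin

text \<open>Partial averages: a function on the product is integrated over one variable against a weight.
  For functions in \<open>H1\<close> they take the place of slices, whose weak differentiability could be claimed
  only for almost every value of the other variable.\<close>
definition avg_snd :: "('a \<times> 'b \<Rightarrow> real) \<Rightarrow> ('b \<Rightarrow> real) \<Rightarrow> 'a \<Rightarrow> real" where
  "avg_snd F g x = (\<integral>y. F (x, y) * g y \<partial>M2)"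

definition avg_fst :: "('a \<times> 'b \<Rightarrow> real) \<Rightarrow> ('a \<Rightarrow> real) \<Rightarrow> 'b \<Rightarrow> real" where
  "avg_fst F f y = (\<integral>x. F (x, y) * f x \<partial>M1)"

lemma L2_tensor:
  assumes f: "f \<in> L2 M1" and g: "g \<in> L2 M2"
  shows "f \<otimes>\<^sub>f g \<in> L2 (M1 \<Otimes>\<^sub>M M2)"
proof -
  note [measurable] = L2_measurable[OF f] L2_measurable[OF g]
  have "integrable (M1 \<Otimes>\<^sub>M M2) (\<lambda>(x, y). (f x)\<^sup>2 * (g y)\<^sup>2)"
  proof (rule Fubini_integrable)
    show "integrable M1 (\<lambda>x. \<integral>y. norm (case (x, y) of (x, y) \<Rightarrow> (f x)\<^sup>2 * (g y)\<^sup>2) \<partial>M2)"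
      using L2_integrable_sq[OF f] by (simp add: abs_mult)
  qed (use L2_integrable_sq[OF g] in auto)
  moreover have "(\<lambda>z. ((f \<otimes>\<^sub>f g) z)\<^sup>2) = (\<lambda>(x, y). (f x)\<^sup>2 * (g y)\<^sup>2)"
    by (auto simp: tensor_def power_mult_distrib)
  moreover have "f \<otimes>\<^sub>f g \<in> borel_measurable (M1 \<Otimes>\<^sub>M M2)"
    unfolding tensor_def by measurable
  ultimately show ?thesis by (simp add: L2_def)
qed

lemma L2_slice_snd:
  assumes F: "F \<in> L2 (M1 \<Otimes>\<^sub>M M2)"
  shows "AE x in M1. (\<lambda>y. F (x, y)) \<in> L2 M2"
  using AE_integrable_fst'[OF L2_integrable_sq[OF F]] AE_space[of M1]
proof eventually_elim
  case (elim x)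
  then show ?case
    using measurable_compose[OF measurable_Pair1' L2_measurable[OF F]] by (simp add: L2_def)
qed

text \<open>The Cauchy-Schwarz inequality on almost every slice bounds the squared average by an integrable
  function.\<close>
lemma avg_snd_L2:
  assumes F: "F \<in> L2 (M1 \<Otimes>\<^sub>M M2)" and g: "g \<in> L2 M2"
  shows "avg_snd F g \<in> L2 M1"
proof -
  note [measurable] = L2_measurable[OF F] L2_measurable[OF g]
  have meas: "avg_snd F g \<in> borel_measurable M1"
    unfolding avg_snd_def[abs_def] by measurable
  have "integrable M1 (\<lambda>x. (avg_snd F g x)\<^sup>2)"
  proof (rule Bochner_Integration.integrable_bound)
    show "integrable M1 (\<lambda>x. (\<integral>y. (F (x, y))\<^sup>2 \<partial>M2) * (\<integral>y. (g y)\<^sup>2 \<partial>M2))"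
      by (intro integrable_mult_left integrable_fst'[OF L2_integrable_sq[OF F]])
    show "AE x in M1. norm ((avg_snd F g x)\<^sup>2) \<le> norm ((\<integral>y. (F (x, y))\<^sup>2 \<partial>M2) * (\<integral>y. (g y)\<^sup>2 \<partial>M2))"
      using L2_slice_snd[OF F]
    proof eventually_elim
      case (elim x)
      have "\<bar>avg_snd F g x\<bar> \<le> ip_norm (L2_ip M2) (\<lambda>y. F (x, y)) * ip_norm (L2_ip M2) g"
        using L2.Cauchy_Schwarz[OF elim g] by (simp add: avg_snd_def L2_ip_def)
      then have "\<bar>avg_snd F g x\<bar>\<^sup>2 \<le> (ip_norm (L2_ip M2) (\<lambda>y. F (x, y)) * ip_norm (L2_ip M2) g)\<^sup>2"
        by (intro power_mono) auto
      then show ?case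
        by (simp add: power_mult_distrib L2_norm_sq_eq[OF elim] L2_norm_sq_eq[OF g])
    qed
  qed (use meas in measurable)
  then show ?thesis using meas by (simp add: L2_def)
qed

text \<open>By Fubini's theorem, averaging against \<open>g\<close> is adjoint to multiplying with \<open>g\<close>.\<close>
lemma avg_snd_ip:
  assumes F: "F \<in> L2 (M1 \<Otimes>\<^sub>M M2)" and g: "g \<in> L2 M2" and h: "h \<in> L2 M1"
  shows "L2_ip M1 (avg_snd F g) h = L2_ip (M1 \<Otimes>\<^sub>M M2) F (h \<otimes>\<^sub>f g)"
proof -
  have "L2_ip (M1 \<Otimes>\<^sub>M M2) F (h \<otimes>\<^sub>f g) = (\<integral>x. \<integral>y. F (x, y) * (h \<otimes>\<^sub>f g) (x, y) \<partial>M2 \<partial>M1)"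
    unfolding L2_ip_def by (rule integral_fst'[OF L2_integrable_mult[OF F L2_tensor[OF h g]], symmetric])
  also have "\<dots> = (\<integral>x. \<integral>y. h x * (F (x, y) * g y) \<partial>M2 \<partial>M1)"
    by (simp add: tensor_def mult_ac)
  also have "\<dots> = L2_ip M1 (avg_snd F g) h"
    by (simp add: L2_ip_def avg_snd_def mult.commute)
  finally show ?thesis by simp
qed

text \<open>Exchanging the factors turns statements about one kind of partial average into statements
  about the other.\<close>
lemma L2_swap:
  assumes F: "F \<in> L2 (M1 \<Otimes>\<^sub>M M2)"
  shows "(\<lambda>(y, x). F (x, y)) \<in> L2 (M2 \<Otimes>\<^sub>M M1)"
proof -
  have "integrable (M2 \<Otimes>\<^sub>M M1) (\<lambda>(y, x). (F (x, y))\<^sup>2)"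
    by (rule integrable_product_swap[OF L2_integrable_sq[OF F]])
  moreover have "(\<lambda>z. ((\<lambda>(y, x). F (x, y)) z)\<^sup>2) = (\<lambda>(y, x). (F (x, y))\<^sup>2)" by auto
  moreover have "(\<lambda>(y, x). F (x, y)) \<in> borel_measurable (M2 \<Otimes>\<^sub>M M1)"
    using measurable_compose[OF measurable_pair_swap' L2_measurable[OF F]] by (simp add: case_prod_beta')
  ultimately show ?thesis by (simp add: L2_def)
qed

lemma L2_ip_swap:
  assumes "F \<in> L2 (M1 \<Otimes>\<^sub>M M2)" "H \<in> L2 (M1 \<Otimes>\<^sub>M M2)"
  shows "L2_ip (M2 \<Otimes>\<^sub>M M1) (\<lambda>(y, x). F (x, y)) (\<lambda>(y, x). H (x, y)) = L2_ip (M1 \<Otimes>\<^sub>M M2) F H"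
  using integral_product_swap[of "\<lambda>z. F z * H z"] L2_measurable[OF assms(1)] L2_measurable[OF assms(2)]
  by (simp add: L2_ip_def case_prod_beta' borel_measurable_times)

lemma avg_fst_L2:
  assumes F: "F \<in> L2 (M1 \<Otimes>\<^sub>M M2)" and f: "f \<in> L2 M1"
  shows "avg_fst F f \<in> L2 M2"
proof -
  interpret swap: pair_sigma_finite M2 M1 ..
  show ?thesis
    using swap.avg_snd_L2[OF L2_swap[OF F] f] by (simp add: swap.avg_snd_def[abs_def] avg_fst_def[abs_def])
qed

lemma avg_fst_ip:
  assumes F: "F \<in> L2 (M1 \<Otimes>\<^sub>M M2)" and f: "f \<in> L2 M1" and h: "h \<in> L2 M2"
  shows "L2_ip M2 (avg_fst F f) h = L2_ip (M1 \<Otimes>\<^sub>M M2) F (f \<otimes>\<^sub>f h)"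
proof -
  interpret swap: pair_sigma_finite M2 M1 ..
  have "(\<lambda>(y, x). (f \<otimes>\<^sub>f h) (x, y)) = h \<otimes>\<^sub>f f"
    by (auto simp: tensor_def)
  then show ?thesis
    using swap.avg_snd_ip[OF L2_swap[OF F] f h] L2_ip_swap[OF F L2_tensor[OF f h]]
    by (simp add: swap.avg_snd_def[abs_def] avg_fst_def[abs_def])
qed

lemma L2_ip_tensor:
  assumes "f \<in> L2 M1" "g \<in> L2 M2" "f' \<in> L2 M1" "g' \<in> L2 M2"
  shows "L2_ip (M1 \<Otimes>\<^sub>M M2) (f \<otimes>\<^sub>f g) (f' \<otimes>\<^sub>f g') = L2_ip M1 f f' * L2_ip M2 g g'"
proof -
  have "avg_snd (f \<otimes>\<^sub>f g) g' x = L2_ip M2 g g' * f x" for x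
    by (simp add: avg_snd_def tensor_def L2_ip_def mult.assoc)
  then have "L2_ip M1 (avg_snd (f \<otimes>\<^sub>f g) g') f' = L2_ip M2 g g' * L2_ip M1 f f'"
    using L2.ip_scale[OF assms(1,3)] by (simp add: L2_ip_def)
  then show ?thesis
    using avg_snd_ip[OF L2_tensor[OF assms(1,2)] assms(4,3)] by simp
qed

text \<open>If \<open>w\<close> is orthogonal to all products, its averages against each \<open>g k\<close> vanish, hence so do
  almost all of its slices.\<close>
lemma tensor_total:
  fixes f :: "nat \<Rightarrow> 'a \<Rightarrow> real" and g :: "nat \<Rightarrow> 'b \<Rightarrow> real"
  assumes f: "\<And>j. f j \<in> L2 M1" and g: "\<And>k. g k \<in> L2 M2"
    and f_total: "\<And>u. u \<in> L2 M1 \<Longrightarrow> (\<And>j. L2_ip M1 u (f j) = 0) \<Longrightarrow> AE x in M1. u x = 0"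
    and g_total: "\<And>u. u \<in> L2 M2 \<Longrightarrow> (\<And>k. L2_ip M2 u (g k) = 0) \<Longrightarrow> AE y in M2. u y = 0"
    and w: "w \<in> L2 (M1 \<Otimes>\<^sub>M M2)"
    and orth: "\<And>j k. L2_ip (M1 \<Otimes>\<^sub>M M2) w (f j \<otimes>\<^sub>f g k) = 0"
  shows "AE z in M1 \<Otimes>\<^sub>M M2. w z = 0"
proof -
  have "AE x in M1. avg_snd w (g k) x = 0" for k
    using f_total[OF avg_snd_L2[OF w g]] avg_snd_ip[OF w g f] orth by simp
  then have "AE x in M1. \<forall>k. avg_snd w (g k) x = 0"
    by (subst AE_all_countable) blast
  then have "AE x in M1. AE y in M2. w (x, y) = 0"
    using L2_slice_snd[OF w]
  proof eventually_elim
    case (elim x)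
    then show ?case
      using g_total[of "\<lambda>y. w (x, y)"] by (simp add: avg_snd_def L2_ip_def)
  qed
  then show ?thesis
    using L2_measurable[OF w] by (intro AE_pair_measure) auto
qed

end

section \<open>Product domains\<close>

lemma sets_leb: "\<Omega> \<in> sets borel \<Longrightarrow> sets (leb \<Omega>) = {A \<in> sets borel. A \<subseteq> \<Omega>}"
  unfolding leb_def by (auto simp: sets_restrict_space_iff sets_restrict_space)

lemma sigma_finite_leb: "\<Omega> \<in> sets borel \<Longrightarrow> sigma_finite_measure (leb \<Omega>)"
  unfolding leb_def by (intro sigma_finite_measure_restrict_space sigma_finite_lborel) simp

text \<open>The measures agree on rectangles. As for the sigma-algebras, the inclusion of the rectangle
  \<open>\<Omega>1 \<times> \<Omega>2\<close> is measurable because its coordinates are, so every Borel subset of the rectangle is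
  measurable for the product.\<close>
lemma leb_Times:
  fixes \<Omega>1 :: "'a::euclidean_space set" and \<Omega>2 :: "'b::euclidean_space set"
  assumes \<Omega>: "\<Omega>1 \<in> sets borel" "\<Omega>2 \<in> sets borel"
  shows "leb \<Omega>1 \<Otimes>\<^sub>M leb \<Omega>2 = leb (\<Omega>1 \<times> \<Omega>2)"
proof (rule pair_measure_eqI)
  have prod: "A \<times> B \<in> sets borel" if "A \<in> sets borel" "B \<in> sets borel" for A :: "'a set" and B :: "'b set"
    using pair_measureI[OF that] by (subst (asm) borel_prod)
  have space: "space (leb \<Omega>) = \<Omega>" for \<Omega> :: "'c::euclidean_space set"
    by (simp add: leb_def space_restrict_space)
  show "sets (leb \<Omega>1 \<Otimes>\<^sub>M leb \<Omega>2) = sets (leb (\<Omega>1 \<times> \<Omega>2))"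
  proof
    show "sets (leb \<Omega>1 \<Otimes>\<^sub>M leb \<Omega>2) \<subseteq> sets (leb (\<Omega>1 \<times> \<Omega>2))"
      unfolding sets_pair_measure
    proof (rule sets.sigma_sets_subset')
      show "space (leb \<Omega>1) \<times> space (leb \<Omega>2) \<in> sets (leb (\<Omega>1 \<times> \<Omega>2))"
        using prod[OF \<Omega>] by (simp add: space sets_leb)
      show "{a \<times> b |a b. a \<in> sets (leb \<Omega>1) \<and> b \<in> sets (leb \<Omega>2)} \<subseteq> sets (leb (\<Omega>1 \<times> \<Omega>2))"
        using prod \<Omega> by (auto simp: sets_leb[OF \<Omega>(1)] sets_leb[OF \<Omega>(2)] sets_leb[OF prod[OF \<Omega>]])
    qed
    show "sets (leb (\<Omega>1 \<times> \<Omega>2)) \<subseteq> sets (leb \<Omega>1 \<Otimes>\<^sub>M leb \<Omega>2)"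
    proof
      fix C assume "C \<in> sets (leb (\<Omega>1 \<times> \<Omega>2))"
      then have "C \<in> sets borel" and C2: "C \<subseteq> \<Omega>1 \<times> \<Omega>2"
        using sets_leb[OF prod[OF \<Omega>]] by auto
      then have C: "C \<in> sets (borel \<Otimes>\<^sub>M borel)" by (subst borel_prod)
      have id: "(\<lambda>x. x) \<in> measurable (leb \<Omega>) borel" for \<Omega> :: "'c::euclidean_space set"
        unfolding leb_def by (rule measurable_restrict_space1) simp
      have "(\<lambda>z. (fst z, snd z)) \<in> measurable (leb \<Omega>1 \<Otimes>\<^sub>M leb \<Omega>2) (borel \<Otimes>\<^sub>M borel)"
        by (intro measurable_Pair measurable_compose[OF measurable_fst id] measurable_compose[OF measurable_snd id])
      from measurable_sets[OF this C]
      have "C \<inter> (\<Omega>1 \<times> \<Omega>2) \<in> sets (leb \<Omega>1 \<Otimes>\<^sub>M leb \<Omega>2)"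
        by (simp add: space_pair_measure space)
      then show "C \<in> sets (leb \<Omega>1 \<Otimes>\<^sub>M leb \<Omega>2)" using C2 by (simp add: Int_absorb2)
    qed
  qed
  have emeasure: "emeasure (leb \<Omega>) A = emeasure lborel A" if "\<Omega> \<in> sets borel" "A \<in> sets (leb \<Omega>)"
    for \<Omega> A :: "'c::euclidean_space set"
    using that unfolding sets_leb[OF that(1)] unfolding leb_def by (subst emeasure_restrict_space) auto
  fix A B assume A: "A \<in> sets (leb \<Omega>1)" and B: "B \<in> sets (leb \<Omega>2)"
  then have AB: "A \<in> sets borel" "B \<in> sets borel" "A \<subseteq> \<Omega>1" "B \<subseteq> \<Omega>2"
    using \<Omega> by (auto simp: sets_leb)
  then have "A \<times> B \<in> sets (leb (\<Omega>1 \<times> \<Omega>2))" using prod by (auto simp: sets_leb[OF prod[OF \<Omega>]])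
  then have "emeasure (leb (\<Omega>1 \<times> \<Omega>2)) (A \<times> B) = emeasure (lborel \<Otimes>\<^sub>M lborel) (A \<times> B)"
    using emeasure[OF prod[OF \<Omega>]] by (simp add: lborel_prod)
  also have "\<dots> = emeasure lborel A * emeasure lborel B"
    using AB by (intro lborel.emeasure_pair_measure_Times) auto
  finally show "emeasure (leb \<Omega>1) A * emeasure (leb \<Omega>2) B = emeasure (leb (\<Omega>1 \<times> \<Omega>2)) (A \<times> B)"
    using emeasure[OF \<Omega>(1) A] emeasure[OF \<Omega>(2) B] by simp
qed (use \<Omega> in \<open>auto intro: sigma_finite_leb\<close>)

locale product_domain =
  fixes \<Omega>1 :: "'a::euclidean_space set" and \<Omega>2 :: "'b::euclidean_space set"
  assumes open1: "open \<Omega>1" and open2: "open \<Omega>2"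
begin

lemma borel1: "\<Omega>1 \<in> sets borel" and borel2: "\<Omega>2 \<in> sets borel"
  using open1 open2 by auto

lemma open_prod: "open (\<Omega>1 \<times> \<Omega>2)"
  using open1 open2 by (rule open_Times)

sublocale pair_sigma_finite "leb \<Omega>1" "leb \<Omega>2"
  by (intro pair_sigma_finite.intro sigma_finite_leb borel1 borel2)

lemmas prod_eq = leb_Times[OF borel1 borel2]

lemma partial_tensor:
  assumes "smooth \<phi>" "smooth \<eta>"
  shows "frechet_derivative (\<phi> \<otimes>\<^sub>f \<eta>) (at z) (b, 0) = ((\<lambda>x. frechet_derivative \<phi> (at x) b) \<otimes>\<^sub>f \<eta>) z"
    and "frechet_derivative (\<phi> \<otimes>\<^sub>f \<eta>) (at z) (0, c) = (\<phi> \<otimes>\<^sub>f (\<lambda>y. frechet_derivative \<eta> (at y) c)) z"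
proof -
  obtain x y where z: "z = (x, y)" by (cases z)
  have s: "smooth (\<phi> \<otimes>\<^sub>f \<eta>)" using assms by (rule smooth_tensor)
  have "((\<lambda>x. (\<phi> \<otimes>\<^sub>f \<eta>) (x, y)) has_derivative (\<lambda>v. frechet_derivative \<phi> (at x) v * \<eta> y)) (at x)"
    using has_derivative_mult_left[OF smooth_has_derivative[OF assms(1)]] by (simp add: tensor_def)
  from has_derivative_unique[OF smooth_slice_has_derivative(1)[OF s] this]
  show "frechet_derivative (\<phi> \<otimes>\<^sub>f \<eta>) (at z) (b, 0) = ((\<lambda>x. frechet_derivative \<phi> (at x) b) \<otimes>\<^sub>f \<eta>) z"
    unfolding z tensor_def[of _ \<eta>] by (auto dest: fun_cong)
  have "((\<lambda>y. (\<phi> \<otimes>\<^sub>f \<eta>) (x, y)) has_derivative (\<lambda>v. \<phi> x * frechet_derivative \<eta> (at y) v)) (at y)"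
    using has_derivative_mult_right[OF smooth_has_derivative[OF assms(2)]] by (simp add: tensor_def)
  from has_derivative_unique[OF smooth_slice_has_derivative(2)[OF s] this]
  show "frechet_derivative (\<phi> \<otimes>\<^sub>f \<eta>) (at z) (0, c) = (\<phi> \<otimes>\<^sub>f (\<lambda>y. frechet_derivative \<eta> (at y) c)) z"
    unfolding z tensor_def[of \<phi>] by (auto dest: fun_cong)
qed

end

context product_domain
begin

lemmas tensor_L2 = L2_tensor[unfolded prod_eq]
lemmas snd_avg_L2 = avg_snd_L2[unfolded prod_eq]
lemmas snd_avg_ip = avg_snd_ip[unfolded prod_eq]
lemmas fst_avg_L2 = avg_fst_L2[unfolded prod_eq]
lemmas fst_avg_ip = avg_fst_ip[unfolded prod_eq]
lemmas tensor_ip = L2_ip_tensor[unfolded prod_eq]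

lemma test_L2:
  "\<phi> \<in> test_functions \<Omega>1 \<Longrightarrow> \<phi> \<in> L2 (leb \<Omega>1)"
  "\<eta> \<in> test_functions \<Omega>2 \<Longrightarrow> \<eta> \<in> L2 (leb \<Omega>2)"
  "\<omega> \<in> test_functions (\<Omega>1 \<times> \<Omega>2) \<Longrightarrow> \<omega> \<in> L2 (leb (\<Omega>1 \<times> \<Omega>2))"
  using borel1 borel2 borel_open[OF open_prod] by (auto intro: test_function_L2)

text \<open>An identity that holds for products with test functions in one variable extends to products
  with arbitrary square-integrable functions: averaging over the other variable leaves a
  square-integrable function that is orthogonal to all test functions.\<close>
lemma extend_test_snd:
  assumes F: "F \<in> L2 (leb (\<Omega>1 \<times> \<Omega>2))" and H: "H \<in> L2 (leb (\<Omega>1 \<times> \<Omega>2))"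
    and \<alpha>: "\<alpha> \<in> L2 (leb \<Omega>1)" and \<beta>: "\<beta> \<in> L2 (leb \<Omega>1)" and g: "g \<in> L2 (leb \<Omega>2)"
    and test: "\<And>\<eta>. \<eta> \<in> test_functions \<Omega>2 \<Longrightarrow>
      L2_ip (leb (\<Omega>1 \<times> \<Omega>2)) F (\<alpha> \<otimes>\<^sub>f \<eta>) = - L2_ip (leb (\<Omega>1 \<times> \<Omega>2)) H (\<beta> \<otimes>\<^sub>f \<eta>)"
  shows "L2_ip (leb (\<Omega>1 \<times> \<Omega>2)) F (\<alpha> \<otimes>\<^sub>f g) = - L2_ip (leb (\<Omega>1 \<times> \<Omega>2)) H (\<beta> \<otimes>\<^sub>f g)"
proof -
  let ?P = "\<lambda>y. 1 * avg_fst F \<alpha> y + 1 * avg_fst H \<beta> y"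
  note avg = fst_avg_L2[OF F \<alpha>] fst_avg_L2[OF H \<beta>]
  have ip: "L2_ip (leb \<Omega>2) ?P h = L2_ip (leb (\<Omega>1 \<times> \<Omega>2)) F (\<alpha> \<otimes>\<^sub>f h) + L2_ip (leb (\<Omega>1 \<times> \<Omega>2)) H (\<beta> \<otimes>\<^sub>f h)"
    if "h \<in> L2 (leb \<Omega>2)" for h
    using L2.ip_lin[OF avg that, of 1 1] fst_avg_ip[OF F \<alpha> that] fst_avg_ip[OF H \<beta> that] by simp
  have P: "?P \<in> L2 (leb \<Omega>2)" by (rule L2.lin_mem[OF avg])
  have "AE y in leb \<Omega>2. ?P y = 0"
  proof (rule AE_zero_of_test_functions[OF open2 P])
    fix \<eta> assume \<eta>: "\<eta> \<in> test_functions \<Omega>2"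
    show "(\<integral>y. ?P y * \<eta> y \<partial>leb \<Omega>2) = 0"
      using ip[OF test_L2(2)[OF \<eta>]] test[OF \<eta>] by (simp add: L2_ip_def)
  qed
  then have "L2_ip (leb \<Omega>2) ?P g = L2_ip (leb \<Omega>2) (\<lambda>y. 0) g"
    using P g by (intro L2_ip_cong_AE L2_zero) auto
  then show ?thesis using ip[OF g] L2.ip_zero[OF g] by simp
qed

lemma extend_test_fst:
  assumes F: "F \<in> L2 (leb (\<Omega>1 \<times> \<Omega>2))" and H: "H \<in> L2 (leb (\<Omega>1 \<times> \<Omega>2))"
    and \<alpha>: "\<alpha> \<in> L2 (leb \<Omega>2)" and \<beta>: "\<beta> \<in> L2 (leb \<Omega>2)" and f: "f \<in> L2 (leb \<Omega>1)"
    and test: "\<And>\<phi>. \<phi> \<in> test_functions \<Omega>1 \<Longrightarrow>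
      L2_ip (leb (\<Omega>1 \<times> \<Omega>2)) F (\<phi> \<otimes>\<^sub>f \<alpha>) = - L2_ip (leb (\<Omega>1 \<times> \<Omega>2)) H (\<phi> \<otimes>\<^sub>f \<beta>)"
  shows "L2_ip (leb (\<Omega>1 \<times> \<Omega>2)) F (f \<otimes>\<^sub>f \<alpha>) = - L2_ip (leb (\<Omega>1 \<times> \<Omega>2)) H (f \<otimes>\<^sub>f \<beta>)"
proof -
  let ?P = "\<lambda>x. 1 * avg_snd F \<alpha> x + 1 * avg_snd H \<beta> x"
  note avg = snd_avg_L2[OF F \<alpha>] snd_avg_L2[OF H \<beta>]
  have ip: "L2_ip (leb \<Omega>1) ?P h = L2_ip (leb (\<Omega>1 \<times> \<Omega>2)) F (h \<otimes>\<^sub>f \<alpha>) + L2_ip (leb (\<Omega>1 \<times> \<Omega>2)) H (h \<otimes>\<^sub>f \<beta>)"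
    if "h \<in> L2 (leb \<Omega>1)" for h
    using L2.ip_lin[OF avg that, of 1 1] snd_avg_ip[OF F \<alpha> that] snd_avg_ip[OF H \<beta> that] by simp
  have P: "?P \<in> L2 (leb \<Omega>1)" by (rule L2.lin_mem[OF avg])
  have "AE x in leb \<Omega>1. ?P x = 0"
  proof (rule AE_zero_of_test_functions[OF open1 P])
    fix \<phi> assume \<phi>: "\<phi> \<in> test_functions \<Omega>1"
    show "(\<integral>x. ?P x * \<phi> x \<partial>leb \<Omega>1) = 0"
      using ip[OF test_L2(1)[OF \<phi>]] test[OF \<phi>] by (simp add: L2_ip_def)
  qed
  then have "L2_ip (leb \<Omega>1) ?P f = L2_ip (leb \<Omega>1) (\<lambda>x. 0) f"
    using P f by (intro L2_ip_cong_AE L2_zero) auto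
  then show ?thesis using ip[OF f] L2.ip_zero[OF f] by simp
qed

text \<open>If the weight is a test function \<open>\<eta>\<close>, this is the weak gradient identity of \<open>w\<close> tested with
  \<open>\<phi> \<otimes>\<^sub>f \<eta>\<close>; \<open>extend_test_snd\<close> reaches general weights. In short, weak differentiation in one variable
  commutes with averaging over the other.\<close>
lemma avg_snd_weak_gradient:
  assumes w: "w \<in> L2 (leb (\<Omega>1 \<times> \<Omega>2))" and G: "L2_weak_gradient (\<Omega>1 \<times> \<Omega>2) w G"
    and g: "g \<in> L2 (leb \<Omega>2)"
  shows "L2_weak_gradient \<Omega>1 (avg_snd w g) (\<lambda>x. \<Sum>b\<in>Basis. avg_snd (\<lambda>z. G z \<bullet> (b, 0)) g x *\<^sub>R b)"
    (is "L2_weak_gradient _ _ ?K")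
proof (rule weak_gradientI)
  fix b :: 'a assume b: "b \<in> Basis"
  then have b0: "(b, 0) \<in> (Basis :: ('a \<times> 'b) set)" by (simp add: Basis_prod_def)
  note Gb = weak_gradient_L2[OF G b0]
  have Kb: "(\<lambda>x. ?K x \<bullet> b) = avg_snd (\<lambda>z. G z \<bullet> (b, 0)) g" using b by simp
  show "(\<lambda>x. ?K x \<bullet> b) \<in> L2 (leb \<Omega>1)" unfolding Kb by (rule snd_avg_L2[OF Gb g])
  fix \<phi> assume \<phi>: "\<phi> \<in> test_functions \<Omega>1"
  let ?D = "\<lambda>x. frechet_derivative \<phi> (at x) b"
  have \<phi>2: "\<phi> \<in> L2 (leb \<Omega>1)" "?D \<in> L2 (leb \<Omega>1)"
    using \<phi> b by (auto intro: test_L2 test_function_partial)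
  have "L2_ip (leb (\<Omega>1 \<times> \<Omega>2)) w (?D \<otimes>\<^sub>f g) = - L2_ip (leb (\<Omega>1 \<times> \<Omega>2)) (\<lambda>z. G z \<bullet> (b, 0)) (\<phi> \<otimes>\<^sub>f g)"
  proof (rule extend_test_snd[OF w Gb \<phi>2(2) \<phi>2(1) g])
    fix \<eta> assume \<eta>: "\<eta> \<in> test_functions \<Omega>2"
    show "L2_ip (leb (\<Omega>1 \<times> \<Omega>2)) w (?D \<otimes>\<^sub>f \<eta>) = - L2_ip (leb (\<Omega>1 \<times> \<Omega>2)) (\<lambda>z. G z \<bullet> (b, 0)) (\<phi> \<otimes>\<^sub>f \<eta>)"
      using weak_gradient_test[OF G b0 test_function_tensor[OF \<phi> \<eta>]]
      by (simp add: partial_tensor[OF test_function_smooth[OF \<phi>] test_function_smooth[OF \<eta>]])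
  qed
  then show "L2_ip (leb \<Omega>1) (avg_snd w g) ?D = - L2_ip (leb \<Omega>1) (\<lambda>x. ?K x \<bullet> b) \<phi>"
    unfolding Kb snd_avg_ip[OF w g \<phi>2(2)] snd_avg_ip[OF Gb g \<phi>2(1)] .
qed

lemma avg_fst_weak_gradient:
  assumes w: "w \<in> L2 (leb (\<Omega>1 \<times> \<Omega>2))" and G: "L2_weak_gradient (\<Omega>1 \<times> \<Omega>2) w G"
    and f: "f \<in> L2 (leb \<Omega>1)"
  shows "L2_weak_gradient \<Omega>2 (avg_fst w f) (\<lambda>y. \<Sum>b\<in>Basis. avg_fst (\<lambda>z. G z \<bullet> (0, b)) f y *\<^sub>R b)"
    (is "L2_weak_gradient _ _ ?K")
proof (rule weak_gradientI)
  fix b :: 'b assume b: "b \<in> Basis"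
  then have b0: "(0, b) \<in> (Basis :: ('a \<times> 'b) set)" by (simp add: Basis_prod_def)
  note Gb = weak_gradient_L2[OF G b0]
  have Kb: "(\<lambda>x. ?K x \<bullet> b) = avg_fst (\<lambda>z. G z \<bullet> (0, b)) f" using b by simp
  show "(\<lambda>x. ?K x \<bullet> b) \<in> L2 (leb \<Omega>2)" unfolding Kb by (rule fst_avg_L2[OF Gb f])
  fix \<eta> assume \<eta>: "\<eta> \<in> test_functions \<Omega>2"
  let ?D = "\<lambda>y. frechet_derivative \<eta> (at y) b"
  have \<eta>2: "\<eta> \<in> L2 (leb \<Omega>2)" "?D \<in> L2 (leb \<Omega>2)"
    using \<eta> b by (auto intro: test_L2 test_function_partial)
  have "L2_ip (leb (\<Omega>1 \<times> \<Omega>2)) w (f \<otimes>\<^sub>f ?D) = - L2_ip (leb (\<Omega>1 \<times> \<Omega>2)) (\<lambda>z. G z \<bullet> (0, b)) (f \<otimes>\<^sub>f \<eta>)"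
  proof (rule extend_test_fst[OF w Gb \<eta>2(2) \<eta>2(1) f])
    fix \<phi> assume \<phi>: "\<phi> \<in> test_functions \<Omega>1"
    show "L2_ip (leb (\<Omega>1 \<times> \<Omega>2)) w (\<phi> \<otimes>\<^sub>f ?D) = - L2_ip (leb (\<Omega>1 \<times> \<Omega>2)) (\<lambda>z. G z \<bullet> (0, b)) (\<phi> \<otimes>\<^sub>f \<eta>)"
      using weak_gradient_test[OF G b0 test_function_tensor[OF \<phi> \<eta>]]
      by (simp add: partial_tensor[OF test_function_smooth[OF \<phi>] test_function_smooth[OF \<eta>]])
  qed
  then show "L2_ip (leb \<Omega>2) (avg_fst w f) ?D = - L2_ip (leb \<Omega>2) (\<lambda>x. ?K x \<bullet> b) \<eta>"
    unfolding Kb fst_avg_ip[OF w f \<eta>2(2)] fst_avg_ip[OF Gb f \<eta>2(1)] .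
qed

definition tensor_grad :: "('a \<Rightarrow> real) \<Rightarrow> ('a \<Rightarrow> 'a) \<Rightarrow> ('b \<Rightarrow> real) \<Rightarrow> ('b \<Rightarrow> 'b) \<Rightarrow> 'a \<times> 'b \<Rightarrow> 'a \<times> 'b" where
  "tensor_grad f F g G = (\<lambda>(x, y). (g y *\<^sub>R F x, f x *\<^sub>R G y))"

lemma tensor_grad_components:
  "(\<lambda>z. tensor_grad f F g G z \<bullet> (b, 0)) = (\<lambda>x. F x \<bullet> b) \<otimes>\<^sub>f g"
  "(\<lambda>z. tensor_grad f F g G z \<bullet> (0, c)) = f \<otimes>\<^sub>f (\<lambda>y. G y \<bullet> c)"
  by (auto simp: tensor_grad_def tensor_def)

text \<open>For fixed \<open>y\<close> the slice of a test function on the product is a test function of the first variable,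
  so the weak derivative of \<open>f\<close> can be applied slice by slice before integrating against \<open>g\<close>. The
  other variable is treated in the same way.\<close>
lemma tensor_weak_gradient:
  assumes f: "f \<in> L2 (leb \<Omega>1)" and F: "L2_weak_gradient \<Omega>1 f F"
    and g: "g \<in> L2 (leb \<Omega>2)" and G: "L2_weak_gradient \<Omega>2 g G"
  shows "L2_weak_gradient (\<Omega>1 \<times> \<Omega>2) (f \<otimes>\<^sub>f g) (tensor_grad f F g G)"
proof (rule weak_gradientI)
  fix \<beta> :: "'a \<times> 'b" assume "\<beta> \<in> Basis"
  then consider b where "b \<in> Basis" "\<beta> = (b, 0)" | c where "c \<in> Basis" "\<beta> = (0, c)"
    by (auto simp: Basis_prod_def)
  then have "(\<lambda>z. tensor_grad f F g G z \<bullet> \<beta>) \<in> L2 (leb (\<Omega>1 \<times> \<Omega>2)) \<and>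
    (\<forall>\<omega>\<in>test_functions (\<Omega>1 \<times> \<Omega>2).
       L2_ip (leb (\<Omega>1 \<times> \<Omega>2)) (f \<otimes>\<^sub>f g) (\<lambda>z. frechet_derivative \<omega> (at z) \<beta>)
       = - L2_ip (leb (\<Omega>1 \<times> \<Omega>2)) (\<lambda>z. tensor_grad f F g G z \<bullet> \<beta>) \<omega>)"
  proof cases
    case (1 b)
    note Fb = weak_gradient_L2[OF F 1(1)]
    have "L2_ip (leb (\<Omega>1 \<times> \<Omega>2)) (f \<otimes>\<^sub>f g) (\<lambda>z. frechet_derivative \<omega> (at z) \<beta>)
        = - L2_ip (leb (\<Omega>1 \<times> \<Omega>2)) ((\<lambda>x. F x \<bullet> b) \<otimes>\<^sub>f g) \<omega>"
      if \<omega>: "\<omega> \<in> test_functions (\<Omega>1 \<times> \<Omega>2)" for \<omega>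
    proof -
      let ?D = "\<lambda>z. frechet_derivative \<omega> (at z) \<beta>"
      have D: "?D \<in> L2 (leb (\<Omega>1 \<times> \<Omega>2))" "\<omega> \<in> L2 (leb (\<Omega>1 \<times> \<Omega>2))"
        using \<omega> \<open>\<beta> \<in> Basis\<close> by (auto intro: test_L2 test_function_partial)
      have "avg_fst ?D f y = - avg_fst \<omega> (\<lambda>x. F x \<bullet> b) y" for y
      proof -
        have "frechet_derivative (\<lambda>x. \<omega> (x, y)) (at x) b = ?D (x, y)" for x
          using frechet_derivative_at[OF smooth_slice_has_derivative(1)[OF test_function_smooth[OF \<omega>], of y x], THEN fun_cong, of b] 1
          by simp
        then show ?thesis
          using weak_gradient_test[OF F 1(1) test_function_slice_fst[OF \<omega>, of y]]
          by (simp add: avg_fst_def L2_ip_def mult.commute)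
      qed
      then have "L2_ip (leb \<Omega>2) (avg_fst ?D f) g = - L2_ip (leb \<Omega>2) (avg_fst \<omega> (\<lambda>x. F x \<bullet> b)) g"
        by (simp add: L2_ip_def)
      then show ?thesis
        using fst_avg_ip[OF D(1) f g] fst_avg_ip[OF D(2) Fb g]
          L2.ip_sym[OF D(1) tensor_L2[OF f g]] L2.ip_sym[OF D(2) tensor_L2[OF Fb g]] by simp
    qed
    then show ?thesis using 1 tensor_L2[OF Fb g] by (simp add: tensor_grad_components)
  next
    case (2 c)
    note Gc = weak_gradient_L2[OF G 2(1)]
    have "L2_ip (leb (\<Omega>1 \<times> \<Omega>2)) (f \<otimes>\<^sub>f g) (\<lambda>z. frechet_derivative \<omega> (at z) \<beta>)
        = - L2_ip (leb (\<Omega>1 \<times> \<Omega>2)) (f \<otimes>\<^sub>f (\<lambda>y. G y \<bullet> c)) \<omega>"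
      if \<omega>: "\<omega> \<in> test_functions (\<Omega>1 \<times> \<Omega>2)" for \<omega>
    proof -
      let ?D = "\<lambda>z. frechet_derivative \<omega> (at z) \<beta>"
      have D: "?D \<in> L2 (leb (\<Omega>1 \<times> \<Omega>2))" "\<omega> \<in> L2 (leb (\<Omega>1 \<times> \<Omega>2))"
        using \<omega> \<open>\<beta> \<in> Basis\<close> by (auto intro: test_L2 test_function_partial)
      have "avg_snd ?D g x = - avg_snd \<omega> (\<lambda>y. G y \<bullet> c) x" for x
      proof -
        have "frechet_derivative (\<lambda>y. \<omega> (x, y)) (at y) c = ?D (x, y)" for y
          using frechet_derivative_at[OF smooth_slice_has_derivative(2)[OF test_function_smooth[OF \<omega>], of x y], THEN fun_cong, of c] 2
          by simp
        then show ?thesis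
          using weak_gradient_test[OF G 2(1) test_function_slice_snd[OF \<omega>, of x]]
          by (simp add: avg_snd_def L2_ip_def mult.commute)
      qed
      then have "L2_ip (leb \<Omega>1) (avg_snd ?D g) f = - L2_ip (leb \<Omega>1) (avg_snd \<omega> (\<lambda>y. G y \<bullet> c)) f"
        by (simp add: L2_ip_def)
      then show ?thesis
        using snd_avg_ip[OF D(1) g f] snd_avg_ip[OF D(2) Gc f]
          L2.ip_sym[OF D(1) tensor_L2[OF f g]] L2.ip_sym[OF D(2) tensor_L2[OF f Gc]] by simp
    qed
    then show ?thesis using 2 tensor_L2[OF f Gc] by (simp add: tensor_grad_components)
  qed
  then show "(\<lambda>z. tensor_grad f F g G z \<bullet> \<beta>) \<in> L2 (leb (\<Omega>1 \<times> \<Omega>2))"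
    and "\<And>\<omega>. \<omega> \<in> test_functions (\<Omega>1 \<times> \<Omega>2) \<Longrightarrow>
       L2_ip (leb (\<Omega>1 \<times> \<Omega>2)) (f \<otimes>\<^sub>f g) (\<lambda>z. frechet_derivative \<omega> (at z) \<beta>)
       = - L2_ip (leb (\<Omega>1 \<times> \<Omega>2)) (\<lambda>z. tensor_grad f F g G z \<bullet> \<beta>) \<omega>"
    by blast+
qed

lemma vec_ip_tensor_grad:
  "vec_ip M H (tensor_grad f F g G)
     = (\<Sum>b\<in>Basis. L2_ip M (\<lambda>z. H z \<bullet> (b, 0)) ((\<lambda>x. F x \<bullet> b) \<otimes>\<^sub>f g))
     + (\<Sum>c\<in>Basis. L2_ip M (\<lambda>z. H z \<bullet> (0, c)) (f \<otimes>\<^sub>f (\<lambda>y. G y \<bullet> c)))"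
proof -
  have inj: "inj_on (\<lambda>b. (b, 0)) (Basis :: 'a set)" "inj_on (\<lambda>c. (0, c)) (Basis :: 'b set)"
    by (auto intro: inj_onI)
  show ?thesis
    unfolding vec_ip_def Basis_prod_def
    by (subst sum.union_disjoint)
      (auto simp: sum.reindex[OF inj(1)] sum.reindex[OF inj(2)] tensor_grad_components)
qed

lemma tensor_H1: "f \<in> H1 \<Omega>1 \<Longrightarrow> g \<in> H1 \<Omega>2 \<Longrightarrow> f \<otimes>\<^sub>f g \<in> H1 (\<Omega>1 \<times> \<Omega>2)"
  by (rule H1I[OF tensor_L2 tensor_weak_gradient]) (auto intro: H1_L2 H1_weak_gradient)

text \<open>Averaging \<open>w\<close> over one variable against an eigenfunction gives an admissible test function
  for the eigenvalue problem in the other variable. Adding the two resulting identities shows that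
  a product of eigenfunctions is a weak eigenfunction for the sum of the eigenvalues.\<close>
lemma H1_ip_tensor_eigenfunctions:
  assumes w: "w \<in> H1 (\<Omega>1 \<times> \<Omega>2)"
    and f: "neumann_eigenpair \<Omega>1 \<kappa> f" and g: "neumann_eigenpair \<Omega>2 \<mu> g"
  shows "H1_ip (\<Omega>1 \<times> \<Omega>2) w (f \<otimes>\<^sub>f g) = (1 + \<kappa> + \<mu>) * L2_ip (leb (\<Omega>1 \<times> \<Omega>2)) w (f \<otimes>\<^sub>f g)"
proof -
  define F G H where "F = grad \<Omega>1 f" and "G = grad \<Omega>2 g" and "H = grad (\<Omega>1 \<times> \<Omega>2) w"
  have fH: "f \<in> H1 \<Omega>1" and gH: "g \<in> H1 \<Omega>2"
    using f g by (auto simp: neumann_eigenpair_def)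
  note fL = H1_L2[OF fH] and gL = H1_L2[OF gH] and wL = H1_L2[OF w]
  have F: "L2_weak_gradient \<Omega>1 f F" and G: "L2_weak_gradient \<Omega>2 g G"
    and H: "L2_weak_gradient (\<Omega>1 \<times> \<Omega>2) w H"
    unfolding F_def G_def H_def using fH gH w by (auto intro: H1_weak_gradient)
  have Hb: "(\<lambda>z. H z \<bullet> (b, 0)) \<in> L2 (leb (\<Omega>1 \<times> \<Omega>2))" if "b \<in> Basis" for b
    using that by (intro weak_gradient_L2[OF H]) (simp add: Basis_prod_def)
  have Hc: "(\<lambda>z. H z \<bullet> (0, c)) \<in> L2 (leb (\<Omega>1 \<times> \<Omega>2))" if "c \<in> Basis" for c
    using that by (intro weak_gradient_L2[OF H]) (simp add: Basis_prod_def)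
  have fst_sum: "(\<Sum>b\<in>Basis. L2_ip (leb (\<Omega>1 \<times> \<Omega>2)) (\<lambda>z. H z \<bullet> (b, 0)) ((\<lambda>x. F x \<bullet> b) \<otimes>\<^sub>f g))
      = \<kappa> * L2_ip (leb (\<Omega>1 \<times> \<Omega>2)) w (f \<otimes>\<^sub>f g)"
  proof -
    define K where "K x = (\<Sum>b\<in>Basis. avg_snd (\<lambda>z. H z \<bullet> (b, 0)) g x *\<^sub>R b)" for x
    have K: "L2_weak_gradient \<Omega>1 (avg_snd w g) K"
      unfolding K_def[abs_def] by (rule avg_snd_weak_gradient[OF wL H gL])
    note L = snd_avg_L2[OF wL gL]
    have WH: "avg_snd w g \<in> H1 \<Omega>1" using L K by (rule H1I)
    note gradW = H1_weak_gradient[OF WH]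
    have "(\<Sum>b\<in>Basis. L2_ip (leb (\<Omega>1 \<times> \<Omega>2)) (\<lambda>z. H z \<bullet> (b, 0)) ((\<lambda>x. F x \<bullet> b) \<otimes>\<^sub>f g))
        = vec_ip (leb \<Omega>1) K F"
      unfolding vec_ip_def
    proof (rule sum.cong[OF refl])
      fix b :: 'a assume b: "b \<in> Basis"
      then have "(\<lambda>x. K x \<bullet> b) = avg_snd (\<lambda>z. H z \<bullet> (b, 0)) g" by (simp add: K_def)
      then show "L2_ip (leb (\<Omega>1 \<times> \<Omega>2)) (\<lambda>z. H z \<bullet> (b, 0)) ((\<lambda>x. F x \<bullet> b) \<otimes>\<^sub>f g)
          = L2_ip (leb \<Omega>1) (\<lambda>x. K x \<bullet> b) (\<lambda>x. F x \<bullet> b)"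
        using snd_avg_ip[OF Hb[OF b] gL weak_gradient_L2[OF F b]] by simp
    qed
    also have "\<dots> = vec_ip (leb \<Omega>1) F (grad \<Omega>1 (avg_snd w g))"
      using H1_ip_eq[OF open1 K F L fL] H1_ip_eq[OF open1 gradW F L fL] vec_ip_sym[of "leb \<Omega>1" F] by simp
    also have "\<dots> = (\<integral>x. F x \<bullet> grad \<Omega>1 (avg_snd w g) x \<partial>leb \<Omega>1)"
      using integral_inner_eq_vec_ip(2)[OF weak_gradient_L2[OF F] weak_gradient_L2[OF gradW]] by simp
    also have "\<dots> = \<kappa> * L2_ip (leb \<Omega>1) f (avg_snd w g)"
      using f WH by (simp add: neumann_eigenpair_def F_def L2_ip_def)
    also have "\<dots> = \<kappa> * L2_ip (leb (\<Omega>1 \<times> \<Omega>2)) w (f \<otimes>\<^sub>f g)"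
      using snd_avg_ip[OF wL gL fL] L2.ip_sym[OF fL L] by simp
    finally show ?thesis .
  qed
  have snd_sum: "(\<Sum>c\<in>Basis. L2_ip (leb (\<Omega>1 \<times> \<Omega>2)) (\<lambda>z. H z \<bullet> (0, c)) (f \<otimes>\<^sub>f (\<lambda>y. G y \<bullet> c)))
      = \<mu> * L2_ip (leb (\<Omega>1 \<times> \<Omega>2)) w (f \<otimes>\<^sub>f g)"
  proof -
    define K where "K y = (\<Sum>c\<in>Basis. avg_fst (\<lambda>z. H z \<bullet> (0, c)) f y *\<^sub>R c)" for y
    have K: "L2_weak_gradient \<Omega>2 (avg_fst w f) K"
      unfolding K_def[abs_def] by (rule avg_fst_weak_gradient[OF wL H fL])
    note L = fst_avg_L2[OF wL fL]
    have WH: "avg_fst w f \<in> H1 \<Omega>2" using L K by (rule H1I)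
    note gradW = H1_weak_gradient[OF WH]
    have "(\<Sum>c\<in>Basis. L2_ip (leb (\<Omega>1 \<times> \<Omega>2)) (\<lambda>z. H z \<bullet> (0, c)) (f \<otimes>\<^sub>f (\<lambda>y. G y \<bullet> c)))
        = vec_ip (leb \<Omega>2) K G"
      unfolding vec_ip_def
    proof (rule sum.cong[OF refl])
      fix c :: 'b assume c: "c \<in> Basis"
      then have "(\<lambda>y. K y \<bullet> c) = avg_fst (\<lambda>z. H z \<bullet> (0, c)) f" by (simp add: K_def)
      then show "L2_ip (leb (\<Omega>1 \<times> \<Omega>2)) (\<lambda>z. H z \<bullet> (0, c)) (f \<otimes>\<^sub>f (\<lambda>y. G y \<bullet> c))
          = L2_ip (leb \<Omega>2) (\<lambda>y. K y \<bullet> c) (\<lambda>y. G y \<bullet> c)"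
        using fst_avg_ip[OF Hc[OF c] fL weak_gradient_L2[OF G c]] by simp
    qed
    also have "\<dots> = vec_ip (leb \<Omega>2) G (grad \<Omega>2 (avg_fst w f))"
      using H1_ip_eq[OF open2 K G L gL] H1_ip_eq[OF open2 gradW G L gL] vec_ip_sym[of "leb \<Omega>2" G] by simp
    also have "\<dots> = (\<integral>y. G y \<bullet> grad \<Omega>2 (avg_fst w f) y \<partial>leb \<Omega>2)"
      using integral_inner_eq_vec_ip(2)[OF weak_gradient_L2[OF G] weak_gradient_L2[OF gradW]] by simp
    also have "\<dots> = \<mu> * L2_ip (leb \<Omega>2) g (avg_fst w f)"
      using g WH by (simp add: neumann_eigenpair_def G_def L2_ip_def)
    also have "\<dots> = \<mu> * L2_ip (leb (\<Omega>1 \<times> \<Omega>2)) w (f \<otimes>\<^sub>f g)"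
      using fst_avg_ip[OF wL fL gL] L2.ip_sym[OF gL L] by simp
    finally show ?thesis .
  qed
  have "H1_ip (\<Omega>1 \<times> \<Omega>2) w (f \<otimes>\<^sub>f g)
      = L2_ip (leb (\<Omega>1 \<times> \<Omega>2)) w (f \<otimes>\<^sub>f g) + vec_ip (leb (\<Omega>1 \<times> \<Omega>2)) H (tensor_grad f F g G)"
    by (rule H1_ip_eq[OF open_prod H tensor_weak_gradient[OF fL F gL G] wL tensor_L2[OF fL gL]])
  also have "vec_ip (leb (\<Omega>1 \<times> \<Omega>2)) H (tensor_grad f F g G) = (\<kappa> + \<mu>) * L2_ip (leb (\<Omega>1 \<times> \<Omega>2)) w (f \<otimes>\<^sub>f g)"
    by (simp only: vec_ip_tensor_grad fst_sum snd_sum distrib_right)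
  finally show ?thesis by (simp add: algebra_simps)
qed

end

section \<open>Neumann eigenfunctions\<close>

lemma neumann_eigenpair_H1_ip:
  assumes f: "neumann_eigenpair \<Omega> \<mu> f" and h: "h \<in> H1 \<Omega>"
  shows "H1_ip \<Omega> f h = (1 + \<mu>) * L2_ip (leb \<Omega>) f h"
proof -
  have fH: "f \<in> H1 \<Omega>" using f by (simp add: neumann_eigenpair_def)
  note int = L2_integrable_mult[OF H1_L2[OF fH] H1_L2[OF h]]
    integral_inner_eq_vec_ip(1)[OF weak_gradient_L2[OF H1_weak_gradient[OF fH]] weak_gradient_L2[OF H1_weak_gradient[OF h]]]
  show ?thesis
    using f h int by (simp add: H1_ip_def L2_ip_def neumann_eigenpair_def algebra_simps)
qed

text \<open>The Dirichlet integral of \<open>f\<close> is \<open>\<mu>\<close> times its positive squared norm.\<close>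
lemma neumann_eigenvalue_nonneg:
  assumes f: "neumann_eigenpair \<Omega> \<mu> f"
  shows "0 \<le> \<mu>"
proof -
  have fH: "f \<in> H1 \<Omega>" and nz: "\<not> (AE x in leb \<Omega>. f x = 0)"
    using f by (auto simp: neumann_eigenpair_def)
  have "(\<integral>x. grad \<Omega> f x \<bullet> grad \<Omega> f x \<partial>leb \<Omega>) = \<mu> * L2_ip (leb \<Omega>) f f"
    using f fH unfolding neumann_eigenpair_def L2_ip_def by blast
  moreover have "0 \<le> (\<integral>x. grad \<Omega> f x \<bullet> grad \<Omega> f x \<partial>leb \<Omega>)" by simp
  ultimately have "0 \<le> \<mu> * L2_ip (leb \<Omega>) f f" by simp
  moreover have "L2_ip (leb \<Omega>) f f > 0"
    using L2_ip_zero_iff[OF H1_L2[OF fH]] L2.ip_nonneg[OF H1_L2[OF fH]] nz by linarith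
  ultimately show ?thesis by (simp add: zero_le_mult_iff)
qed

lemma neumann_eigendata_L2_ip:
  assumes "neumann_eigendata \<Omega> lam f"
  shows "L2_ip (leb \<Omega>) (f j) (f k) = (if j = k then 1 / (1 + lam j) else 0)"
proof -
  have f: "neumann_eigenpair \<Omega> (lam j) (f j)" "f k \<in> H1 \<Omega>"
    and on: "H1_ip \<Omega> (f j) (f k) = (if j = k then 1 else 0)"
    using assms by (auto simp: neumann_eigendata_def neumann_eigenpair_def maximal_orthonormal_def orthonormal_def)
  have "1 + lam j > 0" using neumann_eigenvalue_nonneg[OF f(1)] by simp
  then have "L2_ip (leb \<Omega>) (f j) (f k) = H1_ip \<Omega> (f j) (f k) / (1 + lam j)"
    using neumann_eigenpair_H1_ip[OF f] by simp
  then show ?thesis by (simp add: on)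
qed

text \<open>Orthogonality to the eigenfunctions in \<open>L2\<close> extends to their closed linear span in \<open>H1\<close>, since
  the \<open>H1\<close> norm dominates the \<open>L2\<close> norm. By completeness of \<open>H1\<close> that span is all of \<open>H1\<close>; in
  particular it contains the test functions.\<close>
lemma neumann_eigendata_total:
  assumes \<Omega>: "open \<Omega>" and data: "neumann_eigendata \<Omega> lam f"
    and u: "u \<in> L2 (leb \<Omega>)" and orth: "\<And>k. L2_ip (leb \<Omega>) u (f k) = 0"
  shows "AE x in leb \<Omega>. u x = 0"
proof (rule AE_zero_of_test_functions[OF \<Omega> u])
  interpret H1: semi_inner_space "H1 \<Omega>" "H1_ip \<Omega>" by (rule H1_semi_inner_space[OF \<Omega>])
  have max: "maximal_orthonormal (H1 \<Omega>) (H1_ip \<Omega>) f"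
    using data by (simp add: neumann_eigendata_def)
  have fH: "f k \<in> H1 \<Omega>" for k
    using max by (simp add: maximal_orthonormal_def orthonormal_def)
  have basis: "orthonormal_basis (H1 \<Omega>) (H1_ip \<Omega>) f"
    by (rule H1.orthonormal_basis_of_complete[OF _ H1_complete[OF \<Omega>] inj_on_id])
      (use max in \<open>auto simp: maximal_orthonormal_def\<close>)
  fix h assume "h \<in> test_functions \<Omega>"
  then have h: "h \<in> H1 \<Omega>" by (rule test_function_H1[OF \<Omega>])
  have "\<bar>L2_ip (leb \<Omega>) u h\<bar> \<le> ip_norm (L2_ip (leb \<Omega>)) u * \<epsilon>" if "\<epsilon> > 0" for \<epsilon>
  proof -
    obtain a where "a \<in> finite_combinations f" and close: "ip_norm (H1_ip \<Omega>) (\<lambda>x. h x - a x) < \<epsilon>"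
      using basis h \<open>\<epsilon> > 0\<close> unfolding orthonormal_basis_def ip_dense_def by blast
    then obtain F c where a: "finite F" "a = (\<lambda>x. \<Sum>i\<in>F. c i * f i x)"
      by (auto simp: finite_combinations_def)
    have aH: "a \<in> H1 \<Omega>" unfolding a using a fH by (intro H1.sum_mem) auto
    have "L2_ip (leb \<Omega>) a u = 0"
      unfolding a using L2.ip_sum[OF a(1), of f "leb \<Omega>" u c] fH u orth L2.ip_sym[OF u]
      by (simp add: H1_L2)
    then have "L2_ip (leb \<Omega>) u h = L2_ip (leb \<Omega>) u (\<lambda>x. h x - a x)"
      using L2.ip_diff_right[OF H1_L2[OF h] H1_L2[OF aH] u] L2.ip_sym[OF u H1_L2[OF aH]] by simp
    also have "\<bar>\<dots>\<bar> \<le> ip_norm (L2_ip (leb \<Omega>)) u * ip_norm (L2_ip (leb \<Omega>)) (\<lambda>x. h x - a x)"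
      using L2.Cauchy_Schwarz[OF u H1_L2[OF H1.diff_mem[OF h aH]]] .
    also have "\<dots> \<le> ip_norm (L2_ip (leb \<Omega>)) u * \<epsilon>"
      using L2_norm_le_H1_norm(1)[OF \<Omega> H1_weak_gradient H1_L2, OF H1.diff_mem H1.diff_mem, OF h aH h aH]
        close L2.ip_norm_nonneg[OF u] by (intro mult_left_mono) auto
    finally show ?thesis .
  qed
  note bound = this
  (* The bound holds for every positive epsilon; a choice that makes it at most half the left-hand
     side, even if the norm of u is zero, gives the contradiction. *)
  have "L2_ip (leb \<Omega>) u h = 0"
  proof (rule ccontr)
    assume nz: "L2_ip (leb \<Omega>) u h \<noteq> 0"
    define N where "N = ip_norm (L2_ip (leb \<Omega>)) u"
    have N: "0 \<le> N" unfolding N_def by (rule L2.ip_norm_nonneg[OF u])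
    have "\<bar>L2_ip (leb \<Omega>) u h\<bar> \<le> N * (\<bar>L2_ip (leb \<Omega>) u h\<bar> / (2 * (N + 1)))"
      unfolding N_def using nz N by (intro bound divide_pos_pos) (auto simp: N_def)
    also have "\<dots> = (N / (N + 1)) * (\<bar>L2_ip (leb \<Omega>) u h\<bar> / 2)" by simp
    also have "\<dots> \<le> 1 * (\<bar>L2_ip (leb \<Omega>) u h\<bar> / 2)" using N by (intro mult_right_mono) auto
    finally show False using nz by simp
  qed
  then show "(\<integral>x. u x * h x \<partial>leb \<Omega>) = 0" by (simp add: L2_ip_def)
qed

section \<open>The Hilbert tensor product\<close>

lemma sum_nonzero_coefficients:
  fixes c :: "'i \<Rightarrow> real"
  assumes "finite A" "{i. c i \<noteq> 0} \<subseteq> A"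
  shows "(\<Sum>i | c i \<noteq> 0. c i * w i) = (\<Sum>i\<in>A. c i * w i)"
  using assms by (intro sum.mono_neutral_left) auto

lemma tensor_combination_lin:
  assumes "finite {i. c i \<noteq> 0}" "finite {i. d i \<noteq> 0}"
  shows "tensor_combination p q (\<lambda>i. a * c i + b * d i)
    = (\<lambda>z. a * tensor_combination p q c z + b * tensor_combination p q d z)"
proof
  fix z
  let ?A = "{i. c i \<noteq> 0} \<union> {i. d i \<noteq> 0}"
  have A: "finite ?A" using assms by simp
  show "tensor_combination p q (\<lambda>i. a * c i + b * d i) z
      = a * tensor_combination p q c z + b * tensor_combination p q d z"
    unfolding tensor_combination_def
    by (subst (1 2 3) sum_nonzero_coefficients[OF A])
      (auto simp: sum.distrib sum_distrib_left algebra_simps)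
qed

lemma tensor_combination_single:
  "tensor_combination p q (\<lambda>i. if i = (j, k) then 1 else 0) = p j \<otimes>\<^sub>f q k"
  by (simp add: tensor_combination_def)

context semi_inner_space
begin

lemma orthonormal_scale:
  assumes u: "\<And>i. u i \<in> S" and ip_u: "\<And>i j. ip (u i) (u j) = (if i = j then d i else 0)"
    and c: "\<And>i. c i * (c i * d i) = 1"
  shows "orthonormal S ip (\<lambda>i x. c i * u i x)"
proof -
  have "ip (\<lambda>x. c i * u i x) (\<lambda>x. c j * u j x) = c i * (c j * ip (u i) (u j))" for i j
    using ip_scale[OF u scale_mem[OF u]] ip_scale[OF u u] ip_sym[OF u scale_mem[OF u]] ip_sym[OF u u] by simp
  then show ?thesis
    using c by (auto simp: orthonormal_def ip_u scale_mem u)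
qed

text \<open>A complete space with an orthonormal basis indexed like the products \<open>p j \<otimes>\<^sub>f q k\<close> is a
  Hilbert tensor product as soon as the coefficients of a finite combination can be recovered from
  the combination as a function; \<open>coef\<close> does that, and the embedding replaces \<open>p j \<otimes>\<^sub>f q k\<close> by the
  basis element with the same index.\<close>
lemma hilbert_tensor_product_of_basis:
  fixes v :: "nat \<times> nat \<Rightarrow> 'x \<Rightarrow> real"
  assumes compl: "ip_complete S ip" and basis: "orthonormal_basis S ip v"
    and coef: "\<And>c. finite {i. c i \<noteq> 0} \<Longrightarrow> coef (tensor_combination p q c) = c"
  shows "\<exists>\<iota>. hilbert_tensor_product p q S ip \<iota> \<and> (\<forall>j k. \<iota> (p j \<otimes>\<^sub>f q k) = v (j, k))"
proof -
  define \<iota> where "\<iota> g = (\<lambda>x. \<Sum>i | coef g i \<noteq> 0. coef g i * v i x)" for g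
  have on: "orthonormal S ip v" and dense: "ip_dense S ip (finite_combinations v)"
    using basis by (auto simp: orthonormal_basis_def)
  have \<iota>: "\<iota> (tensor_combination p q c) = (\<lambda>x. \<Sum>i | c i \<noteq> 0. c i * v i x)" if "finite {i. c i \<noteq> 0}" for c
    by (simp add: \<iota>_def coef that)
  have "\<iota> (\<lambda>z. a * g z + b * h z) = (\<lambda>x. a * \<iota> g x + b * \<iota> h x)"
    if "g \<in> tensor_combinations p q" "h \<in> tensor_combinations p q" for g h a b
  proof -
    obtain c d where c: "finite {i. c i \<noteq> 0}" "g = tensor_combination p q c"
      and d: "finite {i. d i \<noteq> 0}" "h = tensor_combination p q d"
      using \<open>g \<in> _\<close> \<open>h \<in> _\<close> by (auto simp: tensor_combinations_def)
    let ?A = "{i. c i \<noteq> 0} \<union> {i. d i \<noteq> 0}"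
    have A: "finite ?A" using c d by simp
    have fin: "finite {i. a * c i + b * d i \<noteq> 0}" by (rule finite_subset[OF _ A]) auto
    show ?thesis
      unfolding c(2) d(2) tensor_combination_lin[OF c(1) d(1), symmetric] \<iota>[OF c(1)] \<iota>[OF d(1)] \<iota>[OF fin]
      by (subst (1 2 3) sum_nonzero_coefficients[OF A])
        (auto simp: sum.distrib sum_distrib_left algebra_simps)
  qed
  moreover have "ip (\<iota> (tensor_combination p q c)) (\<iota> (tensor_combination p q d)) = coeff_ip c d"
    if "finite {i. c i \<noteq> 0}" "finite {i. d i \<noteq> 0}" for c d
    unfolding \<iota>[OF that(1)] \<iota>[OF that(2)] ip_orthonormal_sums[OF on that] coeff_ip_def
    by (simp add: Collect_conj_eq)
  moreover have "\<iota> ` tensor_combinations p q = finite_combinations v"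
  proof (intro equalityI subsetI)
    fix g assume "g \<in> \<iota> ` tensor_combinations p q"
    then obtain c where c: "finite {i. c i \<noteq> 0}" "g = \<iota> (tensor_combination p q c)"
      by (auto simp: tensor_combinations_def)
    then show "g \<in> finite_combinations v"
      unfolding finite_combinations_def \<iota>[OF c(1)] by blast
  next
    fix g assume "g \<in> finite_combinations v"
    then obtain F c where F: "finite F" "g = (\<lambda>x. \<Sum>i\<in>F. c i * v i x)"
      by (auto simp: finite_combinations_def)
    define d where "d i = (if i \<in> F then c i else 0)" for i
    have sub: "{i. d i \<noteq> 0} \<subseteq> F" by (auto simp: d_def)
    then have fin: "finite {i. d i \<noteq> 0}" using F(1) by (rule finite_subset)
    have "\<iota> (tensor_combination p q d) = g"
      unfolding \<iota>[OF fin] F(2)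
      by (subst sum_nonzero_coefficients[OF F(1) sub]) (simp add: d_def)
    moreover have "tensor_combination p q d \<in> tensor_combinations p q"
      using fin by (auto simp: tensor_combinations_def)
    ultimately show "g \<in> \<iota> ` tensor_combinations p q" by blast
  qed
  ultimately have "hilbert_tensor_product p q S ip \<iota>"
    using compl dense by (simp add: hilbert_tensor_product_def)
  moreover have "\<iota> (p j \<otimes>\<^sub>f q k) = v (j, k)" for j k
    using \<iota>[of "\<lambda>i. if i = (j, k) then 1 else 0"] by (simp add: tensor_combination_single)
  ultimately show ?thesis by blast
qed

end

section \<open>Bases of products of Neumann eigenfunctions\<close>

theorem corollary6p3:
  fixes \<Omega>1 :: "'a::euclidean_space set" and \<Omega>2 :: "'b::euclidean_space set"
    and lam1 lam2 :: "nat \<Rightarrow> real"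
    and f1 :: "nat \<Rightarrow> 'a \<Rightarrow> real" and f2 :: "nat \<Rightarrow> 'b \<Rightarrow> real"
    and v vt :: "nat \<times> nat \<Rightarrow> 'a \<times> 'b \<Rightarrow> real"
  assumes "region \<Omega>1" and "condition_B1 \<Omega>1" and "condition_B2 \<Omega>1"
    and "region \<Omega>2" and "condition_B1 \<Omega>2" and "condition_B2 \<Omega>2"
    and "neumann_eigendata \<Omega>1 lam1 f1" and "neumann_eigendata \<Omega>2 lam2 f2"
    and "\<And>j k. v (j, k) = (\<lambda>z. sqrt ((1 + lam1 j) * (1 + lam2 k) / (1 + lam1 j + lam2 k))
                                * (f1 j \<otimes>\<^sub>f f2 k) z)"
    and "\<And>j k. vt (j, k) = (\<lambda>z. sqrt (1 + lam1 j) * sqrt (1 + lam2 k) * (f1 j \<otimes>\<^sub>f f2 k) z)"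
  shows "orthonormal_basis (H1 (\<Omega>1 \<times> \<Omega>2)) (H1_ip (\<Omega>1 \<times> \<Omega>2)) v
       \<and> orthonormal_basis (L2 (leb (\<Omega>1 \<times> \<Omega>2))) (L2_ip (leb (\<Omega>1 \<times> \<Omega>2))) vt
       \<and> (\<exists>\<iota>. hilbert_tensor_product f1 f2 (H1 (\<Omega>1 \<times> \<Omega>2)) (H1_ip (\<Omega>1 \<times> \<Omega>2)) \<iota> \<and>
             (\<forall>j k. \<iota> (f1 j \<otimes>\<^sub>f f2 k) = v (j, k)))"
proof -
  have open12: "open \<Omega>1" "open \<Omega>2"
    using \<open>region \<Omega>1\<close> \<open>region \<Omega>2\<close> by (auto simp: region_def)
  interpret product_domain \<Omega>1 \<Omega>2 using open12 by unfold_locales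
  let ?\<Omega> = "\<Omega>1 \<times> \<Omega>2"
  interpret H1: semi_inner_space "H1 ?\<Omega>" "H1_ip ?\<Omega>" by (rule H1_semi_inner_space[OF open_prod])
  have pair1: "neumann_eigenpair \<Omega>1 (lam1 j) (f1 j)" and pair2: "neumann_eigenpair \<Omega>2 (lam2 k) (f2 k)" for j k
    using assms(7,8) by (auto simp: neumann_eigendata_def)
  have f1: "f1 j \<in> H1 \<Omega>1" and f2: "f2 k \<in> H1 \<Omega>2" for j k
    using pair1[of j] pair2[of k] by (auto simp: neumann_eigenpair_def)
  have pos: "0 \<le> lam1 j" "0 \<le> lam2 k" for j k
    using neumann_eigenvalue_nonneg pair1 pair2 by blast+
  define u where "u i = f1 (fst i) \<otimes>\<^sub>f f2 (snd i)" for i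
  (* d i is the squared L2 norm of u i, and \<sigma> i is the factor between the H1 and L2 inner products
     with u i. *)
  define d where "d i = 1 / ((1 + lam1 (fst i)) * (1 + lam2 (snd i)))" for i
  define \<sigma> where "\<sigma> i = 1 + lam1 (fst i) + lam2 (snd i)" for i
  have \<sigma>: "\<sigma> i > 0" and d: "d i > 0" for i
    using pos(1)[of "fst i"] pos(2)[of "snd i"] by (auto simp: \<sigma>_def d_def)
  have unit: "sqrt (1 / t) * (sqrt (1 / t) * t) = 1" if "t > 0" for t :: real
  proof -
    have "sqrt (1 / t) * (sqrt (1 / t) * t) = (sqrt (1 / t) * sqrt (1 / t)) * t" by (simp only: mult.assoc)
    also have "\<dots> = (1 / t) * t" using that by (subst real_sqrt_mult_self) simp
    finally show ?thesis using that by simp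
  qed
  have uH: "u i \<in> H1 ?\<Omega>" for i unfolding u_def by (rule tensor_H1[OF f1 f2])
  note uL = H1_L2[OF uH]
  have L2_u: "L2_ip (leb ?\<Omega>) (u i) (u j) = (if i = j then d i else 0)" for i j
    unfolding u_def tensor_ip[OF H1_L2[OF f1] H1_L2[OF f2] H1_L2[OF f1] H1_L2[OF f2]]
      neumann_eigendata_L2_ip[OF assms(7)] neumann_eigendata_L2_ip[OF assms(8)]
    by (auto simp: d_def prod_eq_iff)
  have H1_L2_u: "H1_ip ?\<Omega> w (u i) = \<sigma> i * L2_ip (leb ?\<Omega>) w (u i)" if "w \<in> H1 ?\<Omega>" for w i
    unfolding u_def \<sigma>_def by (rule H1_ip_tensor_eigenfunctions[OF that pair1 pair2])
  have H1_u: "H1_ip ?\<Omega> (u i) (u j) = (if i = j then \<sigma> i * d i else 0)" for i j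
    by (simp add: H1_L2_u[OF uH] L2_u)
  have v: "v = (\<lambda>i z. sqrt (1 / (\<sigma> i * d i)) * u i z)"
    using assms(9) by (auto simp: fun_eq_iff u_def \<sigma>_def d_def)
  have vt: "vt = (\<lambda>i z. sqrt (1 / d i) * u i z)"
    using assms(10) by (auto simp: fun_eq_iff u_def d_def real_sqrt_mult)
  have total: "AE z in leb ?\<Omega>. w z = 0"
    if w: "w \<in> L2 (leb ?\<Omega>)" and orth: "\<And>i. L2_ip (leb ?\<Omega>) w (u i) = 0" for w
  proof -
    have "AE z in leb \<Omega>1 \<Otimes>\<^sub>M leb \<Omega>2. w z = 0"
    proof (rule tensor_total[of f1 f2])
      show "L2_ip (leb \<Omega>1 \<Otimes>\<^sub>M leb \<Omega>2) w (f1 j \<otimes>\<^sub>f f2 k) = 0" for j k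
        using orth[of "(j, k)"] by (simp add: u_def prod_eq)
    qed (use w f1 f2 neumann_eigendata_total[OF open1 assms(7)] neumann_eigendata_total[OF open2 assms(8)]
        in \<open>auto simp: prod_eq H1_L2\<close>)
    then show ?thesis unfolding prod_eq .
  qed
  have basis_H1: "orthonormal_basis (H1 ?\<Omega>) (H1_ip ?\<Omega>) v"
  proof (rule H1.orthonormal_basis_of_complete[OF _ H1_complete[OF open_prod] inj_prod_encode])
    show "orthonormal (H1 ?\<Omega>) (H1_ip ?\<Omega>) v"
      unfolding v using \<sigma> d by (intro H1.orthonormal_scale[OF uH H1_u] unit mult_pos_pos)
    fix w assume w: "w \<in> H1 ?\<Omega>" and orth: "\<And>i. H1_ip ?\<Omega> w (v i) = 0"
    have "L2_ip (leb ?\<Omega>) w (u i) = 0" for i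
    proof -
      have "H1_ip ?\<Omega> w (v i) = sqrt (1 / (\<sigma> i * d i)) * H1_ip ?\<Omega> w (u i)"
        unfolding v using H1.ip_scale[OF uH w] H1.ip_sym[OF w] H1.scale_mem[OF uH] uH by simp
      then show ?thesis using orth[of i] \<sigma>[of i] d[of i] H1_L2_u[OF w, of i] by simp
    qed
    then show "H1_ip ?\<Omega> w w = 0"
      by (intro H1_ip_AE_zero[OF open_prod w] total H1_L2[OF w])
  qed
  have basis_L2: "orthonormal_basis (L2 (leb ?\<Omega>)) (L2_ip (leb ?\<Omega>)) vt"
  proof (rule L2.orthonormal_basis_of_complete[OF _ L2_complete inj_prod_encode])
    show "orthonormal (L2 (leb ?\<Omega>)) (L2_ip (leb ?\<Omega>)) vt"
      unfolding vt using d by (intro L2.orthonormal_scale[OF uL L2_u] unit)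
    fix w assume w: "w \<in> L2 (leb ?\<Omega>)" and orth: "\<And>i. L2_ip (leb ?\<Omega>) w (vt i) = 0"
    have "L2_ip (leb ?\<Omega>) w (u i) = 0" for i
    proof -
      have "L2_ip (leb ?\<Omega>) w (vt i) = sqrt (1 / d i) * L2_ip (leb ?\<Omega>) w (u i)"
        unfolding vt using L2.ip_scale[OF uL w] L2.ip_sym[OF w] L2.scale_mem[OF uL] uL by simp
      then show ?thesis using orth[of i] d[of i] by simp
    qed
    then show "L2_ip (leb ?\<Omega>) w w = 0"
      using L2_ip_zero_iff[OF w] total[OF w] by blast
  qed
  (* Orthogonality of the u i in L2 recovers the coefficients of a finite combination. *)
  have "\<exists>\<iota>. hilbert_tensor_product f1 f2 (H1 ?\<Omega>) (H1_ip ?\<Omega>) \<iota> \<and> (\<forall>j k. \<iota> (f1 j \<otimes>\<^sub>f f2 k) = v (j, k))"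
  proof (rule H1.hilbert_tensor_product_of_basis[OF H1_complete[OF open_prod] basis_H1])
    fix c :: "nat \<times> nat \<Rightarrow> real"
    assume fin: "finite {i. c i \<noteq> 0}"
    show "(\<lambda>i. L2_ip (leb ?\<Omega>) (tensor_combination f1 f2 c) (u i) / d i) = c"
    proof
      fix i
      have "L2_ip (leb ?\<Omega>) (tensor_combination f1 f2 c) (u i)
          = (\<Sum>j | c j \<noteq> 0. c j * L2_ip (leb ?\<Omega>) (u j) (u i))"
        unfolding tensor_combination_def u_def[symmetric]
        using fin uL by (intro L2.ip_sum) auto
      also have "\<dots> = (\<Sum>j | c j \<noteq> 0. if j = i then c j * d j else 0)"
        by (intro sum.cong) (auto simp: L2_u)
      also have "\<dots> = c i * d i" using fin by simp
      finally show "L2_ip (leb ?\<Omega>) (tensor_combination f1 f2 c) (u i) / d i = c i"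
        using d[of i] by simp
    qed
  qed
  then show ?thesis using basis_H1 basis_L2 by blast
qed

end
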